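(* Suppose that $m\in O(n)$. Let $F:\{0,1\}^m\times\{0,1\}^n\to\{0,1\}^\ell$ and $g:\{0,1\}^n\to\{0,1\}^\ell$ be functions, given by quantum oracles, and write $f_i(\cdot)=F(i,\cdot)$. Assume that there is exactly one $i_0\in\{0,1\}^m$ such that $f_{i_0}\oplus g$ has a period, i.e. such that for some $s\in\{0,1\}^n\setminus\{0^n\}$ one has $(f_{i_0}\oplus g)(x)=(f_{i_0}\oplus g)(x\oplus s)$ for all $x\in\{0,1\}^n$, and assume that $$\max_{\substack{i\in\{0,1\}^m\setminus\{i_0\}\\ t\in\{0,1\}^n\setminus\{0^n\}}}\ \Pr_{x\gets\{0,1\}^n}\left[(f_i\oplus g)(x\oplus t)=(f_i\oplus g)(x)\right]\le\frac12 .$$ Let $c$ be a sufficiently large constant. Then the algorithm $\mathsf{Alg\text{-}PolyQ2}$ (with parameter $c$) finds $i_0$ with a probability in $\Theta(1)$ by making $O(n)$ quantum queries to $g$ and $O(n2^{m/2})$ quantum queries to $F$. The offline computation of $\mathsf{Alg\text{-}PolyQ2}$ (all procedures excluding those that prepare the state $|\psi_g\rangle$) is done in time $O\left((n^3+nT_F)2^{m/2}\right)$, where $T_F$ is the time required to evaluate $F$ once.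
   Context: Quantum circuit model; time is the number of elementary operations. A quantum query to a function $h$ is one application of the unitary $|x\rangle|y\rangle\mapsto|x\rangle|y\oplus h(x)\rangle$. $\Pr_{x\gets\{0,1\}^n}$ is over uniform $x$; $u\cdot x$ is the inner product modulo 2; $H$ is the Hadamard gate; $|-\rangle=\frac1{\sqrt2}(|0\rangle-|1\rangle)$; $\mathrm{Span}$ is over the field with two elements. The constant $c$ is a positive integer; how large it must be may depend on the constant implicit in $m\in O(n)$. For a function $h:\{0,1\}^n\to\{0,1\}^\ell$ put $|\psi_h\rangle=\left(2^{-n/2}\sum_{x\in\{0,1\}^n}|x\rangle|h(x)\rangle\right)^{\otimes cn}$. The unitary $\mathsf{test}$ acts on an $m$-qubit index register $|i\rangle$, $cn$ pairs of registers of $n$ and $\ell$ qubits (the registers of $|\psi_g\rangle$), and one qubit $|b\rangle$, as follows. (1) Using $cn$ queries to $F$, XOR $f_i(x_j)$ into the $\ell$-qubit register paired with $|x_j\rangle$, for each $j=1,\dots,cn$ (this maps $|i\rangle|\psi_g\rangle|b\rangle$ to $|i\rangle|\psi_{f_i\oplus g}\rangle|b\rangle$). (2) Apply $H^{\otimes n}$ to each of the $cn$ $n$-qubit registers. (3) On computational basis values $u_1,\dots,u_{cn}$ of the $n$-qubit registers, compute $d=\dim(\mathrm{Span}(u_1,\dots,u_{cn}))$, set $r=0$ if $d=n$ and $r=1$ if $d<n$, replace $b$ by $b\oplus r$, and uncompute $d$ and $r$. (4) Undo steps (2) and (1) (using $cn$ further queries to $F$). Algorithm $\mathsf{Alg\text{-}PolyQ2}$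 with parameter $c$. Online phase: prepare $|\psi_g\rangle$ with $cn$ quantum queries to $g$. Offline phase: starting from $\left(2^{-m/2}\sum_{i\in\{0,1\}^m}|i\rangle\right)\otimes|\psi_g\rangle\otimes|-\rangle$, apply $\lfloor\pi/(4\arcsin(2^{-m/2}))\rfloor=O(2^{m/2})$ Grover iterations, each iteration being $-\left((H^{\otimes m}\mathcal S_0H^{\otimes m})\otimes I\right)\mathsf{test}$, where $\mathcal S_0$ maps $|0^m\rangle$ to $-|0^m\rangle$ and fixes every other computational basis state; then measure the index register and output the result. *)

theory Defs
  imports "HOL-Probability.Probability" "HOL-Library.Z2" "HOL-Library.Function_Algebras"
begin

text \<open>A bit string of length \<open>n\<close> is a function \<open>nat \<Rightarrow> bit\<close> that vanishes from \<open>n\<close> on.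
  With the pointwise operations, \<open>+\<close> is the bitwise XOR and \<open>0\<close> is the all-zero string.\<close>

definition bits :: "nat \<Rightarrow> (nat \<Rightarrow> bit) set" where
  "bits n = {x. \<forall>i\<ge>n. x i = 0}"

interpretation f2: vector_space "\<lambda>(a::bit) (v::nat \<Rightarrow> bit) i. a * v i"
  by unfold_locales (auto simp: fun_eq_iff algebra_simps)

definition has_period :: "nat \<Rightarrow> ((nat \<Rightarrow> bit) \<Rightarrow> (nat \<Rightarrow> bit)) \<Rightarrow> bool" where
  "has_period n h \<longleftrightarrow> (\<exists>s\<in>bits n - {0}. \<forall>x\<in>bits n. h x = h (x + s))"

text \<open>Qubits. \<open>Index k\<close> is the \<open>k\<close>-th qubit of the index register, \<open>Inp j k\<close> and \<open>Outp j k\<close>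
  are the \<open>k\<close>-th qubits of the two registers of the \<open>j\<close>-th pair (pairs are counted from 0),
  \<open>Flag\<close> is the qubit \<open>b\<close>, and the qubits \<open>Work k\<close> are ancillas, initially 0.
  The supply of qubits is unlimited; those that no gate mentions stay 0.\<close>

datatype qubit = Index nat | Inp nat nat | Outp nat nat | Flag | Work nat

text \<open>Computational basis states, and states given by their amplitudes.\<close>

type_synonym config = "qubit \<Rightarrow> bit"
type_synonym state = "config \<Rightarrow> complex"

definition index_reg :: "nat \<Rightarrow> config \<Rightarrow> nat \<Rightarrow> bit" where
  "index_reg m z = (\<lambda>k. if k < m then z (Index k) else 0)"

definition inp_reg :: "nat \<Rightarrow> nat \<Rightarrow> config \<Rightarrow> nat \<Rightarrow> bit" where
  "inp_reg n j z = (\<lambda>k. if k < n then z (Inp j k) else 0)"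

definition xor_outp :: "nat \<Rightarrow> (nat \<Rightarrow> bit) \<Rightarrow> config \<Rightarrow> config" where
  "xor_outp j v z = (\<lambda>q. case q of Outp j' k \<Rightarrow> z q + (if j' = j then v k else 0) | _ \<Rightarrow> z q)"

definition zero_state :: state where
  "zero_state = (\<lambda>z. if z = (\<lambda>_. 0) then 1 else 0)"

text \<open>The unitary that maps each basis state \<open>|z\<rangle>\<close> to \<open>|\<sigma> z\<rangle>\<close>, for a bijection \<open>\<sigma>\<close>.\<close>

definition basis_map :: "(config \<Rightarrow> config) \<Rightarrow> state \<Rightarrow> state" where
  "basis_map \<sigma> \<psi> = (\<lambda>z. \<psi> (inv \<sigma> z))"

text \<open>The gates. \<open>Query_F j\<close> and \<open>Query_g j\<close> query the oracle on the \<open>j\<close>-th pair of registers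
  (for \<open>F\<close>, with the index register as its first argument).\<close>

datatype gate =
    Hadamard qubit
  | PauliX qubit
  | CNot qubit qubit
  | Toffoli qubit qubit qubit
  | is_Query_F: Query_F nat
  | is_Query_g: Query_g nat

fun elementary :: "gate \<Rightarrow> bool" where
  "elementary (Hadamard a) \<longleftrightarrow> True"
| "elementary (PauliX a) \<longleftrightarrow> True"
| "elementary (CNot a b) \<longleftrightarrow> a \<noteq> b"
| "elementary (Toffoli a b t) \<longleftrightarrow> distinct [a, b, t]"
| "elementary (Query_F j) \<longleftrightarrow> False"
| "elementary (Query_g j) \<longleftrightarrow> False"

fun apply_gate ::
  "((nat \<Rightarrow> bit) \<Rightarrow> (nat \<Rightarrow> bit) \<Rightarrow> (nat \<Rightarrow> bit)) \<Rightarrow> ((nat \<Rightarrow> bit) \<Rightarrow> (nat \<Rightarrow> bit)) \<Rightarrow>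
    nat \<Rightarrow> nat \<Rightarrow> gate \<Rightarrow> state \<Rightarrow> state" where
  "apply_gate F g m n (Hadamard a) \<psi> =
     (\<lambda>z. (\<psi> (z(a := 0)) + (if z a = 0 then 1 else - 1) * \<psi> (z(a := 1))) / complex_of_real (sqrt 2))"
| "apply_gate F g m n (PauliX a) \<psi> = basis_map (\<lambda>z. z(a := z a + 1)) \<psi>"
| "apply_gate F g m n (CNot a t) \<psi> = basis_map (\<lambda>z. z(t := z t + z a)) \<psi>"
| "apply_gate F g m n (Toffoli a b t) \<psi> = basis_map (\<lambda>z. z(t := z t + z a * z b)) \<psi>"
| "apply_gate F g m n (Query_F j) \<psi> =
     basis_map (\<lambda>z. xor_outp j (F (index_reg m z) (inp_reg n j z)) z) \<psi>"
| "apply_gate F g m n (Query_g j) \<psi> = basis_map (\<lambda>z. xor_outp j (g (inp_reg n j z)) z) \<psi>"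

definition run ::
  "((nat \<Rightarrow> bit) \<Rightarrow> (nat \<Rightarrow> bit) \<Rightarrow> (nat \<Rightarrow> bit)) \<Rightarrow> ((nat \<Rightarrow> bit) \<Rightarrow> (nat \<Rightarrow> bit)) \<Rightarrow>
    nat \<Rightarrow> nat \<Rightarrow> gate list \<Rightarrow> state \<Rightarrow> state" where
  "run F g m n C \<psi> = fold (apply_gate F g m n) C \<psi>"

definition queries_F :: "gate list \<Rightarrow> nat" where
  "queries_F C = length (filter is_Query_F C)"

definition queries_g :: "gate list \<Rightarrow> nat" where
  "queries_g C = length (filter is_Query_g C)"

text \<open>Running time, when one evaluation of \<open>F\<close> takes time \<open>T\<close>.\<close>

definition circuit_time :: "nat \<Rightarrow> gate list \<Rightarrow> nat" where
  "circuit_time T C = (\<Sum>x\<leftarrow>C. if is_Query_F x then T else 1)"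

text \<open>Probability of the outcome \<open>i\<close> when the index register is measured.\<close>

definition outcome_prob :: "nat \<Rightarrow> state \<Rightarrow> (nat \<Rightarrow> bit) \<Rightarrow> real" where
  "outcome_prob m \<psi> i = (\<Sum>\<^sub>\<infinity>z\<in>{z. index_reg m z = i}. (cmod (\<psi> z))\<^sup>2)"

text \<open>The state \<open>|\<psi>\<^sub>h\<rangle>\<close>, all qubits outside its registers being 0.\<close>

definition psi :: "nat \<Rightarrow> nat \<Rightarrow> ((nat \<Rightarrow> bit) \<Rightarrow> (nat \<Rightarrow> bit)) \<Rightarrow> state" where
  "psi c n h = (\<lambda>z.
     if (\<forall>q. z q \<noteq> 0 \<longrightarrow> (\<exists>j<c * n. (\<exists>k<n. q = Inp j k) \<or> (\<exists>k. q = Outp j k))) \<and>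
        (\<forall>j<c * n. (\<lambda>k. z (Outp j k)) = h (inp_reg n j z))
     then complex_of_real ((2 powr (- real n / 2)) ^ (c * n)) else 0)"

text \<open>The steps of the offline phase: gates, step (3) of \<open>test\<close> (with \<open>d\<close> and \<open>r\<close> already
  uncomputed), the reflection \<open>S\<^sub>0\<close> on the index register, and multiplication by \<open>-1\<close>.\<close>

datatype step = Gate gate | Rank_Flip | Reflect_Zero | Negate

fun apply_step ::
  "((nat \<Rightarrow> bit) \<Rightarrow> (nat \<Rightarrow> bit) \<Rightarrow> (nat \<Rightarrow> bit)) \<Rightarrow> ((nat \<Rightarrow> bit) \<Rightarrow> (nat \<Rightarrow> bit)) \<Rightarrow>
    nat \<Rightarrow> nat \<Rightarrow> nat \<Rightarrow> step \<Rightarrow> state \<Rightarrow> state" where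
  "apply_step F g c m n (Gate x) \<psi> = apply_gate F g m n x \<psi>"
| "apply_step F g c m n Rank_Flip \<psi> =
     basis_map (\<lambda>z. z(Flag := z Flag +
       (if f2.dim (f2.span ((\<lambda>j. inp_reg n j z) ` {..<c * n})) < n then 1 else 0))) \<psi>"
| "apply_step F g c m n Reflect_Zero \<psi> = (\<lambda>z. if index_reg m z = 0 then - \<psi> z else \<psi> z)"
| "apply_step F g c m n Negate \<psi> = (\<lambda>z. - \<psi> z)"

definition online_phase :: "nat \<Rightarrow> nat \<Rightarrow> gate list" where
  "online_phase c n =
     [Hadamard (Inp j k). j \<leftarrow> [0..<c * n], k \<leftarrow> [0..<n]] @ [Query_g j. j \<leftarrow> [0..<c * n]]"

text \<open>Each gate of steps (1) and (2) of \<open>test\<close> is its own inverse, so that they are undone by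
  the same gates in reverse order.\<close>

definition test :: "nat \<Rightarrow> nat \<Rightarrow> step list" where
  "test c n =
     (let U = [Gate (Query_F j). j \<leftarrow> [0..<c * n]] @
              [Gate (Hadamard (Inp j k)). j \<leftarrow> [0..<c * n], k \<leftarrow> [0..<n]]
      in U @ [Rank_Flip] @ rev U)"

definition grover_iteration :: "nat \<Rightarrow> nat \<Rightarrow> nat \<Rightarrow> step list" where
  "grover_iteration c n m =
     (let H = [Gate (Hadamard (Index k)). k \<leftarrow> [0..<m]]
      in test c n @ H @ [Reflect_Zero] @ H @ [Negate])"

definition grover_count :: "nat \<Rightarrow> nat" where
  "grover_count m = nat \<lfloor>pi / (4 * arcsin (2 powr (- real m / 2)))\<rfloor>"

definition offline_phase :: "nat \<Rightarrow> nat \<Rightarrow> nat \<Rightarrow> step list" where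
  "offline_phase c n m =
     [Gate (Hadamard (Index k)). k \<leftarrow> [0..<m]] @ [Gate (PauliX Flag), Gate (Hadamard Flag)] @
     concat (replicate (grover_count m) (grover_iteration c n m))"

text \<open>Realisation of the steps by circuits: a gate stands for itself, and each other step is
  carried out exactly by a circuit of elementary gates which may use ancillas, provided they are
  0 at the start and (as the equation requires) at the end.\<close>

definition clean :: "state \<Rightarrow> bool" where
  "clean \<psi> \<longleftrightarrow> (\<forall>z. \<psi> z \<noteq> 0 \<longrightarrow> (\<forall>k. z (Work k) = 0))"

definition implementation :: "nat \<Rightarrow> nat \<Rightarrow> nat \<Rightarrow> (step \<Rightarrow> gate list) \<Rightarrow> bool" where
  "implementation c n m circ \<longleftrightarrow>
     (\<forall>x. circ (Gate x) = [x]) \<and>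
     (\<forall>s\<in>{Rank_Flip, Reflect_Zero, Negate}.
        (\<forall>x\<in>set (circ s). elementary x) \<and>
        (\<forall>F g \<psi>. clean \<psi> \<longrightarrow> run F g m n (circ s) \<psi> = apply_step F g c m n s \<psi>))"

definition compile :: "(step \<Rightarrow> gate list) \<Rightarrow> step list \<Rightarrow> gate list" where
  "compile circ P = concat (map circ P)"

end

theory Submission
  imports Defs
begin

text \<open>The Hadamard transform maps the shift of an input register by \<open>t\<close> to the sign
  \<open>(-1)\<^sup>u\<^sup>\<cdot>\<^sup>t\<close>. Hence a period of \<open>f\<^sub>i \<oplus> g\<close> forces all measured \<open>u\<^sub>j\<close> to be orthogonal
  to it and the rank test never misses \<open>i\<^sub>0\<close>, while for \<open>i \<noteq> i\<^sub>0\<close> and fixed \<open>t \<noteq> 0\<close> the weight of the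
  \<open>u\<close> orthogonal to \<open>t\<close> is the squared norm of the average of the state over the shifts by \<open>t\<close>, at
  most \<open>(3/4)\<^sup>c\<^sup>n\<close>. By a union bound over \<open>t\<close>, \<open>test\<close> differs from the exact phase oracle of \<open>i\<^sub>0\<close> by at
  most \<open>2 (2\<^sup>n (3/4)\<^sup>c\<^sup>n)\<^sup>1\<^sup>/\<^sup>2\<close> in norm, errors add up over the \<open>O(2\<^sup>m\<^sup>/\<^sup>2)\<close> unitary iterations, and for
  large \<open>c\<close> the total is below \<open>1/4\<close>, whereas the exact Grover search has amplitude at
  least \<open>2\<^sup>-\<^sup>1\<^sup>/\<^sup>2\<close> on \<open>i\<^sub>0\<close>. The rank is computed by Gaussian elimination over GF(2), done in
  place by \<open>O(n\<^sup>3)\<close> reversible gates and undone afterwards.\<close>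

section \<open>States on finitely many qubits and the Hadamard transform\<close>

text \<open>The supply of qubits is infinite, so a state is a function on an uncountable set and has
  no finite norm by default. All norms are therefore taken over the configurations of one finite set
  of qubits, and each step of the offline phase is shown to keep states inside it. The ancillas are
  deliberately left outside: a state carried by the set is then \<open>clean\<close>, so the
  isometry statements that control the error also supply the side condition under which a circuit
  may replace a step. The choice of \<open>c\<close> works because every quantity is an n-th power.
  The number of iterations is at most \<open>2 powr (m/2)\<close>, hence exponential in
  \<open>n\<close> with a rate given by the constant in the bound on \<open>m\<close>; the squared
  error of one iteration is 4 times the n-th power of \<open>2 * (3/4) ^ c\<close>. A
  \<open>c\<close> fixed by that rate alone thus serves all \<open>n\<close> at once. A second
  obstacle is reversibility: elimination must overwrite its rows and vectors without losing
  information, so each pivot step records its decisions in fresh ancillas.\<close>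

declare add_bit_eq_xor [simp del] mult_bit_eq_and [simp del]

lemma bit_add_self [simp]: "a + a = (0::bit)"
  by (cases a) auto

lemma bit_fun_add_self [simp]: "x + x = (0::'a \<Rightarrow> bit)"
  by (simp add: fun_eq_iff)

lemma bit_fun_add_self_right [simp]: "x + y + y = (x::'a \<Rightarrow> bit)"
  by (simp add: add.assoc)

text \<open>Bit strings (\<open>A\<close> a set of positions) and configurations (\<open>A\<close> a
  set of qubits) are both instances, so counting and splitting are proved once.\<close>

definition vecs :: "'a set \<Rightarrow> ('a \<Rightarrow> bit) set" where
  "vecs A = {z. \<forall>q. q \<notin> A \<longrightarrow> z q = 0}"

lemma bits_eq_vecs: "bits n = vecs {..<n}"
  by (auto simp: bits_def vecs_def)

lemma bij_betw_vecs: "bij_betw (\<lambda>z. {q. z q = 1}) (vecs A) (Pow A)"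
  by (rule bij_betw_byWitness [where f' = "\<lambda>S q. if q \<in> S then 1 else 0"])
     (auto simp: vecs_def fun_eq_iff split: if_splits)

lemma finite_vecs [simp]: "finite A \<Longrightarrow> finite (vecs A)"
  using bij_betw_finite [OF bij_betw_vecs, of A] by simp

lemma card_vecs: "finite A \<Longrightarrow> card (vecs A) = 2 ^ card A"
  using bij_betw_same_card [OF bij_betw_vecs, of A] by (simp add: card_Pow)

lemma finite_bits [simp]: "finite (bits n)"
  and card_bits: "card (bits n) = 2 ^ n"
  by (simp_all add: bits_eq_vecs card_vecs)

lemma zero_in_vecs [simp]: "0 \<in> vecs A"
  and add_in_vecs: "x \<in> vecs A \<Longrightarrow> y \<in> vecs A \<Longrightarrow> x + y \<in> vecs A"
  by (auto simp: vecs_def)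

lemma zero_in_bits [simp]: "0 \<in> bits n"
  and add_in_bits: "x \<in> bits n \<Longrightarrow> y \<in> bits n \<Longrightarrow> x + y \<in> bits n"
  by (simp_all add: bits_eq_vecs add_in_vecs)

lemma vecs_empty [simp]: "vecs {} = {0}"
  by (auto simp: vecs_def fun_eq_iff)

lemma sum_vecs_insert:
  fixes f :: "('a \<Rightarrow> bit) \<Rightarrow> 'b::comm_monoid_add"
  assumes "finite A" "a \<notin> A"
  shows "(\<Sum>z\<in>vecs (insert a A). f z) = (\<Sum>z\<in>vecs A. f z) + (\<Sum>z\<in>vecs A. f (z(a := 1)))"
proof -
  have split: "vecs (insert a A) = vecs A \<union> (\<lambda>z. z(a := 1)) ` vecs A"
  proof (intro equalityI subsetI)
    fix z assume z: "z \<in> vecs (insert a A)"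
    show "z \<in> vecs A \<union> (\<lambda>z. z(a := 1)) ` vecs A"
    proof (cases "z a = 0")
      case True
      with z show ?thesis by (auto simp: vecs_def)
    next
      case False
      with z have "z = (z(a := 0))(a := 1)" "z(a := 0) \<in> vecs A"
        by (auto simp: vecs_def fun_eq_iff)
      then show ?thesis by blast
    qed
  qed (use assms in \<open>auto simp: vecs_def\<close>)
  have disj: "vecs A \<inter> (\<lambda>z. z(a := 1)) ` vecs A = {}"
    using assms by (auto simp: vecs_def)
  have "inj_on (\<lambda>z. z(a := 1)) (vecs A)"
    using assms by (auto simp: inj_on_def vecs_def fun_eq_iff) metis
  then show ?thesis
    using assms disj by (simp add: split sum.union_disjoint sum.reindex)
qed

section \<open>Characters and the Hadamard transform on a set of qubits\<close>

definition chi :: "bit \<Rightarrow> complex" where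
  "chi b = (if b = 0 then 1 else - 1)"

lemma chi_0 [simp]: "chi 0 = 1" and chi_1 [simp]: "chi 1 = - 1"
  by (simp_all add: chi_def)

lemma chi_add: "chi (a + b) = chi a * chi b"
  by (cases a; cases b) auto

lemma norm_chi [simp]: "cmod (chi a) = 1"
  by (cases a) auto

definition hgate :: "qubit \<Rightarrow> state \<Rightarrow> state" where
  "hgate a \<psi> z = (\<psi> (z(a := 0)) + chi (z a) * \<psi> (z(a := 1))) / complex_of_real (sqrt 2)"

lemma apply_Hadamard: "apply_gate F g m n (Hadamard a) = hgate a"
  by (simp add: fun_eq_iff hgate_def chi_def)

lemma sqrt2_mult_self: "complex_of_real (sqrt 2) * complex_of_real (sqrt 2) = 2"
  by (simp flip: of_real_mult)

lemma hgate_hgate [simp]: "hgate a (hgate a \<psi>) = \<psi>"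
proof
  fix z :: config
  have "z = z(a := z a)" by simp
  then show "hgate a (hgate a \<psi>) z = \<psi> z"
    by (cases "z a") (auto simp: hgate_def divide_simps sqrt2_mult_self simp del: fun_upd_triv)
qed

text \<open>A closed form that does not depend on the order of the gates; \<open>x\<close> runs over
  the old contents of \<open>A\<close>, while \<open>z\<close> holds the new ones.\<close>

definition had :: "qubit set \<Rightarrow> state \<Rightarrow> state" where
  "had A \<psi> z = (1 / complex_of_real (sqrt 2)) ^ card A *
     (\<Sum>x\<in>vecs A. chi (\<Sum>a\<in>A. x a * z a) * \<psi> (override_on z x A))"

lemma had_empty [simp]: "had {} \<psi> = \<psi>"
  by (simp add: had_def fun_eq_iff)

text \<open>Splitting the sum over \<open>vecs (insert a A)\<close> by the bit at \<open>a\<close>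
  yields the two branches of the gate; the branch with bit 1 carries the extra sign
  \<open>chi (z a)\<close>.\<close>

lemma hgate_had:
  assumes "finite A" "a \<notin> A"
  shows "hgate a (had A \<psi>) = had (insert a A) \<psi>"
proof
  fix z :: config
  have s: "(\<Sum>b\<in>A. x b * (z(a := v)) b) = (\<Sum>b\<in>A. x b * z b)" for x :: config and v
    using assms by (intro sum.cong) auto
  have s': "(\<Sum>b\<in>A. (x(a := v)) b * z b) = (\<Sum>b\<in>A. x b * z b)" for x :: config and v
    using assms by (intro sum.cong) auto
  have o0: "override_on (z(a := 0)) x A = override_on z x (insert a A)" if "x \<in> vecs A" for x
    using that assms by (auto simp: override_on_def vecs_def fun_eq_iff)
  have o1: "override_on (z(a := 1)) x A = override_on z (x(a := 1)) (insert a A)" if "x \<in> vecs A" for x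
    using that assms by (auto simp: override_on_def vecs_def fun_eq_iff)
  have x0: "x(a := 0) = x" and x1: "x a = 0" if "x \<in> vecs A" for x
    using that assms by (auto simp: vecs_def)
  let ?c = "1 / complex_of_real (sqrt 2)"
  let ?S = "\<lambda>v. \<Sum>x\<in>vecs A. chi (\<Sum>b\<in>A. x b * z b) * \<psi> (override_on z (x(a := v)) (insert a A))"
  have 0: "had A \<psi> (z(a := 0)) = ?c ^ card A * ?S 0"
    using x0 by (simp add: had_def s o0 del: fun_upd_apply cong: sum.cong)
  have 1: "had A \<psi> (z(a := 1)) = ?c ^ card A * ?S 1"
    by (simp add: had_def s o1 del: fun_upd_apply cong: sum.cong)
  have 2: "(\<Sum>x\<in>vecs A. chi (\<Sum>b\<in>insert a A. x b * z b) * \<psi> (override_on z x (insert a A))) = ?S 0"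
    using assms by (intro sum.cong) (auto simp: x0 x1)
  have 3: "(\<Sum>x\<in>vecs A. chi (\<Sum>b\<in>insert a A. (x(a := 1)) b * z b) *
      \<psi> (override_on z (x(a := 1)) (insert a A))) = chi (z a) * ?S 1"
    using assms s' by (auto simp: sum_distrib_left chi_add mult.assoc simp del: fun_upd_apply simp add: fun_upd_same)
  have "had (insert a A) \<psi> z = ?c ^ Suc (card A) * (?S 0 + chi (z a) * ?S 1)"
    unfolding had_def sum_vecs_insert [OF assms] 2 3 card_insert_disjoint [OF assms] ..
  then show "hgate a (had A \<psi>) z = had (insert a A) \<psi> z"
    unfolding hgate_def 0 1 by (simp add: field_simps)
qed

lemma fold_hgate:
  assumes "distinct qs" "finite A" "A \<inter> set qs = {}"
  shows "fold hgate qs (had A \<psi>) = had (A \<union> set qs) \<psi>"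
  using assms by (induction qs arbitrary: A) (auto simp: hgate_had Un_commute)

lemma had_eq_fold: "distinct qs \<Longrightarrow> had (set qs) \<psi> = fold hgate qs \<psi>"
  using fold_hgate [of qs "{}" \<psi>] by simp

text \<open>A list of the qubits and its reversal give the same transform, and one fold undoes the
  other gate by gate.\<close>

lemma had_had [simp]:
  assumes "finite A" shows "had A (had A \<psi>) = \<psi>"
proof -
  obtain qs where qs: "set qs = A" "distinct qs"
    using assms finite_distinct_list by blast
  have *: "fold hgate (rev qs) (fold hgate qs \<phi>) = \<phi>" for \<phi>
    by (induction qs arbitrary: \<phi>) auto
  show ?thesis
    using * qs had_eq_fold [of qs] had_eq_fold [of "rev qs"] by simp
qed

text \<open>Substitute \<open>x + w\<close> for \<open>x\<close> in the sum and use that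
  \<open>chi\<close> is multiplicative; \<open>w\<close> has to live on \<open>A\<close> for the
  substitution to stay in \<open>vecs A\<close>.\<close>

lemma had_shift:
  assumes "finite A" "w \<in> vecs A"
  shows "had A (\<lambda>z. \<psi> (z + w)) z = chi (\<Sum>a\<in>A. w a * z a) * had A \<psi> z"
proof -
  have o: "override_on z x A + w = override_on z (x + w) A" for x
    using assms by (auto simp: override_on_def vecs_def fun_eq_iff)
  have "(\<Sum>x\<in>vecs A. chi (\<Sum>a\<in>A. x a * z a) * \<psi> (override_on z (x + w) A))
      = (\<Sum>x\<in>vecs A. chi (\<Sum>a\<in>A. (x + w) a * z a) * \<psi> (override_on z x A))"
    by (rule sum.reindex_bij_witness [of _ "\<lambda>x. x + w" "\<lambda>x. x + w"]) (auto simp: add_in_vecs assms)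
  then show ?thesis
    by (simp add: had_def o ring_distribs sum.distrib chi_add sum_distrib_left mult_ac)
qed

text \<open>Applied to functions of the index register, this allows the input registers to be
  analysed for each index separately.\<close>

lemma had_mult_local:
  assumes "\<And>z x. c (override_on z x A) = c z"
  shows "had A (\<lambda>z. c z * \<psi> z) = (\<lambda>z. c z * had A \<psi> z)"
  by (simp add: had_def fun_eq_iff assms sum_distrib_left mult_ac)

lemma had_add: "had A (\<lambda>z. \<psi> z + \<phi> z) = (\<lambda>z. had A \<psi> z + had A \<phi> z)"
  by (simp add: had_def fun_eq_iff ring_distribs sum.distrib)

lemma had_scale: "had A (\<lambda>z. k * \<psi> z) = (\<lambda>z. k * had A \<psi> z)"
  by (rule had_mult_local) simp

lemma had_diff: "had A (\<lambda>z. \<psi> z - \<phi> z) = (\<lambda>z. had A \<psi> z - had A \<phi> z)"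
  by (simp add: had_def fun_eq_iff ring_distribs sum_subtractf)

section \<open>Norms and isometries on a finite set of qubits\<close>

definition supp_on :: "qubit set \<Rightarrow> state \<Rightarrow> bool" where
  "supp_on Q \<psi> \<longleftrightarrow> (\<forall>z. z \<notin> vecs Q \<longrightarrow> \<psi> z = 0)"

text \<open>This is the genuine norm only for states that satisfy \<open>supp_on Q\<close>;
  elsewhere amplitudes outside \<open>vecs Q\<close> are ignored.\<close>

definition nrm :: "qubit set \<Rightarrow> state \<Rightarrow> real" where
  "nrm Q \<psi> = L2_set (\<lambda>z. cmod (\<psi> z)) (vecs Q)"

lemma nrm_sq: "(nrm Q \<psi>)\<^sup>2 = (\<Sum>z\<in>vecs Q. (cmod (\<psi> z))\<^sup>2)"
  by (simp add: nrm_def L2_set_def sum_nonneg)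

lemma nrm_nonneg [simp]: "nrm Q \<psi> \<ge> 0"
  by (simp add: nrm_def)

lemma L2_set_cmod_triangle:
  "L2_set (\<lambda>z. cmod (\<psi> z + \<phi> z)) A \<le> L2_set (\<lambda>z. cmod (\<psi> z)) A + L2_set (\<lambda>z. cmod (\<phi> z)) A"
  by (rule order_trans [OF L2_set_mono L2_set_triangle_ineq]) (auto intro: norm_triangle_ineq)

lemma nrm_triangle: "nrm Q (\<psi> - \<phi>) \<le> nrm Q (\<psi> - \<xi>) + nrm Q (\<xi> - \<phi>)"
  using L2_set_cmod_triangle [of "\<psi> - \<xi>" "\<xi> - \<phi>" "vecs Q"] by (simp add: nrm_def)

text \<open>Compatibility with differences replaces full linearity: it is exactly what transports
  the distance between an actual and an ideal state.\<close>

definition isom :: "qubit set \<Rightarrow> (state \<Rightarrow> state) \<Rightarrow> bool" where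
  "isom Q U \<longleftrightarrow> (\<forall>\<psi>. supp_on Q \<psi> \<longrightarrow> supp_on Q (U \<psi>) \<and> nrm Q (U \<psi>) = nrm Q \<psi>) \<and>
     (\<forall>\<psi> \<phi>. U (\<psi> - \<phi>) = U \<psi> - U \<phi>)"

lemma isomD:
  assumes "isom Q U"
  shows "supp_on Q \<psi> \<Longrightarrow> supp_on Q (U \<psi>)" "supp_on Q \<psi> \<Longrightarrow> nrm Q (U \<psi>) = nrm Q \<psi>"
    "U (\<psi> - \<phi>) = U \<psi> - U \<phi>"
  using assms by (auto simp: isom_def)

lemma supp_on_diff: "supp_on Q \<psi> \<Longrightarrow> supp_on Q \<phi> \<Longrightarrow> supp_on Q (\<psi> - \<phi>)"
  by (auto simp: supp_on_def)

lemma isom_nrm_diff: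
  assumes "isom Q U" "supp_on Q \<psi>" "supp_on Q \<phi>"
  shows "nrm Q (U \<psi> - U \<phi>) = nrm Q (\<psi> - \<phi>)"
  using isomD(2,3) [OF assms(1)] supp_on_diff [OF assms(2,3)] by metis

lemma isom_id: "isom Q (\<lambda>\<psi>. \<psi>)"
  by (simp add: isom_def)

lemma isom_comp: "isom Q U \<Longrightarrow> isom Q V \<Longrightarrow> isom Q (\<lambda>\<psi>. U (V \<psi>))"
  by (simp add: isom_def)

lemma isom_fold: "(\<And>s. s \<in> set P \<Longrightarrow> isom Q (f s)) \<Longrightarrow> isom Q (fold f P)"
proof (induction P)
  case Nil
  then show ?case by (simp add: isom_id id_def)
next
  case (Cons s P)
  then show ?case using isom_comp [of Q "fold f P" "f s"] by (simp add: comp_def)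
qed

lemma inv_involution: "(\<And>z. \<sigma> (\<sigma> z) = z) \<Longrightarrow> inv \<sigma> = \<sigma>"
  by (rule inv_equality) auto

lemma isom_reindex:
  assumes inv: "\<And>z. \<sigma> (\<sigma> z) = z" and Q: "\<And>z. z \<in> vecs Q \<Longrightarrow> \<sigma> z \<in> vecs Q"
  shows "isom Q (\<lambda>\<psi> z. \<psi> (\<sigma> z))"
proof -
  have "nrm Q (\<lambda>z. \<psi> (\<sigma> z)) = nrm Q \<psi>" for \<psi>
    unfolding nrm_def L2_set_def
    by (intro arg_cong [where f = sqrt] sum.reindex_bij_witness [of _ \<sigma> \<sigma>]) (auto simp: inv Q)
  moreover have "supp_on Q (\<lambda>z. \<psi> (\<sigma> z))" if "supp_on Q \<psi>" for \<psi>
    using that unfolding supp_on_def by (metis inv Q)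
  ultimately show ?thesis by (auto simp: isom_def fun_eq_iff)
qed

lemma parallelogram_cmod:
  "(cmod ((a + b) / complex_of_real (sqrt 2)))\<^sup>2 + (cmod ((a - b) / complex_of_real (sqrt 2)))\<^sup>2
    = (cmod a)\<^sup>2 + (cmod b)\<^sup>2"
  unfolding norm_divide power_divide norm_of_real cmod_power2
  by (simp add: power2_sum power2_diff add_divide_distrib diff_divide_distrib)

text \<open>Pair the configurations that differ only at \<open>a\<close>; on each pair the gate
  preserves the sum of squares by the parallelogram identity.\<close>

lemma isom_hgate:
  assumes "finite Q" "a \<in> Q"
  shows "isom Q (hgate a)"
proof -
  let ?A = "Q - {a}"
  have Q: "Q = insert a ?A" "finite ?A" "a \<notin> ?A" using assms by auto
  have "(nrm Q (hgate a \<psi>))\<^sup>2 = (nrm Q \<psi>)\<^sup>2" for \<psi>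
  proof -
    have x0: "z a = 0" "z(a := 0) = z" if "z \<in> vecs ?A" for z
      using that by (auto simp: vecs_def)
    have "(cmod (hgate a \<psi> z))\<^sup>2 + (cmod (hgate a \<psi> (z(a := 1))))\<^sup>2
        = (cmod (\<psi> z))\<^sup>2 + (cmod (\<psi> (z(a := 1))))\<^sup>2" if "z \<in> vecs ?A" for z
      using parallelogram_cmod [of "\<psi> z" "\<psi> (z(a := 1))"] by (simp add: hgate_def x0 [OF that])
    then have "(\<Sum>z\<in>vecs (insert a ?A). (cmod (hgate a \<psi> z))\<^sup>2) = (\<Sum>z\<in>vecs (insert a ?A). (cmod (\<psi> z))\<^sup>2)"
      unfolding sum_vecs_insert [OF Q(2,3)] sum.distrib [symmetric] by (rule sum.cong [OF refl])
    then show ?thesis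
      unfolding nrm_sq using Q(1) by simp
  qed
  then have "nrm Q (hgate a \<psi>) = nrm Q \<psi>" for \<psi>
    by (metis nrm_nonneg power2_eq_iff_nonneg)
  moreover have "supp_on Q (hgate a \<psi>)" if "supp_on Q \<psi>" for \<psi>
    unfolding supp_on_def
  proof (intro allI impI)
    fix z assume "z \<notin> vecs Q"
    then have "z(a := v) \<notin> vecs Q" for v using assms by (auto simp: vecs_def)
    then show "hgate a \<psi> z = 0" using that by (simp add: supp_on_def hgate_def)
  qed
  ultimately show ?thesis
    by (auto simp: isom_def fun_eq_iff hgate_def diff_divide_distrib add_divide_distrib ring_distribs)
qed

lemma isom_had: "finite Q \<Longrightarrow> A \<subseteq> Q \<Longrightarrow> isom Q (had A)"
proof -
  assume Q: "finite Q" "A \<subseteq> Q"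
  then obtain qs where qs: "set qs = A" "distinct qs"
    using finite_distinct_list finite_subset by metis
  then have "had A = fold hgate qs" using had_eq_fold by auto
  moreover have "isom Q (fold hgate qs)"
    using Q qs by (intro isom_fold isom_hgate) auto
  ultimately show ?thesis by simp
qed

section \<open>Registers, queries and shifts\<close>

lemma in_bits: "x \<in> bits n \<longleftrightarrow> (\<forall>k. k < n \<or> x k = 0)"
  unfolding bits_def mem_Collect_eq by (metis leD leI)

lemma bits_eq_0: "x \<in> bits n \<Longrightarrow> n \<le> k \<Longrightarrow> x k = 0"
  by (simp add: bits_def)

lemma basis_map_involution: "(\<And>z. \<sigma> (\<sigma> z) = z) \<Longrightarrow> basis_map \<sigma> \<psi> = (\<lambda>z. \<psi> (\<sigma> z))"
  by (simp add: basis_map_def inv_involution)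

lemma index_reg_in_bits [simp]: "index_reg m z \<in> bits m"
  and inp_reg_in_bits [simp]: "inp_reg n j z \<in> bits n"
  by (auto simp: index_reg_def inp_reg_def bits_def)

lemma xor_outp_simps [simp]:
  "xor_outp j v z (Index k) = z (Index k)"
  "xor_outp j v z (Inp j' k) = z (Inp j' k)"
  "xor_outp j v z (Outp j' k) = z (Outp j' k) + (if j' = j then v k else 0)"
  "xor_outp j v z Flag = z Flag"
  "xor_outp j v z (Work k) = z (Work k)"
  "index_reg m (xor_outp j v z) = index_reg m z"
  "inp_reg n i (xor_outp j v z) = inp_reg n i z"
  by (simp_all add: xor_outp_def index_reg_def inp_reg_def cong: if_cong)

lemma config_eqI:
  assumes "\<And>k. z (Index k) = z' (Index k)" "\<And>j k. z (Inp j k) = z' (Inp j k)"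
    "\<And>j k. z (Outp j k) = z' (Outp j k)" "z Flag = z' Flag" "\<And>k. z (Work k) = z' (Work k)"
  shows "z = z'"
proof
  show "z q = z' q" for q using assms by (cases q) auto
qed

lemma xor_outp_xor_outp [simp]: "xor_outp j v (xor_outp j v z) = z"
  by (rule config_eqI) (auto simp: add.assoc)

lemma apply_Query_F:
  "apply_gate F g m n (Query_F j) \<psi> = (\<lambda>z. \<psi> (xor_outp j (F (index_reg m z) (inp_reg n j z)) z))"
  by (simp add: basis_map_involution)

lemma apply_Query_g:
  "apply_gate F g m n (Query_g j) \<psi> = (\<lambda>z. \<psi> (xor_outp j (g (inp_reg n j z)) z))"
  by (simp add: basis_map_involution)

lemma apply_PauliX: "apply_gate F g m n (PauliX a) \<psi> = (\<lambda>z. \<psi> (z(a := z a + 1)))"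
  by (simp add: basis_map_involution add.assoc)

definition rank_flip :: "nat \<Rightarrow> nat \<Rightarrow> config \<Rightarrow> config" where
  "rank_flip c n z = z(Flag := z Flag +
     (if f2.dim (f2.span ((\<lambda>j. inp_reg n j z) ` {..<c * n})) < n then 1 else 0))"

lemma inp_reg_upd_Flag [simp]: "inp_reg n j (z(Flag := v)) = inp_reg n j z"
  by (auto simp: inp_reg_def)

lemma apply_Rank_Flip: "apply_step F g c m n Rank_Flip \<psi> = (\<lambda>z. \<psi> (rank_flip c n z))"
  by (simp add: rank_flip_def [abs_def] basis_map_involution add.assoc)

lemmas apply_gate_simps = apply_Hadamard apply_Query_F apply_Query_g apply_PauliX

declare apply_gate.simps [simp del] apply_step.simps(2) [simp del]

definition xor_all ::
  "nat \<Rightarrow> nat \<Rightarrow> nat \<Rightarrow> ((nat \<Rightarrow> bit) \<Rightarrow> (nat \<Rightarrow> bit) \<Rightarrow> (nat \<Rightarrow> bit)) \<Rightarrow> config \<Rightarrow> config" where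
  "xor_all m n k f z = (\<lambda>q. case q of
     Outp j i \<Rightarrow> z q + (if j < k then f (index_reg m z) (inp_reg n j z) i else 0) | _ \<Rightarrow> z q)"

lemma xor_all_simps [simp]:
  "xor_all m n N f z (Index k) = z (Index k)"
  "xor_all m n N f z (Inp j k) = z (Inp j k)"
  "xor_all m n N f z (Outp j k) = z (Outp j k) + (if j < N then f (index_reg m z) (inp_reg n j z) k else 0)"
  "xor_all m n N f z Flag = z Flag"
  "xor_all m n N f z (Work k) = z (Work k)"
  "index_reg m (xor_all m n N f z) = index_reg m z"
  "inp_reg n j (xor_all m n N f z) = inp_reg n j z"
  by (simp_all add: xor_all_def index_reg_def inp_reg_def cong: if_cong)

text \<open>Queries write to different output registers and never change their arguments, so they
  merge into a single XOR. With \<open>f\<close> constant in its first argument the lemma also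
  covers the queries to \<open>g\<close>.\<close>

lemma fold_queries:
  "fold (\<lambda>j \<psi> z. \<psi> (xor_outp j (f (index_reg m z) (inp_reg n j z)) z)) [0..<k] \<psi>
     = (\<lambda>z. \<psi> (xor_all m n k f z))"
proof (induction k)
  case 0
  have "xor_all m n 0 f z = z" for z by (rule config_eqI) auto
  then show ?case by simp
next
  case (Suc k)
  have "xor_all m n k f (xor_outp k (f (index_reg m z) (inp_reg n k z)) z) = xor_all m n (Suc k) f z" for z
    by (rule config_eqI) (auto simp: less_Suc_eq)
  then show ?case by (simp add: Suc)
qed

definition inps :: "nat \<Rightarrow> nat \<Rightarrow> qubit set" where
  "inps n N = (\<lambda>(j, k). Inp j k) ` ({..<N} \<times> {..<n})"

definition idx :: "nat \<Rightarrow> qubit set" where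
  "idx m = Index ` {..<m}"

text \<open>No \<open>Work\<close> qubit belongs to this set, so support on it implies
  \<open>clean\<close>.\<close>

definition qubits :: "nat \<Rightarrow> nat \<Rightarrow> nat \<Rightarrow> nat \<Rightarrow> qubit set" where
  "qubits m n l N = idx m \<union> inps n N \<union> (\<lambda>(j, k). Outp j k) ` ({..<N} \<times> {..<l}) \<union> {Flag}"

lemma finite_inps [simp]: "finite (inps n N)" and finite_idx [simp]: "finite (idx m)"
  and finite_qubits [simp]: "finite (qubits m n l N)"
  by (simp_all add: inps_def idx_def qubits_def)

lemma in_qubits [simp]:
  "Index k \<in> qubits m n l N \<longleftrightarrow> k < m"
  "Inp j k \<in> qubits m n l N \<longleftrightarrow> j < N \<and> k < n"
  "Outp j k \<in> qubits m n l N \<longleftrightarrow> j < N \<and> k < l"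
  "Flag \<in> qubits m n l N" "Work k \<notin> qubits m n l N"
  by (auto simp: qubits_def inps_def idx_def)

lemma in_vecs_qubits:
  "z \<in> vecs (qubits m n l N) \<longleftrightarrow>
     (\<forall>k. k < m \<or> z (Index k) = 0) \<and> (\<forall>j k. j < N \<and> k < n \<or> z (Inp j k) = 0) \<and>
     (\<forall>j k. j < N \<and> k < l \<or> z (Outp j k) = 0) \<and> (\<forall>k. z (Work k) = 0)" (is "?L \<longleftrightarrow> ?R")
proof
  assume ?L
  then have "q \<notin> qubits m n l N \<Longrightarrow> z q = 0" for q by (simp add: vecs_def)
  then show ?R by (meson in_qubits)
next
  assume R: ?R
  show ?L unfolding vecs_def
  proof (intro CollectI allI impI)
    show "z q = 0" if "q \<notin> qubits m n l N" for q
      using R that by (cases q) auto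
  qed
qed

definition outp :: "nat \<Rightarrow> config \<Rightarrow> nat \<Rightarrow> bit" where
  "outp j z = (\<lambda>k. z (Outp j k))"

lemma outp_in_bits: "z \<in> vecs (qubits m n l N) \<Longrightarrow> outp j z \<in> bits l"
  by (auto simp: in_vecs_qubits outp_def bits_def) (metis leD)

lemma UNIV_bit: "(UNIV :: bit set) = {0, 1}"
  by auto

text \<open>Fubini for configurations: one of them amounts to an index string, a flag and
  \<open>N\<close> pairs of strings, as the mutually inverse \<open>mk\<close> and \<open>un\<close>
  show. The factor 2 counts the values of the flag.\<close>

lemma sum_configs:
  fixes f :: "nat \<Rightarrow> (nat \<Rightarrow> bit) \<Rightarrow> (nat \<Rightarrow> bit) \<Rightarrow> (nat \<Rightarrow> bit) \<Rightarrow> real"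
  shows "(\<Sum>z\<in>vecs (qubits m n l N). a (index_reg m z) *
            (\<Prod>j<N. f j (index_reg m z) (inp_reg n j z) (outp j z)))
       = 2 * (\<Sum>i\<in>bits m. a i * (\<Prod>j<N. \<Sum>x\<in>bits n. \<Sum>y\<in>bits l. f j i x y))"
proof -
  define mk :: "(nat \<Rightarrow> bit) \<times> bit \<times> (nat \<Rightarrow> (nat \<Rightarrow> bit) \<times> (nat \<Rightarrow> bit)) \<Rightarrow> config" where
    "mk = (\<lambda>(i, b, h) q. case q of Index k \<Rightarrow> i k | Inp j k \<Rightarrow> if j < N then fst (h j) k else 0
        | Outp j k \<Rightarrow> if j < N then snd (h j) k else 0 | Flag \<Rightarrow> b | Work k \<Rightarrow> 0)"
  define un :: "config \<Rightarrow> (nat \<Rightarrow> bit) \<times> bit \<times> (nat \<Rightarrow> (nat \<Rightarrow> bit) \<times> (nat \<Rightarrow> bit))" where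
    "un z = (index_reg m z, z Flag, \<lambda>j\<in>{..<N}. (inp_reg n j z, outp j z))" for z
  let ?X = "bits m \<times> (UNIV :: bit set) \<times> (\<Pi>\<^sub>E j\<in>{..<N}. bits n \<times> bits l)"
  have mk_simps: "mk (i, b, h) (Index k) = i k"
      "mk (i, b, h) (Inp j k) = (if j < N then fst (h j) k else 0)"
      "mk (i, b, h) (Outp j k) = (if j < N then snd (h j) k else 0)"
      "mk (i, b, h) Flag = b" "mk (i, b, h) (Work k) = 0" for i b h j k
    by (simp_all add: mk_def)
  have mk_un: "mk (un z) = z" if "z \<in> vecs (qubits m n l N)" for z
    by (rule config_eqI)
       (use that in \<open>auto simp: mk_simps un_def in_vecs_qubits index_reg_def inp_reg_def outp_def\<close>)
  have un_in: "un z \<in> ?X" if "z \<in> vecs (qubits m n l N)" for z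
    using that by (auto simp: un_def outp_in_bits)
  have mk_in: "mk s \<in> vecs (qubits m n l N)" if "s \<in> ?X" for s
  proof -
    obtain i b h where s: "s = (i, b, h)" by (cases s)
    with that have "i \<in> bits m" "\<And>j. j < N \<Longrightarrow> fst (h j) \<in> bits n \<and> snd (h j) \<in> bits l"
      by (auto simp: PiE_iff mem_Times_iff)
    then show ?thesis
      unfolding s in_vecs_qubits mk_simps in_bits by auto
  qed
  have regs: "index_reg m (mk (i, b, h)) = i" "\<And>j. j < N \<Longrightarrow> inp_reg n j (mk (i, b, h)) = fst (h j)"
      "\<And>j. j < N \<Longrightarrow> outp j (mk (i, b, h)) = snd (h j)" "mk (i, b, h) Flag = b" if "(i, b, h) \<in> ?X" for i b h
    using that
    by (auto simp: mk_simps index_reg_def inp_reg_def outp_def PiE_iff mem_Times_iff bits_def fun_eq_iff)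
  have un_mk: "un (mk s) = s" if "s \<in> ?X" for s
  proof -
    obtain i b h where s: "s = (i, b, h)" by (cases s)
    have "(\<lambda>j\<in>{..<N}. (fst (h j), snd (h j))) = h"
      using that s by (auto simp: PiE_def extensional_def restrict_def fun_eq_iff)
    then show ?thesis
      using regs that unfolding s un_def by (auto cong: restrict_cong)
  qed
  have "(\<Sum>z\<in>vecs (qubits m n l N). a (index_reg m z) *
            (\<Prod>j<N. f j (index_reg m z) (inp_reg n j z) (outp j z)))
      = (\<Sum>(i, b, h)\<in>?X. a i * (\<Prod>j<N. f j i (fst (h j)) (snd (h j))))"
  proof (rule sum.reindex_bij_witness [of _ mk un])
    show "(case un z of (i, b, h) \<Rightarrow> a i * (\<Prod>j<N. f j i (fst (h j)) (snd (h j)))) =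
      a (index_reg m z) * (\<Prod>j<N. f j (index_reg m z) (inp_reg n j z) (outp j z))" for z
      by (simp add: un_def)
  qed (erule mk_un un_in mk_in un_mk)+
  also have "\<dots> = (\<Sum>i\<in>bits m. \<Sum>b\<in>(UNIV :: bit set). \<Sum>h\<in>(\<Pi>\<^sub>E j\<in>{..<N}. bits n \<times> bits l).
      a i * (\<Prod>j<N. f j i (fst (h j)) (snd (h j))))"
    by (simp add: sum.cartesian_product case_prod_beta del: sum_constant)
  also have "\<dots> = (\<Sum>i\<in>bits m. 2 * (a i * (\<Prod>j<N. \<Sum>p\<in>bits n \<times> bits l. f j i (fst p) (snd p))))"
    by (simp add: UNIV_bit prod_sum_PiE sum_distrib_left)
  also have "\<dots> = 2 * (\<Sum>i\<in>bits m. a i * (\<Prod>j<N. \<Sum>x\<in>bits n. \<Sum>y\<in>bits l. f j i x y))"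
    by (simp add: sum_distrib_left sum.cartesian_product case_prod_beta)
  finally show ?thesis .
qed

section \<open>Inner products and rank over the field with two elements\<close>

definition dot :: "nat \<Rightarrow> (nat \<Rightarrow> bit) \<Rightarrow> (nat \<Rightarrow> bit) \<Rightarrow> bit" where
  "dot n t u = (\<Sum>k<n. t k * u k)"

lemma sum_fun_apply: "(\<Sum>a\<in>A. f a) x = (\<Sum>a\<in>A. f a x)" for f :: "'a \<Rightarrow> 'b \<Rightarrow> 'c::comm_monoid_add"
  by (induction A rule: infinite_finite_induct) auto

definition unit_vec :: "nat \<Rightarrow> nat \<Rightarrow> bit" where
  "unit_vec k = (\<lambda>i. if i = k then 1 else 0)"

lemma sum_units: "u \<in> bits n \<Longrightarrow> u = (\<Sum>k<n. (\<lambda>i. u k * unit_vec k i))"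
  by (rule ext) (auto simp: sum_fun_apply unit_vec_def if_distrib bits_eq_0 cong: if_cong)

lemma dot_unit: "k < n \<Longrightarrow> dot n t (unit_vec k) = t k"
  by (simp add: dot_def unit_vec_def if_distrib cong: if_cong)

lemma subspace_orthogonal: "f2.subspace {u. dot n t u = 0}"
  by (auto simp: f2.subspace_def dot_def distrib_left sum.distrib mult.left_commute simp flip: sum_distrib_left)

lemma orthogonal_span:
  assumes "\<forall>u\<in>S. dot n t u = 0" "u \<in> f2.span S"
  shows "dot n t u = 0"
  using f2.span_minimal [OF _ subspace_orthogonal, of S n t] assms by auto

lemma bits_subset_span_units: "bits n \<subseteq> f2.span (unit_vec ` {..<n})"
proof
  fix u assume "u \<in> bits n"
  then show "u \<in> f2.span (unit_vec ` {..<n})"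
    by (subst sum_units) (auto intro!: f2.span_sum f2.span_scale intro: f2.span_base)
qed

lemma inj_unit: "inj unit_vec"
  by (auto simp: inj_def unit_vec_def fun_eq_iff)

lemma independent_units: "f2.independent (unit_vec ` A)"
  unfolding f2.dependent_def
proof safe
  fix k assume "k \<in> A" and span: "unit_vec k \<in> f2.span (unit_vec ` A - {unit_vec k})"
  have "f2.subspace {v. v k = 0}" by (auto simp: f2.subspace_def)
  moreover have "unit_vec ` A - {unit_vec k} \<subseteq> {v. v k = 0}" by (auto simp: unit_vec_def fun_eq_iff)
  ultimately have "unit_vec k \<in> {v. v k = 0}" using f2.span_minimal span by blast
  then show False by (simp add: unit_vec_def)
qed

text \<open>If a basis of the span has fewer than \<open>n\<close> vectors, some unit vector lies
  outside it, and a functional that is 1 there and 0 on the basis yields \<open>t\<close>.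
  Conversely \<open>t k \<noteq> 0\<close> keeps the \<open>k\<close>-th unit vector out of the
  span, so the basis can be enlarged inside an \<open>n\<close>-dimensional space.\<close>

lemma rank_deficient_iff:
  assumes "S \<subseteq> bits n"
  shows "f2.dim (f2.span S) < n \<longleftrightarrow> (\<exists>t\<in>bits n - {0}. \<forall>u\<in>S. dot n t u = 0)"
proof -
  let ?E = "unit_vec ` {..<n}"
  have E: "finite ?E" "card ?E = n" "S \<subseteq> f2.span ?E"
    using assms bits_subset_span_units by (auto simp: card_image inj_on_subset [OF inj_unit])
  obtain B where B: "B \<subseteq> f2.span S" "f2.independent B" "f2.span S \<subseteq> f2.span B" "card B = f2.dim (f2.span S)"
    using f2.basis_exists by metis
  have "B \<subseteq> f2.span ?E" using B(1) E(3) f2.span_minimal f2.subspace_span by blast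
  with B(2) E(1) have finB: "finite B" using f2.independent_span_bound by blast
  show ?thesis
  proof
    assume "f2.dim (f2.span S) < n"
    have "\<not> ?E \<subseteq> f2.span B"
      using f2.independent_span_bound [OF finB independent_units, of "{..<n}"] \<open>f2.dim _ < n\<close> B(4) E(2) by auto
    then obtain k where k: "k < n" "unit_vec k \<notin> f2.span B" by auto
    then have ind: "f2.independent (insert (unit_vec k) B)" using B(2) by (intro f2.independent_insertI)
    \<comment> \<open>The field is viewed as a vector space over itself, so that functionals are
      linear maps and can be extended from an independent set.\<close>
    interpret b: vector_space "(*) :: bit \<Rightarrow> bit \<Rightarrow> bit"
      by unfold_locales (simp_all add: distrib_left distrib_right mult.assoc)
    interpret p: vector_space_pair "\<lambda>(a::bit) (v::nat \<Rightarrow> bit) i. a * v i" "(*) :: bit \<Rightarrow> bit \<Rightarrow> bit" ..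
    obtain f where f: "Vector_Spaces.linear (\<lambda>(a::bit) (v::nat \<Rightarrow> bit) i. a * v i) (*) f"
        "\<forall>v\<in>insert (unit_vec k) B. f v = (if v = unit_vec k then 1 else 0 :: bit)"
      using p.linear_independent_extend [OF ind, of "\<lambda>v. if v = unit_vec k then 1 else 0"] by blast
    interpret f: Vector_Spaces.linear "\<lambda>(a::bit) (v::nat \<Rightarrow> bit) i. a * v i" "(*) :: bit \<Rightarrow> bit \<Rightarrow> bit" f
      by (rule f(1))
    \<comment> \<open>On \<open>bits n\<close> a functional is the inner product with the vector of
      its values on the unit vectors.\<close>
    define t where "t j = (if j < n then f (unit_vec j) else 0)" for j
    have t: "dot n t u = f u" if "u \<in> bits n" for u
    proof -
      have "f u = (\<Sum>k<n. f (\<lambda>i. u k * unit_vec k i))"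
        by (subst sum_units [OF that]) (rule f.sum)
      then show ?thesis by (simp add: f.scale dot_def t_def mult.commute)
    qed
    have "unit_vec k \<notin> B" using k(2) f2.span_base by blast
    then have "f u = 0" if "u \<in> B" for u using f(2) that by auto
    then have "f u = 0" if "u \<in> f2.span B" for u
      using f.eq_0_on_span that by blast
    moreover have "S \<subseteq> f2.span B" using B(3) f2.span_superset by blast
    ultimately have "\<forall>u\<in>S. dot n t u = 0" using t assms by (metis subsetD)
    moreover have "t \<in> bits n - {0}"
      using k(1) f(2) by (auto simp: bits_def t_def fun_eq_iff)
    ultimately show "\<exists>t\<in>bits n - {0}. \<forall>u\<in>S. dot n t u = 0" by blast
  next
    assume "\<exists>t\<in>bits n - {0}. \<forall>u\<in>S. dot n t u = 0"
    then obtain t where t: "t \<in> bits n" "t \<noteq> 0" "\<forall>u\<in>S. dot n t u = 0" by blast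
    then obtain k where k: "t k \<noteq> 0" by (force simp: fun_eq_iff)
    with t(1) have "k < n" by (auto simp: in_bits)
    then have "unit_vec k \<notin> f2.span S"
      using k orthogonal_span [OF t(3)] dot_unit by metis
    then have "unit_vec k \<notin> f2.span B"
      using B(1) f2.span_minimal f2.subspace_span by blast
    then have "f2.independent (insert (unit_vec k) B)" "unit_vec k \<notin> B"
      using f2.independent_insertI [OF _ B(2)] f2.span_base by blast+
    moreover have "insert (unit_vec k) B \<subseteq> f2.span ?E"
      using \<open>B \<subseteq> f2.span ?E\<close> \<open>k < n\<close> by (auto intro: f2.span_base)
    ultimately have "card (insert (unit_vec k) B) \<le> card ?E"
      using f2.independent_span_bound [OF E(1)] by blast
    then show "f2.dim (f2.span S) < n"
      using \<open>unit_vec k \<notin> B\<close> finB B(4) E(2) by simp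
  qed
qed

section \<open>Shifts of input registers and averages over them\<close>

definition inp_shift :: "nat \<Rightarrow> (nat \<Rightarrow> bit) \<Rightarrow> config" where
  "inp_shift j t = (\<lambda>q. case q of Inp j' k \<Rightarrow> if j' = j then t k else 0 | _ \<Rightarrow> 0)"

lemma inp_shift_simps [simp]:
  "inp_shift j t (Index k) = 0" "inp_shift j t (Inp j' k) = (if j' = j then t k else 0)"
  "inp_shift j t (Outp j' k) = 0" "inp_shift j t Flag = 0" "inp_shift j t (Work k) = 0"
  "index_reg m (z + inp_shift j t) = index_reg m z" "outp i (z + inp_shift j t) = outp i z"
  by (auto simp: inp_shift_def index_reg_def outp_def)

lemma inp_reg_shift: "t \<in> bits n \<Longrightarrow> inp_reg n i (z + inp_shift j t) = (if i = j then inp_reg n i z + t else inp_reg n i z)"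
  by (auto simp: inp_reg_def bits_def fun_eq_iff)

lemma shift_in_vecs_inps: "t \<in> bits n \<Longrightarrow> j < N \<Longrightarrow> inp_shift j t \<in> vecs (inps n N)"
  unfolding vecs_def
proof (intro CollectI allI impI)
  fix q assume "t \<in> bits n" "j < N" "q \<notin> inps n N"
  then show "inp_shift j t q = 0"
    by (cases q) (auto simp: inps_def bits_def image_iff not_less)
qed

lemma sum_inps: "(\<Sum>q\<in>inps n N. f q) = (\<Sum>j<N. \<Sum>k<n. f (Inp j k))"
  unfolding inps_def by (subst sum.reindex) (auto simp: inj_on_def sum.cartesian_product case_prod_beta)

lemma sum_shift_inps:
  assumes "j < N"
  shows "(\<Sum>q\<in>inps n N. inp_shift j t q * z q) = dot n t (inp_reg n j z)"
proof -
  have "(\<Sum>q\<in>inps n N. inp_shift j t q * z q) = (\<Sum>i<N. if i = j then \<Sum>k<n. t k * z (Inp j k) else 0)"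
    unfolding sum_inps by (intro sum.cong) auto
  then show ?thesis using assms by (simp add: dot_def inp_reg_def)
qed

definition avg :: "(nat \<Rightarrow> bit) \<Rightarrow> nat \<Rightarrow> state \<Rightarrow> state" where
  "avg t j \<psi> z = (\<psi> z + \<psi> (z + inp_shift j t)) / 2"

text \<open>The Hadamard transform turns a shift of an input register into a sign, hence the
  average over a shift into the projection to the strings orthogonal to it.\<close>

lemma had_avg:
  assumes "t \<in> bits n" "j < N"
  shows "had (inps n N) (avg t j \<psi>) z = (if dot n t (inp_reg n j z) = 0 then had (inps n N) \<psi> z else 0)"
proof -
  have "avg t j \<psi> = (\<lambda>z. (1/2) * (\<psi> z + \<psi> (z + inp_shift j t)))"
    by (simp add: avg_def fun_eq_iff)
  then have "had (inps n N) (avg t j \<psi>) z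
      = (1/2) * (had (inps n N) \<psi> z + chi (dot n t (inp_reg n j z)) * had (inps n N) \<psi> z)"
    using assms by (simp only: had_scale had_add had_shift [OF finite_inps shift_in_vecs_inps] sum_shift_inps)
  then show ?thesis by (cases "dot n t (inp_reg n j z)") auto
qed

text \<open>Averaging over the same \<open>t\<close> in every register becomes the projection to the
  event that all strings are orthogonal to \<open>t\<close>. This is the event to which the union
  bound over \<open>t\<close> is applied.\<close>

lemma had_fold_avg:
  assumes "t \<in> bits n" "k \<le> N"
  shows "had (inps n N) (fold (avg t) [0..<k] \<psi>) z =
     (if \<forall>j<k. dot n t (inp_reg n j z) = 0 then had (inps n N) \<psi> z else 0)"
  using assms(2)
proof (induction k)
  case (Suc k)
  then show ?case using assms(1) by (auto simp: had_avg less_Suc_eq)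
qed simp

definition graph :: "('i \<Rightarrow> (nat \<Rightarrow> bit) \<Rightarrow> (nat \<Rightarrow> bit)) \<Rightarrow> 'i \<Rightarrow> (nat \<Rightarrow> bit) \<Rightarrow> (nat \<Rightarrow> bit) \<Rightarrow> complex" where
  "graph h i x y = (if y = h i x then 1 else 0)"

section \<open>Product states with an index register\<close>

context
  fixes m n l N :: nat
begin

abbreviation Q :: "qubit set" where "Q \<equiv> qubits m n l N"

text \<open>States with index amplitudes \<open>a\<close>, flag \<open>|-\<rangle>\<close>, and the \<open>j\<close>-th pair of registers in the
  (not normalised) state with amplitudes \<open>f j i\<close> when the index is \<open>i\<close>.\<close>

definition st :: "((nat \<Rightarrow> bit) \<Rightarrow> complex) \<Rightarrow>
    (nat \<Rightarrow> (nat \<Rightarrow> bit) \<Rightarrow> (nat \<Rightarrow> bit) \<Rightarrow> (nat \<Rightarrow> bit) \<Rightarrow> complex) \<Rightarrow> state" where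
  "st a f z = (if z \<in> vecs Q
     then complex_of_real ((2 powr (- real n / 2)) ^ N / sqrt 2) * chi (z Flag) * a (index_reg m z) *
       (\<Prod>j<N. f j (index_reg m z) (inp_reg n j z) (outp j z)) else 0)"

lemma supp_on_st [simp]: "supp_on Q (st a f)"
  by (simp add: supp_on_def st_def)

lemma st_mult: "st (\<lambda>i. b i * a i) f = (\<lambda>z. b (index_reg m z) * st a f z)"
  by (simp add: st_def fun_eq_iff)

lemma nrm_st:
  "(nrm Q (st a f))\<^sup>2 = (\<Sum>i\<in>bits m. (cmod (a i))\<^sup>2 * (\<Prod>j<N. (\<Sum>x\<in>bits n. \<Sum>y\<in>bits l. (cmod (f j i x y))\<^sup>2) / 2 ^ n))"
proof -
  let ?k = "(2 powr (- real n / 2)) ^ N / sqrt 2"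
  \<comment> \<open>The 1/2 stems from normalising the flag and cancels the 2 of
    \<open>sum_configs\<close>.\<close>
  have k: "?k\<^sup>2 = inverse (2 ^ n) ^ N / 2"
  proof -
    have "(2 powr (- real n / 2))\<^sup>2 = 2 powr - real n"
      by (simp add: powr_power)
    also have "\<dots> = inverse (2 ^ n)"
      by (simp add: powr_minus powr_realpow)
    finally show ?thesis
      by (metis power_divide power_mult mult.commute real_sqrt_pow2 zero_le_numeral)
  qed
  have "(nrm Q (st a f))\<^sup>2 = ?k\<^sup>2 * (\<Sum>z\<in>vecs Q. (cmod (a (index_reg m z)))\<^sup>2 *
      (\<Prod>j<N. (cmod (f j (index_reg m z) (inp_reg n j z) (outp j z)))\<^sup>2))"
    unfolding nrm_sq sum_distrib_left
    by (intro sum.cong) (simp_all add: st_def norm_mult power_mult_distrib norm_power norm_divide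
        prod_norm [symmetric] prod_power_distrib power_divide)
  also have "\<dots> = inverse (2 ^ n) ^ N * (\<Sum>i\<in>bits m. (cmod (a i))\<^sup>2 * (\<Prod>j<N. \<Sum>x\<in>bits n. \<Sum>y\<in>bits l. (cmod (f j i x y))\<^sup>2))"
    unfolding sum_configs [where f = "\<lambda>j i x y. (cmod (f j i x y))\<^sup>2" and a = "\<lambda>i. (cmod (a i))\<^sup>2"] k by simp
  also have "\<dots> = (\<Sum>i\<in>bits m. (cmod (a i))\<^sup>2 * (\<Prod>j<N. (\<Sum>x\<in>bits n. \<Sum>y\<in>bits l. (cmod (f j i x y))\<^sup>2) / 2 ^ n))"
    by (simp add: sum_distrib_left prod_dividef field_simps)
  finally show ?thesis .
qed

lemma sum_graph:
  assumes "h i x \<in> bits l"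
  shows "(\<Sum>y\<in>bits l. (cmod (graph h i x y))\<^sup>2) = 1"
proof -
  have "(\<Sum>y\<in>bits l. (cmod (graph h i x y))\<^sup>2) = (\<Sum>y\<in>bits l. if y = h i x then 1 else 0)"
    by (intro sum.cong) (auto simp: graph_def)
  then show ?thesis using assms by simp
qed

lemma nrm_st_graph:
  assumes "\<And>i x. i \<in> bits m \<Longrightarrow> x \<in> bits n \<Longrightarrow> h i x \<in> bits l"
  shows "(nrm Q (st a (\<lambda>_. graph h)))\<^sup>2 = (\<Sum>i\<in>bits m. (cmod (a i))\<^sup>2)"
  unfolding nrm_st by (intro sum.cong) (auto simp: sum_graph assms card_bits)

lemma shift_in_vecs_iff:
  assumes "t \<in> bits n" "j < N"
  shows "z + inp_shift j t \<in> vecs Q \<longleftrightarrow> z \<in> vecs Q"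
proof -
  have "inps n N \<subseteq> Q" by (auto simp: qubits_def)
  then have "inp_shift j t \<in> vecs Q"
    using shift_in_vecs_inps [OF assms] by (auto simp: vecs_def)
  then show ?thesis
    using add_in_vecs [of z Q "inp_shift j t"] add_in_vecs [of "z + inp_shift j t" Q "inp_shift j t"] by auto
qed

text \<open>The shift concerns the factor of pair \<open>k\<close> alone, so a product state remains
  one and its norm still factorises.\<close>

lemma avg_st:
  assumes "t \<in> bits n" "k < N"
  shows "avg t k (st a f) = st a (f(k := \<lambda>i x y. (f k i x y + f k i (x + t) y) / 2))"
proof
  fix z
  have split: "(\<Prod>j<N. F j) = F k * (\<Prod>j\<in>{..<N} - {k}. F j)" for F :: "nat \<Rightarrow> complex"
    using assms by (simp add: prod.remove)
  have 1: "(\<Prod>j\<in>{..<N} - {k}. f j (index_reg m z) (inp_reg n j (z + inp_shift k t)) (outp j z))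
      = (\<Prod>j\<in>{..<N} - {k}. f j (index_reg m z) (inp_reg n j z) (outp j z))"
    by (intro prod.cong) (auto simp: inp_reg_shift assms)
  have 2: "(\<Prod>j\<in>{..<N} - {k}. (f(k := G)) j (index_reg m z) (inp_reg n j z) (outp j z))
      = (\<Prod>j\<in>{..<N} - {k}. f j (index_reg m z) (inp_reg n j z) (outp j z))" for G
    by (intro prod.cong) auto
  show "avg t k (st a f) z = st a (f(k := \<lambda>i x y. (f k i x y + f k i (x + t) y) / 2)) z"
    unfolding avg_def st_def split shift_in_vecs_iff [OF assms] inp_shift_simps 1 2
    by (simp add: inp_reg_shift assms field_simps)
qed

lemma fold_avg_st:
  assumes "t \<in> bits n" "k \<le> N"
  shows "fold (avg t) [0..<k] (st a (\<lambda>_. f))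
    = st a (\<lambda>j. if j < k then \<lambda>i x y. (f i x y + f i (x + t) y) / 2 else f)"
  using assms(2)
proof (induction k)
  case (Suc k)
  then show ?case
    by (simp add: avg_st assms(1)) (rule arg_cong [of _ _ "st a"], auto simp: fun_eq_iff)
qed simp

text \<open>Origin of the 3/4: for fixed \<open>x\<close> the averaged pair has squared norm 1 if
  \<open>x\<close> collides with \<open>x + t\<close>, and two amplitudes 1/2 on different outputs,
  hence 1/2, otherwise. With collision probability at most 1/2 the mean over \<open>x\<close> is at
  most 3/4. The condition \<open>a i \<noteq> 0\<close> in \<open>prob\<close> lets the periodic
  index be excluded by giving it amplitude 0.\<close>

lemma nrm_fold_avg_st:
  assumes t: "t \<in> bits n" and h: "\<And>i x. i \<in> bits m \<Longrightarrow> x \<in> bits n \<Longrightarrow> h i x \<in> bits l"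
    and prob: "\<And>i. i \<in> bits m \<Longrightarrow> a i \<noteq> 0 \<Longrightarrow> real (card {x \<in> bits n. h i (x + t) = h i x}) \<le> 2 ^ n / 2"
  shows "(nrm Q (fold (avg t) [0..<N] (st a (\<lambda>_. graph h))))\<^sup>2 \<le> (3/4) ^ N * (\<Sum>i\<in>bits m. (cmod (a i))\<^sup>2)"
proof -
  let ?f = "\<lambda>i x y. (graph h i x y + graph h i (x + t) y) / 2"
  have "fold (avg t) [0..<N] (st a (\<lambda>_. graph h)) = st a (\<lambda>_. ?f)"
    by (subst fold_avg_st) (auto simp: t st_def fun_eq_iff)
  moreover have "(cmod (a i))\<^sup>2 * (\<Prod>j<N. (\<Sum>x\<in>bits n. \<Sum>y\<in>bits l. (cmod (?f i x y))\<^sup>2) / 2 ^ n)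
      \<le> (3/4) ^ N * (cmod (a i))\<^sup>2" if i: "i \<in> bits m" for i
  proof (cases "a i = 0")
    case False
    let ?P = "{x \<in> bits n. h i (x + t) = h i x}"
    have "(\<Sum>y\<in>bits l. (cmod (?f i x y))\<^sup>2) = (if x \<in> ?P then 1 else 0) / 2 + 1 / 2" if x: "x \<in> bits n" for x
    proof (cases "x \<in> ?P")
      case True
      then have "?f i x y = graph h i x y" for y by (simp add: graph_def)
      then show ?thesis using True sum_graph [of h i x] h i x by simp
    next
      case False
      then have "(cmod (?f i x y))\<^sup>2 = (if y = h i x then 1/4 else 0) + (if y = h i (x + t) then 1/4 else 0)" for y
        using x by (auto simp: graph_def power2_eq_square)
      then show ?thesis using False h i x t add_in_bits [OF x t] by (simp add: sum.distrib)
    qed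
    then have "(\<Sum>x\<in>bits n. \<Sum>y\<in>bits l. (cmod (?f i x y))\<^sup>2) = card ?P / 2 + 2 ^ n / 2"
      by (simp add: sum.distrib card_bits flip: sum_divide_distrib)
         (simp add: sum.If_cases Int_def conj_commute)
    also have "\<dots> \<le> 3/4 * 2 ^ n"
      using prob [OF i False] by simp
    finally have "(\<Sum>x\<in>bits n. \<Sum>y\<in>bits l. (cmod (?f i x y))\<^sup>2) / 2 ^ n \<le> 3/4"
      by (simp add: divide_le_eq)
    then have "((\<Sum>x\<in>bits n. \<Sum>y\<in>bits l. (cmod (?f i x y))\<^sup>2) / 2 ^ n) ^ N \<le> (3/4) ^ N"
      by (intro power_mono) (auto intro!: sum_nonneg divide_nonneg_nonneg)
    then show ?thesis by (simp add: mult_left_mono mult.commute)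
  qed simp
  ultimately show ?thesis
    by (simp only: nrm_st sum_distrib_left) (rule sum_mono, blast)
qed

lemma add_outp_in_vecs:
  assumes "\<And>j. j < N \<Longrightarrow> v j \<in> bits l" "z \<in> vecs Q"
    and z': "\<And>j k. z' (Outp j k) = z (Outp j k) + (if j < N then v j k else 0)"
      "\<And>k. z' (Index k) = z (Index k)" "\<And>j k. z' (Inp j k) = z (Inp j k)" "z' Flag = z Flag"
      "\<And>k. z' (Work k) = z (Work k)"
  shows "z' \<in> vecs Q"
proof -
  have "v j k = 0" if "j < N" "l \<le> k" for j k
    using assms(1) [OF that(1)] that(2) by (rule bits_eq_0)
  then have "j < N \<and> k < l \<or> z' (Outp j k) = 0" for j k
    using assms(2) unfolding in_vecs_qubits z' by (metis add_0 leI)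
  then show ?thesis
    using assms(2) by (simp add: in_vecs_qubits z' del: z'(1))
qed

lemma xor_all_in_vecs:
  assumes "\<And>i x. i \<in> bits m \<Longrightarrow> x \<in> bits n \<Longrightarrow> f i x \<in> bits l" "z \<in> vecs Q"
  shows "xor_all m n N f z \<in> vecs Q"
  by (rule add_outp_in_vecs [where v = "\<lambda>j. f (index_reg m z) (inp_reg n j z)" and z = z])
     (simp_all add: assms)

lemma xor_all_xor_all [simp]: "xor_all m n N f (xor_all m n N f z) = z"
  by (rule config_eqI) (simp_all add: add.assoc)

text \<open>XOR is its own inverse, so pulling amplitudes back along the queries adds
  \<open>f\<close> to the graph. In this way the state prepared from \<open>g\<close> alone serves
  for every \<open>i\<close>.\<close>

lemma st_xor_all:
  assumes f: "\<And>i x. i \<in> bits m \<Longrightarrow> x \<in> bits n \<Longrightarrow> f i x \<in> bits l"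
  shows "(\<lambda>z. st a (\<lambda>_. graph h) (xor_all m n N f z)) =
    st a (\<lambda>_. graph (\<lambda>i x. f i x + h i x))"
proof
  fix z
  have v: "xor_all m n N f z \<in> vecs Q \<longleftrightarrow> z \<in> vecs Q"
    using xor_all_in_vecs [of f z] xor_all_in_vecs [of f "xor_all m n N f z"] f by (auto simp only: xor_all_xor_all)
  have "outp j (xor_all m n N f z) = outp j z + f (index_reg m z) (inp_reg n j z)" if "j < N" for j
    using that by (simp add: outp_def fun_eq_iff)
  moreover have "x + y = w \<longleftrightarrow> x = y + w" for x y w :: "nat \<Rightarrow> bit"
    by (metis add.commute bit_fun_add_self_right)
  ultimately show "st a (\<lambda>_. graph h) (xor_all m n N f z) = st a (\<lambda>_. graph (\<lambda>i x. f i x + h i x)) z"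
    by (simp add: st_def v graph_def)
qed

text \<open>Apart from Hadamard gates, each step either permutes the configurations by an involution
  or multiplies amplitudes by signs. The range condition on \<open>F\<close> keeps queries within
  the \<open>l\<close> output qubits.\<close>

lemma isom_step:
  assumes F: "\<And>i x. i \<in> bits m \<Longrightarrow> x \<in> bits n \<Longrightarrow> F i x \<in> bits l"
    and s: "s \<in> {Rank_Flip, Reflect_Zero, Negate, Gate (PauliX Flag)} \<union> {Gate (Hadamard q) |q. q \<in> Q} \<union>
      {Gate (Query_F j) |j. j < N}"
  shows "isom Q (apply_step F g c m n s)"
proof -
  have sign: "isom Q (\<lambda>\<psi> z. b z * \<psi> z)" if "\<And>z. cmod (b z) = 1" for b :: "config \<Rightarrow> complex"
    using that by (auto simp: isom_def supp_on_def nrm_def norm_mult fun_eq_iff ring_distribs)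
  have "isom Q (\<lambda>\<psi> z. \<psi> (z(Flag := z Flag + 1)))"
    by (rule isom_reindex) (auto simp: add.assoc in_vecs_qubits)
  moreover have "isom Q (\<lambda>\<psi> z. \<psi> (rank_flip c n z))"
    by (rule isom_reindex) (auto simp: rank_flip_def add.assoc in_vecs_qubits)
  moreover have "isom Q (\<lambda>\<psi> z. \<psi> (xor_outp j (F (index_reg m z) (inp_reg n j z)) z))" if "j < N" for j
  proof (rule isom_reindex)
    show "xor_outp j (F (index_reg m z) (inp_reg n j z)) z \<in> vecs Q" if "z \<in> vecs Q" for z
      by (rule add_outp_in_vecs [where v = "\<lambda>i. if i = j then F (index_reg m z) (inp_reg n j z) else 0" and z = z])
         (use \<open>j < N\<close> in \<open>auto simp: F that\<close>)
  qed simp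
  moreover have "isom Q (\<lambda>\<psi> z. if index_reg m z = 0 then - \<psi> z else \<psi> z)"
    using sign [of "\<lambda>z. if index_reg m z = 0 then - 1 else 1"] by (simp add: if_distrib if_distribR cong: if_cong)
  moreover have "isom Q (\<lambda>\<psi> z. - \<psi> z)"
    using sign [of "\<lambda>z. - 1"] by simp
  moreover have "apply_step F g c m n Rank_Flip = (\<lambda>\<psi> z. \<psi> (rank_flip c n z))"
    "apply_step F g c m n Reflect_Zero = (\<lambda>\<psi> z. if index_reg m z = 0 then - \<psi> z else \<psi> z)"
    "apply_step F g c m n Negate = (\<lambda>\<psi> z. - \<psi> z)"
    "apply_step F g c m n (Gate (PauliX Flag)) = (\<lambda>\<psi> z. \<psi> (z(Flag := z Flag + 1)))"
    "\<And>q. apply_step F g c m n (Gate (Hadamard q)) = hgate q"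
    "\<And>j. apply_step F g c m n (Gate (Query_F j)) =
      (\<lambda>\<psi> z. \<psi> (xor_outp j (F (index_reg m z) (inp_reg n j z)) z))"
    by (simp_all add: apply_gate_simps apply_Rank_Flip fun_eq_iff)
  ultimately show ?thesis
    using s isom_hgate [OF finite_qubits] by auto
qed

lemma in_vecs_override_idx: "override_on z x (idx m) \<in> vecs Q \<longleftrightarrow> z \<in> vecs Q"
  by (auto simp: in_vecs_qubits override_on_def idx_def image_iff)

lemma reg_override_idx [simp]:
  "inp_reg n j (override_on z x (idx m)) = inp_reg n j z"
  "outp j (override_on z x (idx m)) = outp j z"
  "override_on z x (idx m) Flag = z Flag"
  "index_reg m (override_on z x (idx m)) = index_reg m x"
  by (auto simp: override_on_def idx_def inp_reg_def outp_def index_reg_def fun_eq_iff)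

lemma sum_vecs_idx: "(\<Sum>x\<in>vecs (idx m). f (index_reg m x)) = (\<Sum>i\<in>bits m. f i)" for f :: "_ \<Rightarrow> complex"
proof (rule sum.reindex_bij_witness [of _ "\<lambda>i q. case q of Index k \<Rightarrow> i k | _ \<Rightarrow> 0" "index_reg m"])
  fix z assume z: "z \<in> vecs (idx m)"
  show "(\<lambda>q. case q of Index k \<Rightarrow> index_reg m z k | _ \<Rightarrow> 0) = z"
    by (rule config_eqI) (use z in \<open>auto simp: vecs_def idx_def index_reg_def image_iff\<close>)
next
  fix i assume i: "i \<in> bits m"
  show "index_reg m (\<lambda>q. case q of Index k \<Rightarrow> i k | _ \<Rightarrow> 0) = i"
    using i by (auto simp: index_reg_def bits_eq_0 not_less)
  have "i k = 0" if "Index k \<notin> idx m" for k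
    using that i by (intro bits_eq_0) (auto simp: idx_def image_iff not_less)
  then show "(\<lambda>q. case q of Index k \<Rightarrow> i k | _ \<Rightarrow> 0) \<in> vecs (idx m)"
    unfolding vecs_def by (auto split: qubit.split)
qed simp_all

text \<open>The hypothesis says that the pairs are not entangled with the index. The state prepared
  from \<open>g\<close> has this form, and the ideal marking restores it before the
  diffusion.\<close>

lemma had_idx_st:
  assumes "\<And>j i. f j i = f j 0"
  shows "had (idx m) (st a f) =
    st (\<lambda>u. (1 / complex_of_real (sqrt 2)) ^ m * (\<Sum>i\<in>bits m. chi (dot m i u) * a i)) f"
proof
  fix z
  have card: "card (idx m) = m" by (simp add: idx_def card_image inj_on_def)
  have 1: "st a f (override_on z x (idx m)) = st (\<lambda>_. 1) f z * a (index_reg m x)" for x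
  proof -
    have "f j i = f j i'" for j i i' using assms by metis
    then have "(\<Prod>j<N. f j (index_reg m x) (inp_reg n j z) (outp j z)) =
       (\<Prod>j<N. f j (index_reg m z) (inp_reg n j z) (outp j z))"
      by metis
    then show ?thesis by (simp add: st_def in_vecs_override_idx)
  qed
  have 2: "(\<Sum>q\<in>idx m. x q * z q) = dot m (index_reg m x) (index_reg m z)" for x :: config
    by (simp add: idx_def sum.reindex inj_on_def dot_def index_reg_def)
  have "had (idx m) (st a f) z = (1 / complex_of_real (sqrt 2)) ^ m * st (\<lambda>_. 1) f z *
      (\<Sum>x\<in>vecs (idx m). chi (dot m (index_reg m x) (index_reg m z)) * a (index_reg m x))"
    by (simp add: had_def card 1 2 sum_distrib_left mult_ac)
  also have "\<dots> = (1 / complex_of_real (sqrt 2)) ^ m * st (\<lambda>_. 1) f z *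
      (\<Sum>i\<in>bits m. chi (dot m i (index_reg m z)) * a i)"
    by (subst sum_vecs_idx [symmetric]) simp
  finally show "had (idx m) (st a f) z =
    st (\<lambda>u. (1 / complex_of_real (sqrt 2)) ^ m * (\<Sum>i\<in>bits m. chi (dot m i u) * a i)) f z"
    by (simp add: st_def)
qed

end

section \<open>The error of the rank test\<close>

lemma in_inps [simp]:
  "Index k \<notin> inps n N" "Inp j k \<in> inps n N \<longleftrightarrow> j < N \<and> k < n" "Outp j k \<notin> inps n N"
  "Flag \<notin> inps n N" "Work k \<notin> inps n N"
  by (auto simp: inps_def)

lemma in_idx [simp]:
  "Index k \<in> idx m \<longleftrightarrow> k < m" "Inp j k \<notin> idx m" "Outp j k \<notin> idx m" "Flag \<notin> idx m" "Work k \<notin> idx m"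
  by (auto simp: idx_def)

lemma in_vecs_inps:
  "z \<in> vecs (inps n N) \<longleftrightarrow>
     (\<forall>k. z (Index k) = 0) \<and> (\<forall>j k. j < N \<and> k < n \<or> z (Inp j k) = 0) \<and>
     (\<forall>j k. z (Outp j k) = 0) \<and> z Flag = 0 \<and> (\<forall>k. z (Work k) = 0)" (is "?L \<longleftrightarrow> ?R")
proof
  assume ?L
  then have "q \<notin> inps n N \<Longrightarrow> z q = 0" for q by (simp add: vecs_def)
  then show ?R by (meson in_inps)
next
  assume R: ?R
  show ?L unfolding vecs_def
  proof (intro CollectI allI impI)
    show "z q = 0" if "q \<notin> inps n N" for q
      using R that by (cases q) auto
  qed
qed

lemma card_inps: "card (inps n N) = N * n"
  unfolding inps_def by (subst card_image) (auto simp: inj_on_def)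

lemma card_idx: "card (idx m) = m"
  unfolding idx_def by (subst card_image) (auto simp: inj_on_def)

definition inp_list :: "nat \<Rightarrow> nat \<Rightarrow> qubit list" where
  "inp_list n N = concat (map (\<lambda>j. map (Inp j) [0..<n]) [0..<N])"

lemma set_inp_list: "set (inp_list n N) = inps n N"
  by (auto simp: inp_list_def inps_def)

lemma distinct_inp_list: "distinct (inp_list n N)"
proof (induction N)
  case (Suc N)
  then show ?case by (auto simp: inp_list_def distinct_map inj_on_def)
qed (simp add: inp_list_def)

lemma psi_eq:
  "psi c n h z = (if (\<forall>k. z (Index k) = 0) \<and> (\<forall>j k. j < c * n \<and> k < n \<or> z (Inp j k) = 0) \<and>
      (\<forall>j k. j < c * n \<or> z (Outp j k) = 0) \<and> z Flag = 0 \<and> (\<forall>k. z (Work k) = 0) \<and>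
      (\<forall>j<c * n. outp j z = h (inp_reg n j z))
     then complex_of_real ((2 powr (- real n / 2)) ^ (c * n)) else 0)"
proof -
  have "(\<forall>q. z q \<noteq> 0 \<longrightarrow> (\<exists>j<c * n. (\<exists>k<n. q = Inp j k) \<or> (\<exists>k. q = Outp j k))) \<longleftrightarrow>
      (\<forall>k. z (Index k) = 0) \<and> (\<forall>j k. j < c * n \<and> k < n \<or> z (Inp j k) = 0) \<and>
      (\<forall>j k. j < c * n \<or> z (Outp j k) = 0) \<and> z Flag = 0 \<and> (\<forall>k. z (Work k) = 0)" (is "?L \<longleftrightarrow> ?R")
  proof
    assume L: ?L
    show ?R
    proof (intro conjI allI)
      show "z (Index k) = 0" "z Flag = 0" "z (Work k) = 0" for k using L by blast+
      show "j < c * n \<and> k < n \<or> z (Inp j k) = 0" for j k using L by blast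
      show "j < c * n \<or> z (Outp j k) = 0" for j k using L by blast
    qed
  next
    assume R: ?R
    show ?L
    proof (intro allI impI)
      fix q assume "z q \<noteq> 0"
      then show "\<exists>j<c * n. (\<exists>k<n. q = Inp j k) \<or> (\<exists>k. q = Outp j k)"
        using R by (cases q) (metis | simp)+
    qed
  qed
  then show ?thesis by (simp add: psi_def outp_def conj_assoc)
qed

text \<open>Meant for registers still in the all-zero state, where only one summand survives and the
  result is the uniform superposition.\<close>

lemma had_single_support:
  assumes "finite A" "\<And>x. x \<in> vecs A \<Longrightarrow> x \<noteq> 0 \<Longrightarrow> \<psi> (override_on z x A) = 0"
  shows "had A \<psi> z = (1 / complex_of_real (sqrt 2)) ^ card A * \<psi> (override_on z 0 A)"
proof -
  have "(\<Sum>x\<in>vecs A. chi (\<Sum>a\<in>A. x a * z a) * \<psi> (override_on z x A))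
      = (\<Sum>x\<in>vecs A. if x = 0 then \<psi> (override_on z 0 A) else 0)"
    using assms by (intro sum.cong) auto
  then show ?thesis using assms(1) by (simp add: had_def)
qed

lemma sqrt2_power: "(1 / complex_of_real (sqrt 2)) ^ k = complex_of_real (2 powr (- real k / 2))"
proof -
  have "1 / sqrt 2 = 2 powr (- (1/2))"
    by (subst powr_minus_divide) (simp add: powr_half_sqrt)
  then have "(1 / sqrt 2) ^ k = 2 powr (- (1/2) * real k)"
    by (simp only: powr_power) simp
  then have "complex_of_real ((1 / sqrt 2) ^ k) = complex_of_real (2 powr (- real k / 2))"
    by simp
  then show ?thesis by (simp only: of_real_power of_real_divide of_real_1)
qed

lemma fold_apply_gate_Hadamard:
  "fold (apply_gate F g m n) (map Hadamard qs) \<psi> = fold hgate qs \<psi>"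
  by (simp add: fold_map comp_def apply_Hadamard)

lemma fold_apply_gate_Query_F:
  "fold (apply_gate F g m n) (map Query_F js) \<psi> =
     fold (\<lambda>j \<psi> z. \<psi> (xor_outp j (F (index_reg m z) (inp_reg n j z)) z)) js \<psi>"
  by (induction js arbitrary: \<psi>) (simp_all add: apply_Query_F)

lemma fold_apply_gate_Query_g:
  "fold (apply_gate F g m n) (map Query_g js) \<psi> =
     fold (\<lambda>j \<psi> z. \<psi> (xor_outp j (g (inp_reg n j z)) z)) js \<psi>"
  by (induction js arbitrary: \<psi>) (simp_all add: apply_Query_g)

lemma fold_apply_step_Gate:
  "fold (apply_step F g c m n) (map Gate C) \<psi> = fold (apply_gate F g m n) C \<psi>"
  by (induction C arbitrary: \<psi>) simp_all

lemma run_online_phase: "run F g m n (online_phase c n) zero_state = psi c n g"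
proof -
  let ?N = "c * n"
  have split: "online_phase c n = map Hadamard (inp_list n ?N) @ map Query_g [0..<?N]"
    by (simp add: online_phase_def inp_list_def map_concat comp_def)
  have "override_on z x (inps n ?N) = (\<lambda>_. 0) \<longleftrightarrow> x = 0 \<and> z \<in> vecs (inps n ?N)"
    if "x \<in> vecs (inps n ?N)" for x z :: config
    using that by (auto simp: override_on_def vecs_def fun_eq_iff)
  then have "had (inps n ?N) zero_state z =
      (1 / complex_of_real (sqrt 2)) ^ (?N * n) * (if z \<in> vecs (inps n ?N) then 1 else 0)" for z
    by (subst had_single_support) (auto simp: zero_state_def card_inps)
  then have 1: "had (inps n ?N) zero_state =
      (\<lambda>z. if z \<in> vecs (inps n ?N) then complex_of_real ((2 powr (- real n / 2)) ^ ?N) else 0)"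
    by (auto simp: fun_eq_iff power_mult mult.commute [of _ n] sqrt2_power simp flip: of_real_power)
  \<comment> \<open>The amplitude at \<open>z\<close> is found by undoing the queries; outputs that
    become zero in doing so are exactly the values of \<open>g\<close>.\<close>
  have 2: "xor_all m n ?N (\<lambda>_. g) z \<in> vecs (inps n ?N) \<longleftrightarrow>
      (\<forall>k. z (Index k) = 0) \<and> (\<forall>j k. j < c * n \<and> k < n \<or> z (Inp j k) = 0) \<and>
      (\<forall>j k. j < c * n \<or> z (Outp j k) = 0) \<and> z Flag = 0 \<and> (\<forall>k. z (Work k) = 0) \<and>
      (\<forall>j<c * n. outp j z = g (inp_reg n j z))" for z
  proof -
    have "a + b = 0 \<longleftrightarrow> a = b" for a b :: bit by (cases a; cases b) auto
    then have "(\<forall>j k. z (Outp j k) + (if j < ?N then g (inp_reg n j z) k else 0) = 0) \<longleftrightarrow>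
      (\<forall>j k. j < ?N \<or> z (Outp j k) = 0) \<and> (\<forall>j<?N. outp j z = g (inp_reg n j z))"
      by (auto simp: outp_def fun_eq_iff split: if_splits)
    then show ?thesis unfolding in_vecs_inps xor_all_simps by blast
  qed
  have "run F g m n (online_phase c n) zero_state
      = fold (\<lambda>j \<psi> z. \<psi> (xor_outp j (g (inp_reg n j z)) z)) [0..<?N] (had (inps n ?N) zero_state)"
    by (simp add: split run_def fold_apply_gate_Hadamard fold_apply_gate_Query_g
        set_inp_list [symmetric] had_eq_fold distinct_inp_list)
  also have "\<dots> = psi c n g"
    unfolding fold_queries [where f = "\<lambda>_. g" and m = m] 1 2 by (simp add: fun_eq_iff psi_eq)
  finally show ?thesis .
qed

lemma prod_indicator: "finite A \<Longrightarrow> (\<Prod>j\<in>A. if P j then 1 else 0 :: complex) = (if \<forall>j\<in>A. P j then 1 else 0)"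
  by (induction A rule: finite_induct) auto

lemma st_graph:
  "st m n l N a (\<lambda>_. graph h) z = (if z \<in> vecs (qubits m n l N) \<and> (\<forall>j<N. outp j z = h (index_reg m z) (inp_reg n j z))
     then complex_of_real ((2 powr (- real n / 2)) ^ N / sqrt 2) * chi (z Flag) * a (index_reg m z) else 0)"
  by (auto simp: st_def graph_def prod_indicator)

definition test_prep :: "nat \<Rightarrow> nat \<Rightarrow> step list" where
  "test_prep c n = map Gate (map Query_F [0..<c * n] @ map Hadamard (inp_list n (c * n)))"

lemma test_eq: "test c n = test_prep c n @ [Rank_Flip] @ rev (test_prep c n)"
  by (simp add: test_def test_prep_def inp_list_def map_concat comp_def Let_def)

lemma grover_iteration_eq:
  "grover_iteration c n m = test c n @ (map (\<lambda>k. Gate (Hadamard (Index k))) [0..<m] @ [Reflect_Zero] @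
      map (\<lambda>k. Gate (Hadamard (Index k))) [0..<m] @ [Negate])"
  by (simp add: grover_iteration_def Let_def)

section \<open>The rank test under the hypotheses on the oracles\<close>

locale unique_period =
  fixes F :: "(nat \<Rightarrow> bit) \<Rightarrow> (nat \<Rightarrow> bit) \<Rightarrow> (nat \<Rightarrow> bit)" and g :: "(nat \<Rightarrow> bit) \<Rightarrow> (nat \<Rightarrow> bit)"
    and c m n l :: nat and i0 :: "nat \<Rightarrow> bit"
  assumes F_in: "\<And>i x. i \<in> bits m \<Longrightarrow> x \<in> bits n \<Longrightarrow> F i x \<in> bits l"
    and g_in: "\<And>x. x \<in> bits n \<Longrightarrow> g x \<in> bits l"
    and i0_in: "i0 \<in> bits m"
    and period: "has_period n (\<lambda>x. F i0 x + g x)"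
    and collisions: "\<And>i t. i \<in> bits m \<Longrightarrow> i \<noteq> i0 \<Longrightarrow> t \<in> bits n \<Longrightarrow> t \<noteq> 0 \<Longrightarrow>
      real (card {x \<in> bits n. F i (x + t) + g (x + t) = F i x + g x}) \<le> 2 ^ n / 2"
begin

abbreviation N :: nat where "N \<equiv> c * n"
abbreviation Qb :: "qubit set" where "Qb \<equiv> qubits m n l N"
abbreviation app :: "step \<Rightarrow> state \<Rightarrow> state" where "app \<equiv> apply_step F g c m n"
abbreviation H :: "state \<Rightarrow> state" where "H \<equiv> had (inps n N)"
abbreviation h :: "(nat \<Rightarrow> bit) \<Rightarrow> (nat \<Rightarrow> bit) \<Rightarrow> (nat \<Rightarrow> bit)" where "h \<equiv> \<lambda>i x. F i x + g x"
abbreviation S :: "((nat \<Rightarrow> bit) \<Rightarrow> complex) \<Rightarrow> state" where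
  "S a \<equiv> st m n l N a (\<lambda>_. graph (\<lambda>_. g))"
abbreviation Sh :: "((nat \<Rightarrow> bit) \<Rightarrow> complex) \<Rightarrow> state" where
  "Sh a \<equiv> st m n l N a (\<lambda>_. graph h)"

lemma h_in: "i \<in> bits m \<Longrightarrow> x \<in> bits n \<Longrightarrow> h i x \<in> bits l"
  by (simp add: F_in g_in add_in_bits)

lemma fold_test_prep: "fold app (test_prep c n) \<psi> = H (\<lambda>z. \<psi> (xor_all m n N F z))"
  by (simp add: test_prep_def fold_apply_step_Gate fold_apply_gate_Query_F fold_apply_gate_Hadamard fold_queries
      set_inp_list [symmetric] had_eq_fold distinct_inp_list del: map_append map_map)

lemma fold_rev_test_prep [simp]: "fold app (rev (test_prep c n)) (fold app (test_prep c n) \<psi>) = \<psi>"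
proof -
  have "fold app (rev P) (fold app P \<phi>) = \<phi>" if "\<And>s \<psi>. s \<in> set P \<Longrightarrow> app s (app s \<psi>) = \<psi>" for P \<phi>
    using that by (induction P arbitrary: \<phi>) auto
  moreover have "app s (app s \<psi>) = \<psi>" if "s \<in> set (test_prep c n)" for s \<psi>
    using that by (auto simp: test_prep_def apply_gate_simps)
  ultimately show ?thesis by blast
qed

lemma isom_test_steps:
  assumes "s \<in> set (test_prep c n)" shows "isom Qb (app s)"
  using assms by (intro isom_step F_in) (auto simp: test_prep_def set_inp_list qubits_def)

lemma fold_test_prep_S: "fold app (test_prep c n) (S a) = H (Sh a)"
  using st_xor_all [where f = F and m = m and n = n and l = l and N = N and a = a and h = "\<lambda>_. g", OF F_in] by (simp add: fold_test_prep)

lemma H_mult_index: "H (\<lambda>z. b (index_reg m z) * \<psi> z) = (\<lambda>z. b (index_reg m z) * H \<psi> z)"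
  by (rule had_mult_local) (simp add: index_reg_def override_on_def cong: if_cong)

lemma H_Sh_mult: "H (Sh (\<lambda>i. b i * a i)) z = b (index_reg m z) * H (Sh a) z"
  by (simp add: st_mult H_mult_index)

text \<open>Phase kickback: the flag is in the state minus and is not touched by the transform of
  the input registers, so flipping it only changes the sign.\<close>

lemma H_Sh_flag: "H (Sh a) (z(Flag := z Flag + 1)) = - H (Sh a) z"
proof -
  have 1: "Sh a (w(Flag := w Flag + 1)) = - Sh a w" for w
  proof -
    have "chi (w Flag + 1) = - chi (w Flag)" by (simp add: chi_add)
    moreover have "w(Flag := w Flag + 1) \<in> vecs Qb \<longleftrightarrow> w \<in> vecs Qb"
      by (simp add: in_vecs_qubits)
    moreover have "index_reg m (w(Flag := w Flag + 1)) = index_reg m w" "outp j (w(Flag := w Flag + 1)) = outp j w" for j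
      by (auto simp: outp_def index_reg_def fun_eq_iff)
    ultimately show ?thesis by (auto simp: st_graph)
  qed
  have 2: "override_on (z(Flag := z Flag + 1)) x (inps n N) =
      (override_on z x (inps n N))(Flag := (override_on z x (inps n N)) Flag + 1)" for x
    by (auto simp: override_on_def fun_eq_iff)
  have 3: "(\<Sum>a\<in>inps n N. x a * (z(Flag := z Flag + 1)) a) = (\<Sum>a\<in>inps n N. x a * z a)" for x :: config
    by (intro sum.cong) auto
  show ?thesis
    unfolding had_def 3 2 1 by (simp add: sum_negf)
qed

definition deficient :: "config \<Rightarrow> bool" where
  "deficient z \<longleftrightarrow> (\<exists>t\<in>bits n - {0}. \<forall>j<N. dot n t (inp_reg n j z) = 0)"

lemma Rank_Flip_H_Sh: "app Rank_Flip (H (Sh a)) z = (if deficient z then - 1 else 1) * H (Sh a) z"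
proof -
  have "f2.dim (f2.span ((\<lambda>j. inp_reg n j z) ` {..<N})) < n \<longleftrightarrow> deficient z"
    unfolding deficient_def by (subst rank_deficient_iff) auto
  then show ?thesis
    by (simp add: apply_Rank_Flip rank_flip_def H_Sh_flag)
qed

text \<open>The part of the state with index \<open>i0\<close> is invariant under the shift by the
  period in every register, hence equal to its averages, and \<open>had_avg\<close> then forces
  amplitude 0 unless all strings are orthogonal to the period.\<close>

lemma H_Sh_period:
  assumes "H (Sh a) z \<noteq> 0" "index_reg m z = i0"
  shows "deficient z"
proof -
  obtain s where s: "s \<in> bits n" "s \<noteq> 0" "\<And>x. x \<in> bits n \<Longrightarrow> h i0 x = h i0 (x + s)"
    using period by (auto simp: has_period_def)
  \<comment> \<open>Cutting down to index \<open>i0\<close> is harmless, since factors that depend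
    on the index commute with \<open>H\<close>.\<close>
  let ?b = "\<lambda>i. if i = i0 then 1 else 0 :: complex"
  let ?\<psi> = "Sh (\<lambda>i. ?b i * a i)"
  have "avg s j ?\<psi> = ?\<psi>" if "j < N" for j
  proof
    fix w
    have "?\<psi> (w + inp_shift j s) = ?\<psi> w"
    proof (cases "index_reg m w = i0")
      case True
      have "h i0 (inp_reg n i (w + inp_shift j s)) = h i0 (inp_reg n i w)" for i
        using s(3) [of "inp_reg n i w"] by (simp add: inp_reg_shift s(1))
      then show ?thesis
        using True by (auto simp: st_graph shift_in_vecs_iff s(1) that)
    qed (simp add: st_graph)
    then show "avg s j ?\<psi> w = ?\<psi> w" by (simp add: avg_def)
  qed
  moreover have "H ?\<psi> z \<noteq> 0"
    using assms by (simp add: H_Sh_mult)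
  ultimately have "dot n s (inp_reg n j z) = 0" if "j < N" for j
    using had_avg [OF s(1) that, of ?\<psi> z] that by (metis (no_types, lifting))
  then show ?thesis using s by (auto simp: deficient_def)
qed

definition mark :: "((nat \<Rightarrow> bit) \<Rightarrow> complex) \<Rightarrow> (nat \<Rightarrow> bit) \<Rightarrow> complex" where
  "mark a i = (if i = i0 then - 1 else 1) * a i"

text \<open>The two signs can disagree only where the index is not \<open>i0\<close> and the strings
  are deficient. The disagreement of +1 and -1 gives the factor 2; deficiency supplies a
  \<open>t\<close>, and the sum over all \<open>t\<close> gives the factor \<open>2 ^ n\<close>
  under the root.\<close>

lemma nrm_test_error:
  assumes a: "(\<Sum>i\<in>bits m. (cmod (a i))\<^sup>2) \<le> 1"
  shows "nrm Qb (fold app (test c n) (S a) - S (mark a)) \<le> 2 * sqrt (2 ^ n * (3/4) ^ N)"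
proof -
  let ?a = "\<lambda>i. (if i = i0 then 0 else 1) * a i :: complex"
  let ?\<Phi> = "H (Sh a)"
  define E where "E = app Rank_Flip ?\<Phi> - H (Sh (mark a))"
  define G where "G t = H (fold (avg t) [0..<N] (Sh ?a))" for t
  have supp: "supp_on Qb (app Rank_Flip ?\<Phi>)" "supp_on Qb (H (Sh b))" for b
  proof -
    have "isom Qb H" by (rule isom_had) (auto simp: qubits_def)
    then show *: "supp_on Qb (H (Sh b))" for b by (rule isomD) simp
    have "isom Qb (app Rank_Flip)" by (rule isom_step) (auto simp: F_in)
    then show "supp_on Qb (app Rank_Flip ?\<Phi>)" by (rule isomD) (rule *)
  qed
  \<comment> \<open>The ideal result is also obtained by undoing the preparation, namely on
    \<open>H (Sh (mark a))\<close>. Both sides thus end with the same isometry, and the error can be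
    measured before it.\<close>
  have *: "fold app (test c n) (S a) - S (mark a) =
      fold app (rev (test_prep c n)) (app Rank_Flip ?\<Phi>) - fold app (rev (test_prep c n)) (H (Sh (mark a)))"
    unfolding test_eq by (simp add: fold_test_prep_S del: fold_rev) (simp flip: fold_test_prep_S del: fold_rev)
  have 1: "nrm Qb (fold app (test c n) (S a) - S (mark a)) = nrm Qb E"
    unfolding * E_def by (intro isom_nrm_diff isom_fold supp) (auto intro: isom_test_steps)
  have G: "G t z = (if \<forall>j<N. dot n t (inp_reg n j z) = 0 then H (Sh ?a) z else 0)" if "t \<in> bits n" for t z
    unfolding G_def by (rule had_fold_avg [OF that order_refl])
  \<comment> \<open>The union bound holds pointwise: a deficient \<open>z\<close> survives in
    \<open>G t\<close> for at least one \<open>t\<close>. The amplitude of \<open>i0\<close> is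
    removed in \<open>?a\<close> because the collision bound covers the other indices.\<close>
  have "(cmod (E z))\<^sup>2 \<le> 4 * (\<Sum>t\<in>bits n - {0}. (cmod (G t z))\<^sup>2)" for z
  proof (cases "index_reg m z \<noteq> i0 \<and> deficient z")
    case True
    then obtain t where t: "t \<in> bits n - {0}" "\<forall>j<N. dot n t (inp_reg n j z) = 0"
      by (auto simp: deficient_def)
    have "cmod (E z) = 2 * cmod (?\<Phi> z)"
      using True by (simp add: E_def Rank_Flip_H_Sh mark_def [abs_def] H_Sh_mult)
    moreover have "H (Sh ?a) z = ?\<Phi> z"
      using True H_Sh_mult [of "\<lambda>i. if i = i0 then 0 else 1" a z] by simp
    ultimately have "(cmod (E z))\<^sup>2 = 4 * (cmod (G t z))\<^sup>2"
      using t by (simp add: G power_mult_distrib)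
    also have "(cmod (G t z))\<^sup>2 \<le> (\<Sum>t\<in>bits n - {0}. (cmod (G t z))\<^sup>2)"
      using t(1) by (intro member_le_sum) auto
    finally show ?thesis by simp
  next
    case False
    then have "E z = 0"
      using H_Sh_period [of a z] by (auto simp: E_def Rank_Flip_H_Sh mark_def [abs_def] H_Sh_mult)
    then show ?thesis by (simp add: sum_nonneg)
  qed
  then have "(nrm Qb E)\<^sup>2 \<le> (\<Sum>z\<in>vecs Qb. 4 * (\<Sum>t\<in>bits n - {0}. (cmod (G t z))\<^sup>2))"
    unfolding nrm_sq by (intro sum_mono)
  also have "\<dots> = 4 * (\<Sum>t\<in>bits n - {0}. (nrm Qb (G t))\<^sup>2)"
    unfolding nrm_sq sum_distrib_left by (rule sum.swap)
  also have "\<dots> \<le> 4 * (\<Sum>t\<in>bits n - {0}. (3/4) ^ N)"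
  proof (intro mult_left_mono sum_mono)
    fix t assume t: "t \<in> bits n - {0}"
    have "supp_on Qb (fold (avg t) [0..<N] (Sh ?a))"
      using t by (subst fold_avg_st) auto
    then have "(nrm Qb (G t))\<^sup>2 = (nrm Qb (fold (avg t) [0..<N] (Sh ?a)))\<^sup>2"
      unfolding G_def by (subst isomD(2) [OF isom_had]) (auto simp: qubits_def)
    also have "\<dots> \<le> (3/4) ^ N * (\<Sum>i\<in>bits m. (cmod (?a i))\<^sup>2)"
      by (intro nrm_fold_avg_st h_in collisions) (use t in \<open>auto split: if_splits\<close>)
    also have "\<dots> \<le> (3/4) ^ N * 1"
    proof (intro mult_left_mono)
      have "(\<Sum>i\<in>bits m. (cmod (?a i))\<^sup>2) \<le> (\<Sum>i\<in>bits m. (cmod (a i))\<^sup>2)"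
        by (intro sum_mono) auto
      then show "(\<Sum>i\<in>bits m. (cmod (?a i))\<^sup>2) \<le> 1" using a by simp
    qed simp
    finally show "(nrm Qb (G t))\<^sup>2 \<le> (3/4) ^ N" by simp
  qed simp
  also have "\<dots> \<le> 4 * (2 ^ n * (3/4) ^ N)"
    by (simp add: card_Diff_singleton card_bits)
  finally have "nrm Qb E \<le> sqrt (4 * (2 ^ n * (3/4) ^ N))"
    by (rule real_le_rsqrt)
  then show ?thesis by (simp only: 1 real_sqrt_mult) simp
qed

end

section \<open>Grover iterations\<close>

lemma st_cong: "(\<And>i. i \<in> bits m \<Longrightarrow> a i = b i) \<Longrightarrow> st m n l N a f = st m n l N b f"
  by (simp add: st_def fun_eq_iff)

lemma fold_Hadamard_idx:
  "fold (apply_step F g c m n) (map (\<lambda>k. Gate (Hadamard (Index k))) [0..<m']) \<psi> = had (idx m') \<psi>"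
proof -
  have 1: "map (\<lambda>k. Gate (Hadamard (Index k))) [0..<m'] = map Gate (map Hadamard (map Index [0..<m']))"
    by simp
  have 2: "set (map Index [0..<m']) = idx m'" "distinct (map Index [0..<m'])"
    by (auto simp: idx_def distinct_map inj_on_def)
  show ?thesis
    unfolding 1 fold_apply_step_Gate fold_apply_gate_Hadamard using had_eq_fold [OF 2(2)] 2(1) by simp
qed

section \<open>The rotation angle and the number of iterations\<close>

definition grover_angle :: "nat \<Rightarrow> real" where
  "grover_angle m = arcsin (2 powr (- real m / 2))"

lemma powr_half_minus: "2 powr (- real m / 2) = 1 / sqrt (2 ^ m)"
  by (simp add: powr_minus_divide powr_half_sqrt [symmetric] powr_realpow [symmetric] powr_powr)

lemma sin_grover_angle: "sin (grover_angle m) = 1 / sqrt (2 ^ m)"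
proof -
  have "sqrt (2 ^ m) \<ge> 1" by simp
  then have "1 / sqrt (2 ^ m) \<le> 1" "-1 \<le> 1 / sqrt (2 ^ m)"
    by (simp_all add: divide_le_eq order_trans [of "-1" 0])
  then show ?thesis unfolding grover_angle_def powr_half_minus by (rule sin_arcsin [rotated])
qed

lemma grover_angle_bounds: "0 < grover_angle m" "grover_angle m \<le> pi / 2"
  "m \<noteq> 0 \<Longrightarrow> grover_angle m \<le> pi / 4"
proof -
  have "sqrt (2 ^ m) \<ge> 1" by simp
  then have s: "0 < sin (grover_angle m)" "sin (grover_angle m) \<le> 1"
    unfolding sin_grover_angle by (simp_all add: divide_le_eq)
  have angle: "grover_angle m = arcsin (sin (grover_angle m))"
    unfolding sin_grover_angle unfolding grover_angle_def powr_half_minus ..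
  have "arcsin 0 < arcsin (sin (grover_angle m))"
    using s by (intro arcsin_less_arcsin) auto
  then show "0 < grover_angle m" using angle by simp
  show "grover_angle m \<le> pi / 2"
    using angle arcsin_ubound [of "sin (grover_angle m)"] s by simp
  show "grover_angle m \<le> pi / 4" if "m \<noteq> 0"
  proof -
    have "(2::real) ^ 1 \<le> 2 ^ m" using that by (intro power_increasing) auto
    then have "sin (grover_angle m) \<le> 1 / sqrt 2"
      unfolding sin_grover_angle by (intro divide_left_mono) auto
    also have "\<dots> = sin (pi / 4)" by (simp add: sin_45 real_div_sqrt field_simps)
    finally have "arcsin (sin (grover_angle m)) \<le> arcsin (sin (pi / 4))"
      using s by (intro arcsin_le_arcsin) auto
    then show ?thesis using angle by (simp add: arcsin_sin)
  qed
qed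

lemma cos_grover_angle: "cos (grover_angle m) = sqrt (2 ^ m - 1) / sqrt (2 ^ m)"
proof -
  have "cos (grover_angle m) \<ge> 0"
    using grover_angle_bounds [of m] by (intro cos_ge_zero) auto
  then have "cos (grover_angle m) = sqrt (1 - (sin (grover_angle m))\<^sup>2)"
    by (metis cos_squared_eq real_sqrt_unique)
  also have "\<dots> = sqrt ((2 ^ m - 1) / 2 ^ m)"
    by (simp add: sin_grover_angle power_divide diff_divide_distrib)
  finally show ?thesis by (simp add: real_sqrt_divide)
qed

lemma cos_double_grover_angle: "cos (2 * grover_angle m) = 1 - 2 / 2 ^ m"
  unfolding cos_double_sin sin_grover_angle by (simp add: power_divide)

lemma sin_double_grover_angle: "sin (2 * grover_angle m) = 2 * sqrt (2 ^ m - 1) / 2 ^ m"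
  unfolding sin_double sin_grover_angle cos_grover_angle by simp

text \<open>By the choice of the floor, the final angle differs from \<open>pi / 2\<close> by at
  most one \<open>grover_angle m\<close>, which is at most \<open>pi / 4\<close> for positive
  \<open>m\<close>. For \<open>m = 0\<close> the angle is \<open>pi / 2\<close> and no iteration is
  made.\<close>

lemma sin_grover_count: "sin ((2 * real (grover_count m) + 1) * grover_angle m) \<ge> sqrt 2 / 2"
proof (cases "m = 0")
  case True
  then have "sin (grover_angle m) = 1" by (simp add: sin_grover_angle)
  moreover from True have "grover_count m = 0" by (simp add: grover_count_def)
  ultimately show ?thesis using sqrt2_less_2 by (simp add: field_simps)
next
  case False
  let ?\<theta> = "grover_angle m" and ?k = "real (grover_count m)"
  note \<theta> = grover_angle_bounds(1) [of m] grover_angle_bounds(3) [OF False]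
  have k: "grover_count m = nat \<lfloor>pi / (4 * ?\<theta>)\<rfloor>"
    by (simp add: grover_count_def grover_angle_def)
  have "?k = of_int \<lfloor>pi / (4 * ?\<theta>)\<rfloor>"
    unfolding k using \<theta> by simp
  then have "?k \<le> pi / (4 * ?\<theta>)" "pi / (4 * ?\<theta>) < ?k + 1"
    by linarith+
  then have "4 * (?k * ?\<theta>) \<le> pi" "pi < 4 * (?k * ?\<theta>) + 4 * ?\<theta>"
    using \<theta> by (simp_all add: field_simps)
  moreover have "(2 * ?k + 1) * ?\<theta> = 2 * (?k * ?\<theta>) + ?\<theta>"
    by (simp add: algebra_simps)
  ultimately have "\<bar>(2 * ?k + 1) * ?\<theta> - pi / 2\<bar> \<le> pi / 4"
    unfolding abs_le_iff using \<theta> by (intro conjI; linarith)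
  then have "cos (pi / 4) \<le> cos \<bar>(2 * ?k + 1) * ?\<theta> - pi / 2\<bar>"
    using \<theta> by (intro cos_monotone_0_pi_le) auto
  also have "\<dots> = sin ((2 * ?k + 1) * ?\<theta>)"
    by (simp add: cos_diff)
  finally show ?thesis by (simp add: cos_45)
qed

context unique_period
begin

text \<open>The closed form of exact Grover search after \<open>k\<close> iterations. For
  \<open>m = 0\<close> the second branch divides by zero, but no string in \<open>bits m\<close>
  reaches it.\<close>

definition amp :: "nat \<Rightarrow> (nat \<Rightarrow> bit) \<Rightarrow> complex" where
  "amp k i = complex_of_real (if i = i0 then sin ((2 * real k + 1) * grover_angle m)
     else cos ((2 * real k + 1) * grover_angle m) / sqrt (2 ^ m - 1))"

lemma sum_bits_split:
  fixes f :: "(nat \<Rightarrow> bit) \<Rightarrow> 'a::comm_ring_1"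
  assumes "\<And>i. i \<in> bits m \<Longrightarrow> f i = (if i = i0 then u else v)"
  shows "(\<Sum>i\<in>bits m. f i) = u + (2 ^ m - 1) * v"
proof -
  have "(\<Sum>i\<in>bits m. f i) = f i0 + (\<Sum>i\<in>bits m - {i0}. f i)"
    using i0_in by (simp add: sum.remove)
  also have "(\<Sum>i\<in>bits m - {i0}. f i) = (\<Sum>i\<in>bits m - {i0}. v)"
    using assms by (intro sum.cong) auto
  also have "\<dots> = (2 ^ m - 1) * v"
    using i0_in by (simp add: card_Diff_singleton card_bits of_nat_diff)
  finally show ?thesis using assms [OF i0_in] by simp
qed

lemma m_pos: "i \<in> bits m \<Longrightarrow> i \<noteq> i0 \<Longrightarrow> (2::real) ^ m - 1 > 0"
proof -
  assume "i \<in> bits m" "i \<noteq> i0"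
  then have "m \<noteq> 0" using i0_in by (auto simp: bits_eq_vecs)
  then show ?thesis by (simp add: one_less_power)
qed

lemma sum_amp: "(\<Sum>i\<in>bits m. (cmod (amp k i))\<^sup>2) \<le> 1"
proof -
  let ?\<phi> = "(2 * real k + 1) * grover_angle m"
  have "(\<Sum>i\<in>bits m. (cmod (amp k i))\<^sup>2) = (sin ?\<phi>)\<^sup>2 + (2 ^ m - 1) * (cos ?\<phi> / sqrt (2 ^ m - 1))\<^sup>2"
    by (rule sum_bits_split) (simp add: amp_def norm_divide power_divide)
  also have "\<dots> \<le> (sin ?\<phi>)\<^sup>2 + (cos ?\<phi>)\<^sup>2"
  proof (rule add_left_mono)
    show "(2 ^ m - 1) * (cos ?\<phi> / sqrt (2 ^ m - 1))\<^sup>2 \<le> (cos ?\<phi>)\<^sup>2"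
      by (cases "(2::real) ^ m - 1 = 0") (simp_all add: power_divide)
  qed
  finally show ?thesis by simp
qed

text \<open>Marking followed by inversion about the mean is a rotation by twice the Grover angle,
  since \<open>1 - 2 / 2 ^ m\<close> and \<open>2 * sqrt (2 ^ m - 1) / 2 ^ m\<close> are the cosine
  and sine of that double angle.\<close>

lemma amp_Suc:
  assumes i: "i \<in> bits m"
  shows "2 / 2 ^ m * (\<Sum>i\<in>bits m. mark (amp k) i) - mark (amp k) i = amp (Suc k) i"
proof -
  let ?\<phi> = "(2 * real k + 1) * grover_angle m" and ?r = "sqrt (2 ^ m - 1)"
  have "(\<Sum>i\<in>bits m. mark (amp k) i) = complex_of_real (- sin ?\<phi>) + (2 ^ m - 1) * complex_of_real (cos ?\<phi> / ?r)"
    by (rule sum_bits_split) (simp add: amp_def mark_def)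
  also have "\<dots> = complex_of_real (- sin ?\<phi> + (2 ^ m - 1) * (cos ?\<phi> / ?r))"
    by simp
  also have "(2 ^ m - 1) * (cos ?\<phi> / ?r) = ?r * cos ?\<phi>"
    by (simp add: real_div_sqrt flip: times_divide_eq_left)
  finally have sum: "(\<Sum>i\<in>bits m. mark (amp k) i) = complex_of_real (- sin ?\<phi> + ?r * cos ?\<phi>)" .
  have suc: "(2 * real (Suc k) + 1) * grover_angle m = ?\<phi> + 2 * grover_angle m"
    by (simp add: algebra_simps)
  show ?thesis
  proof (cases "i = i0")
    case True
    have "2 / 2 ^ m * (- sin ?\<phi> + ?r * cos ?\<phi>) + sin ?\<phi> = sin (?\<phi> + 2 * grover_angle m)"
      unfolding sin_add cos_double_grover_angle sin_double_grover_angle by (simp add: field_simps)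
    then have "complex_of_real (2 / 2 ^ m * (- sin ?\<phi> + ?r * cos ?\<phi>) + sin ?\<phi>) =
        complex_of_real (sin (?\<phi> + 2 * grover_angle m))"
      by (rule arg_cong)
    then show ?thesis
      using True unfolding sum by (simp add: mark_def amp_def suc del: of_nat_Suc)
  next
    case False
    have r: "?r * ?r = 2 ^ m - 1" "?r \<noteq> 0" using m_pos [OF i False] by auto
    \<comment> \<open>The addition theorem for the cosine, freed of trigonometry: only
      \<open>r * r = M - 1\<close> relates the number of indices to the square root.\<close>
    have algebra: "2 / M * (- u + r * v) - v / r = (v * (1 - 2 / M) - u * (2 * r / M)) / r"
      if "M \<noteq> 0" "r \<noteq> 0" "r * r = M - 1" for M r u v :: real
    proof -
      have "r * r * v = (M - 1) * v" using that(3) by simp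
      with that(1,2) show ?thesis by (simp add: divide_simps) algebra
    qed
    have "2 / 2 ^ m * (- sin ?\<phi> + ?r * cos ?\<phi>) - cos ?\<phi> / ?r = cos (?\<phi> + 2 * grover_angle m) / ?r"
      unfolding cos_add cos_double_grover_angle sin_double_grover_angle
      by (rule algebra) (use r in auto)
    then have "complex_of_real (2 / 2 ^ m * (- sin ?\<phi> + ?r * cos ?\<phi>) - cos ?\<phi> / ?r) =
        complex_of_real (cos (?\<phi> + 2 * grover_angle m) / ?r)"
      by (rule arg_cong)
    then show ?thesis
      using False unfolding sum by (simp add: mark_def amp_def suc del: of_nat_Suc)
  qed
qed

text \<open>The reflection subtracts twice the component at the zero string, here \<open>d\<close>,
  whose transform is the constant function with value twice the mean of \<open>a\<close>.
  \<open>Negate\<close> then turns \<open>a\<close> minus this constant into the inversion about the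
  mean.\<close>

lemma diffusion_S:
  "fold app (map (\<lambda>k. Gate (Hadamard (Index k))) [0..<m] @ [Reflect_Zero] @
      map (\<lambda>k. Gate (Hadamard (Index k))) [0..<m] @ [Negate]) (S a)
   = S (\<lambda>i. 2 / 2 ^ m * (\<Sum>i\<in>bits m. a i) - a i)"
proof -
  let ?s = "1 / complex_of_real (sqrt 2)"
  define b where "b u = ?s ^ m * (\<Sum>i\<in>bits m. chi (dot m i u) * a i)" for u :: "nat \<Rightarrow> bit"
  define d where "d u = (if u = 0 then 2 * b 0 else 0)" for u :: "nat \<Rightarrow> bit"
  have had: "had (idx m) (S f) = S (\<lambda>u. ?s ^ m * (\<Sum>i\<in>bits m. chi (dot m i u) * f i))" for f
    by (rule had_idx_st) (simp add: graph_def fun_eq_iff)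
  have 1: "had (idx m) (S a) = S b" by (simp add: had b_def [abs_def])
  have 2: "app Reflect_Zero (S b) = (\<lambda>z. S b z - S d z)"
  proof
    show "app Reflect_Zero (S b) z = S b z - S d z" for z
      by (cases "index_reg m z = 0") (auto simp: d_def st_graph)
  qed
  have 3: "had (idx m) (S b) = S a" by (simp flip: 1)
  have b0: "b 0 = ?s ^ m * (\<Sum>i\<in>bits m. a i)" by (simp add: b_def dot_def)
  have "(\<Sum>i\<in>bits m. chi (dot m i u) * d i) = 2 * b 0" for u
  proof -
    have "(\<Sum>i\<in>bits m. chi (dot m i u) * d i) = (\<Sum>i\<in>bits m. if i = 0 then 2 * b 0 else 0)"
      by (intro sum.cong) (auto simp: d_def dot_def)
    then show ?thesis by simp
  qed
  moreover have "?s ^ m * ?s ^ m = 1 / 2 ^ m"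
    by (simp add: sqrt2_mult_self flip: power_mult_distrib) (simp add: power_one_over)
  ultimately have 4: "had (idx m) (S d) = S (\<lambda>u. 2 / 2 ^ m * (\<Sum>i\<in>bits m. a i))"
    by (simp add: had b0 mult.assoc [symmetric] mult.commute [of _ 2])
       (simp add: mult.assoc)
  have "fold app (map (\<lambda>k. Gate (Hadamard (Index k))) [0..<m] @ [Reflect_Zero] @
      map (\<lambda>k. Gate (Hadamard (Index k))) [0..<m] @ [Negate]) (S a)
    = (\<lambda>z. - had (idx m) (\<lambda>z. S b z - S d z) z)"
    unfolding fold_append o_apply fold_Hadamard_idx 1 by (simp del: apply_step.simps(3) add: 2 fold_Hadamard_idx)
  also have "\<dots> = S (\<lambda>i. 2 / 2 ^ m * (\<Sum>i\<in>bits m. a i) - a i)"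
    unfolding had_diff 3 4 by (auto simp: st_graph fun_eq_iff ring_distribs)
  finally show ?thesis .
qed

lemma isom_grover_steps:
  assumes "s \<in> set (grover_iteration c n m)" shows "isom Qb (app s)"
proof -
  have "s \<in> {Rank_Flip, Reflect_Zero, Negate, Gate (PauliX Flag)} \<union> {Gate (Hadamard q) |q. q \<in> Qb} \<union>
      {Gate (Query_F j) |j. j < N}"
    using assms by (auto simp: grover_iteration_eq test_eq test_prep_def set_inp_list qubits_def idx_def)
  then show ?thesis by (intro isom_step F_in)
qed

lemma isom_offline_steps:
  assumes "s \<in> set (offline_phase c n m)" shows "isom Qb (app s)"
proof -
  have "s \<in> set (concat (replicate k (grover_iteration c n m))) \<Longrightarrow> s \<in> set (grover_iteration c n m)" for k
    by (auto split: if_splits)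
  then have "s \<in> {Gate (PauliX Flag), Gate (Hadamard Flag)} \<union> (\<lambda>k. Gate (Hadamard (Index k))) ` {..<m} \<or>
      s \<in> set (grover_iteration c n m)"
    using assms unfolding offline_phase_def by (auto simp del: set_concat)
  then show ?thesis
    by (elim disjE isom_grover_steps) (intro isom_step F_in, auto)
qed

abbreviation err :: real where "err \<equiv> 2 * sqrt (2 ^ n * (3/4) ^ N)"

lemma nrm_grover_iteration_error:
  "nrm Qb (fold app (grover_iteration c n m) (S (amp k)) - S (amp (Suc k))) \<le> err"
proof -
  let ?D = "map (\<lambda>k. Gate (Hadamard (Index k))) [0..<m] @ [Reflect_Zero] @
      map (\<lambda>k. Gate (Hadamard (Index k))) [0..<m] @ [Negate]"
  have D: "isom Qb (fold app ?D)"
    by (intro isom_fold isom_step F_in) (auto simp: qubits_def idx_def)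
  have T: "isom Qb (fold app (test c n))"
    by (intro isom_fold isom_step F_in) (auto simp: test_eq test_prep_def set_inp_list qubits_def)
  have "S (amp (Suc k)) = fold app ?D (S (mark (amp k)))"
    unfolding diffusion_S by (rule st_cong) (rule amp_Suc [symmetric])
  then have "nrm Qb (fold app (grover_iteration c n m) (S (amp k)) - S (amp (Suc k)))
      = nrm Qb (fold app ?D (fold app (test c n) (S (amp k))) - fold app ?D (S (mark (amp k))))"
    by (simp only: grover_iteration_eq fold_append o_apply)
  also have "\<dots> = nrm Qb (fold app (test c n) (S (amp k)) - S (mark (amp k)))"
    by (intro isom_nrm_diff D isomD(1) [OF T] supp_on_st)
  also have "\<dots> \<le> err" by (intro nrm_test_error sum_amp)
  finally show ?thesis .
qed

lemma nrm_grover_error: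
  "nrm Qb (fold app (concat (replicate k (grover_iteration c n m))) (S (amp 0)) - S (amp k)) \<le> real k * err"
proof (induction k)
  case 0
  then show ?case by (simp add: nrm_def L2_set_def)
next
  case (Suc k)
  let ?G = "fold app (grover_iteration c n m)"
  let ?\<psi> = "fold app (concat (replicate k (grover_iteration c n m))) (S (amp 0))"
  have G: "isom Qb ?G" by (intro isom_fold isom_grover_steps)
  have supp: "supp_on Qb ?\<psi>"
    by (rule isomD(1) [OF isom_fold]) (auto split: if_splits intro: isom_grover_steps)
  have "concat (replicate (Suc k) xs) = concat (replicate k xs) @ xs" for xs :: "step list"
    by (induction k) auto
  then have "fold app (concat (replicate (Suc k) (grover_iteration c n m))) (S (amp 0)) = ?G ?\<psi>"
    by (metis fold_append o_apply)
  \<comment> \<open>The intermediate state \<open>?G (S (amp k))\<close>, one actual iteration on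
    the ideal state, separates the inherited error from the new one.\<close>
  then have "nrm Qb (fold app (concat (replicate (Suc k) (grover_iteration c n m))) (S (amp 0)) - S (amp (Suc k)))
    \<le> nrm Qb (?G ?\<psi> - ?G (S (amp k))) + nrm Qb (?G (S (amp k)) - S (amp (Suc k)))"
    by (simp only: nrm_triangle)
  also have "nrm Qb (?G ?\<psi> - ?G (S (amp k))) = nrm Qb (?\<psi> - S (amp k))"
    by (intro isom_nrm_diff G supp supp_on_st)
  also have "nrm Qb (?\<psi> - S (amp k)) + nrm Qb (?G (S (amp k)) - S (amp (Suc k))) \<le> real k * err + err"
    by (intro add_mono Suc.IH nrm_grover_iteration_error)
  also have "\<dots> = real (Suc k) * err"
    by (simp add: distrib_right)
  finally show ?case .
qed

lemma prepare_S:
  "fold app (map (\<lambda>k. Gate (Hadamard (Index k))) [0..<m] @ [Gate (PauliX Flag), Gate (Hadamard Flag)]) (psi c n g)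
    = S (amp 0)"
proof -
  have amp0: "amp 0 i = (1 / complex_of_real (sqrt 2)) ^ m" if "i \<in> bits m" for i
  proof -
    have "i = i0 \<or> sqrt (2 ^ m - 1) \<noteq> 0" using m_pos [OF that] by auto
    then have "amp 0 i = complex_of_real (1 / sqrt (2 ^ m))"
      by (auto simp: amp_def sin_grover_angle cos_grover_angle)
    then show ?thesis by (simp add: power_one_over real_sqrt_power)
  qed
  have had: "had (idx m) (psi c n g) z =
      (1 / complex_of_real (sqrt 2)) ^ m * psi c n g (override_on z 0 (idx m))" for z
  proof (subst had_single_support)
    fix x :: config assume x: "x \<in> vecs (idx m)" "x \<noteq> 0"
    from x(2) obtain q where q: "x q \<noteq> 0" by (force simp: fun_eq_iff)
    with x(1) have "q \<in> idx m" by (auto simp: vecs_def)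
    with q have "\<exists>k. override_on z x (idx m) (Index k) \<noteq> 0" by (auto simp: override_on_def idx_def)
    then show "psi c n g (override_on z x (idx m)) = 0" by (auto simp: psi_eq)
  qed (auto simp: card_idx)
  have psi0: "psi c n g (override_on (z(Flag := v)) 0 (idx m)) =
      (if v = 0 \<and> z \<in> vecs Qb \<and> (\<forall>j<N. outp j z = g (inp_reg n j z))
       then complex_of_real ((2 powr (- real n / 2)) ^ N) else 0)" for z v
  proof -
    have o: "outp j (z(Flag := v)) = outp j z" for j by (simp add: outp_def)
    have *: "k < l \<or> outp j z k = 0" if "outp j z = g (inp_reg n j z)" for j k
      using g_in [OF inp_reg_in_bits, unfolded in_bits] that by simp
    then have bound: "k < l \<or> z (Outp j k) = 0" if "outp j z = g (inp_reg n j z)" for j k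
      using * [OF that, of k] by (simp only: outp_def)
    let ?w = "override_on (z(Flag := v)) 0 (idx m)"
    have w: "?w (Index k) = 0 \<longleftrightarrow> k < m \<or> z (Index k) = 0" "?w (Inp j k) = z (Inp j k)"
      "?w (Outp j k) = z (Outp j k)" "?w Flag = v" "?w (Work k) = z (Work k)" for j k
      by (auto simp: override_on_def)
    \<comment> \<open>In \<open>psi\<close> the outputs are limited only by being values of
      \<open>g\<close>, in \<open>vecs Qb\<close> by the length \<open>l\<close>; the range of
      \<open>g\<close> reconciles the two.\<close>
    have eq: "(\<forall>j k. j < N \<or> z (Outp j k) = 0) \<and> (\<forall>j<N. outp j z = g (inp_reg n j z)) \<longleftrightarrow>
        (\<forall>j k. j < N \<and> k < l \<or> z (Outp j k) = 0) \<and> (\<forall>j<N. outp j z = g (inp_reg n j z))"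
      using bound by blast
    have regroup: "X \<and> Y \<longleftrightarrow> X' \<and> Y \<Longrightarrow>
        A \<and> B \<and> X \<and> f \<and> W \<and> Y \<longleftrightarrow> f \<and> (A \<and> B \<and> X' \<and> W) \<and> Y" for A B X X' Y f W
      by blast
    show ?thesis
      unfolding psi_eq in_vecs_qubits w reg_override_idx inp_reg_upd_Flag o fun_upd_same
      by (rule if_cong [OF regroup [OF eq] refl refl])
  qed
  show ?thesis
  proof
    fix z
    have "fold app (map (\<lambda>k. Gate (Hadamard (Index k))) [0..<m] @ [Gate (PauliX Flag), Gate (Hadamard Flag)])
        (psi c n g) z
      = (had (idx m) (psi c n g) (z(Flag := 1)) + chi (z Flag) * had (idx m) (psi c n g) (z(Flag := 0)))
        / complex_of_real (sqrt 2)"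
      by (simp add: fold_Hadamard_idx apply_PauliX apply_Hadamard hgate_def)
    also have "\<dots> = S (amp 0) z"
      unfolding had psi0 st_graph by (auto simp: amp0)
    finally show "fold app (map (\<lambda>k. Gate (Hadamard (Index k))) [0..<m] @ [Gate (PauliX Flag), Gate (Hadamard Flag)])
        (psi c n g) z = S (amp 0) z" .
  qed
qed

lemma fold_offline_phase:
  "fold app (offline_phase c n m) (psi c n g) =
     fold app (concat (replicate (grover_count m) (grover_iteration c n m))) (S (amp 0))"
proof -
  have "offline_phase c n m =
      (map (\<lambda>k. Gate (Hadamard (Index k))) [0..<m] @ [Gate (PauliX Flag), Gate (Hadamard Flag)]) @
      concat (replicate (grover_count m) (grover_iteration c n m))"
    by (simp add: offline_phase_def)
  then show ?thesis by (simp only: fold_append o_apply flip: prepare_S)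
qed

lemma outcome_prob_eq:
  assumes "supp_on Qb \<psi>"
  shows "outcome_prob m \<psi> i = (\<Sum>z\<in>{z \<in> vecs Qb. index_reg m z = i}. (cmod (\<psi> z))\<^sup>2)"
proof -
  have "outcome_prob m \<psi> i = (\<Sum>\<^sub>\<infinity>z\<in>{z \<in> vecs Qb. index_reg m z = i}. (cmod (\<psi> z))\<^sup>2)"
    unfolding outcome_prob_def using assms by (intro infsum_cong_neutral) (auto simp: supp_on_def)
  then show ?thesis by simp
qed

text \<open>On the configurations with index \<open>i0\<close> the ideal state has norm at least
  \<open>sqrt 2 / 2\<close>, and the actual one differs by at most 1/4. As
  \<open>sqrt 2 \<ge> 1\<close>, a norm of 1/4 remains, and its square is the 1/16.\<close>

lemma outcome_prob_bounds:
  assumes "real (grover_count m) * err \<le> 1 / 4"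
  defines "\<psi> \<equiv> fold app (offline_phase c n m) (psi c n g)"
  shows "1 / 16 \<le> outcome_prob m \<psi> i0" "outcome_prob m \<psi> i0 \<le> 1"
proof -
  let ?K = "grover_count m"
  let ?A = "{z \<in> vecs Qb. index_reg m z = i0}"
  have A: "?A \<subseteq> vecs Qb" "finite ?A" by auto
  have iso: "isom Qb (fold app (concat (replicate ?K (grover_iteration c n m))))"
    by (intro isom_fold isom_grover_steps) (auto split: if_splits)
  have supp: "supp_on Qb \<psi>"
    unfolding \<psi>_def fold_offline_phase by (rule isomD(1) [OF iso]) simp
  note prob = outcome_prob_eq [OF supp]
  have "(nrm Qb \<psi>)\<^sup>2 = (\<Sum>i\<in>bits m. (cmod (amp 0 i))\<^sup>2)"
    unfolding \<psi>_def fold_offline_phase isomD(2) [OF iso supp_on_st]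
    by (rule nrm_st_graph) (simp add: g_in)
  then have "(nrm Qb \<psi>)\<^sup>2 \<le> 1" using sum_amp [of 0] by simp
  moreover have "outcome_prob m \<psi> i0 \<le> (nrm Qb \<psi>)\<^sup>2"
    unfolding prob nrm_sq by (intro sum_mono2) auto
  ultimately show "outcome_prob m \<psi> i0 \<le> 1" by simp
  have "sqrt 2 / 2 \<le> L2_set (\<lambda>z. cmod (S (amp ?K) z)) ?A"
  proof -
    \<comment> \<open>Deleting all other indices turns the norm over \<open>?A\<close> into a full
      norm, which \<open>nrm_st_graph\<close> evaluates.\<close>
    let ?b = "\<lambda>i. (if i = i0 then 1 else 0) * amp ?K i :: complex"
    have "(L2_set (\<lambda>z. cmod (S (amp ?K) z)) ?A)\<^sup>2 = (\<Sum>z\<in>?A. (cmod (S (amp ?K) z))\<^sup>2)"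
      by (simp add: L2_set_def sum_nonneg)
    also have "\<dots> = (\<Sum>z\<in>vecs Qb. (cmod (S ?b z))\<^sup>2)"
      unfolding st_mult by (rule sum.mono_neutral_cong_left) auto
    also have "\<dots> = (\<Sum>i\<in>bits m. (cmod (?b i))\<^sup>2)"
      unfolding nrm_sq [symmetric] by (rule nrm_st_graph) (simp add: g_in)
    also have "\<dots> = (\<Sum>i\<in>bits m. if i = i0 then (cmod (amp ?K i0))\<^sup>2 else 0)"
      by (intro sum.cong) auto
    also have "\<dots> = (sin ((2 * real ?K + 1) * grover_angle m))\<^sup>2"
      using i0_in by (simp add: amp_def)
    finally have "(sin ((2 * real ?K + 1) * grover_angle m))\<^sup>2 \<le> (L2_set (\<lambda>z. cmod (S (amp ?K) z)) ?A)\<^sup>2"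
      by (rule eq_refl [OF sym])
    then have "sin ((2 * real ?K + 1) * grover_angle m) \<le> L2_set (\<lambda>z. cmod (S (amp ?K) z)) ?A"
      by (rule power2_le_imp_le) simp
    then show ?thesis using sin_grover_count [of m] by linarith
  qed
  also have "\<dots> \<le> L2_set (\<lambda>z. cmod ((S (amp ?K) - \<psi>) z)) ?A + L2_set (\<lambda>z. cmod (\<psi> z)) ?A"
    using L2_set_cmod_triangle [of "S (amp ?K) - \<psi>" \<psi> ?A] by simp
  also have "L2_set (\<lambda>z. cmod ((S (amp ?K) - \<psi>) z)) ?A \<le> nrm Qb (\<psi> - S (amp ?K))"
    unfolding nrm_def L2_set_def using A
    by (intro real_sqrt_le_mono) (auto simp: norm_minus_commute intro!: sum_mono2)
  also have "\<dots> \<le> 1 / 4"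
    using nrm_grover_error [of ?K] assms(1) unfolding \<psi>_def fold_offline_phase by linarith
  also have "L2_set (\<lambda>z. cmod (\<psi> z)) ?A = sqrt (outcome_prob m \<psi> i0)"
    by (simp add: prob L2_set_def)
  finally have "sqrt 2 / 2 - 1 / 4 \<le> sqrt (outcome_prob m \<psi> i0)" by simp
  moreover have "1 \<le> sqrt 2" by simp
  ultimately have "1 / 4 \<le> sqrt (outcome_prob m \<psi> i0)" by linarith
  then have "(1 / 4)\<^sup>2 \<le> outcome_prob m \<psi> i0"
    by (intro sqrt_ge_absD) simp
  then show "1 / 16 \<le> outcome_prob m \<psi> i0" by (simp add: power2_eq_square)
qed

end

section \<open>Circuits for the steps\<close>

lemma bit_cases: "(b::bit) = 0 \<or> b = 1" by (cases b) auto

text \<open>The last clause is a default for the gates that \<open>classical\<close>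
  excludes.\<close>

fun cact :: "gate \<Rightarrow> config \<Rightarrow> config" where
  "cact (PauliX a) z = z(a := z a + 1)"
| "cact (CNot a t) z = z(t := z t + z a)"
| "cact (Toffoli a b t) z = z(t := z t + z a * z b)"
| "cact _ z = z"

definition classical :: "gate \<Rightarrow> bool" where
  "classical x \<longleftrightarrow> elementary x \<and> (\<forall>a. x \<noteq> Hadamard a)"

lemma classical_simps [simp]:
  "classical (PauliX a)" "classical (CNot a t) \<longleftrightarrow> a \<noteq> t" "classical (Toffoli a b t) \<longleftrightarrow> distinct [a, b, t]"
  by (simp_all add: classical_def)

lemma cact_cact: "classical x \<Longrightarrow> cact x (cact x z) = z"
  by (cases x) (auto simp: classical_def add.assoc)

lemma apply_gate_classical: "classical x \<Longrightarrow> apply_gate F g m n x \<psi> = (\<lambda>z. \<psi> (cact x z))"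
proof -
  assume x: "classical x"
  then have "(\<And>z. cact x z = f z) \<Longrightarrow> basis_map f \<psi> = (\<lambda>z. \<psi> (f z))" for f
    using cact_cact [OF x] by (intro basis_map_involution) metis
  with x show ?thesis by (cases x) (auto simp: classical_def apply_gate.simps)
qed

lemma run_append: "run F g m n (C @ D) \<psi> = run F g m n D (run F g m n C \<psi>)"
  by (simp add: run_def)

text \<open>Tracing the amplitude at \<open>z\<close> back to its origin meets the last gate first,
  hence the reversal; the gates are involutions, so no inverses show up.\<close>

lemma run_classical:
  "(\<forall>x\<in>set C. classical x) \<Longrightarrow> run F g m n C \<psi> = (\<lambda>z. \<psi> (fold cact (rev C) z))"
  by (induction C arbitrary: \<psi>) (simp_all add: run_def apply_gate_classical)

lemma fold_cact_rev:
  "(\<forall>x\<in>set C. classical x) \<Longrightarrow> fold cact (rev C) (fold cact C z) = z"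
  by (induction C arbitrary: z) (simp_all add: cact_cact)

lemma hgate_X_hgate: "hgate w (\<lambda>z. hgate w \<psi> (z(w := z w + 1))) = (\<lambda>z. chi (z w) * \<psi> z)"
proof
  fix z :: config
  have "z = z(w := z w)" by simp
  then show "hgate w (\<lambda>z. hgate w \<psi> (z(w := z w + 1))) z = chi (z w) * \<psi> z"
    by (cases "z w") (auto simp: hgate_def chi_add divide_simps sqrt2_mult_self simp del: fun_upd_triv)
qed

text \<open>Pauli Z, which is not among the gates, as X conjugated by Hadamard gates.\<close>

definition phase :: "qubit \<Rightarrow> gate list" where
  "phase w = [Hadamard w, PauliX w, Hadamard w]"

lemma run_phase: "run F g m n (phase w) \<psi> = (\<lambda>z. chi (z w) * \<psi> z)"
  by (simp add: phase_def run_def apply_Hadamard apply_PauliX hgate_X_hgate)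

lemma run_phase_conj:
  assumes "\<forall>x\<in>set C. classical x"
  shows "run F g m n (C @ phase w @ rev C) \<psi> = (\<lambda>z. chi (fold cact C z w) * \<psi> z)"
  using assms by (simp add: run_append run_classical run_phase fold_cact_rev)

fun gate_qubits :: "gate \<Rightarrow> qubit set" where
  "gate_qubits (PauliX a) = {a}"
| "gate_qubits (CNot a t) = {a, t}"
| "gate_qubits (Toffoli a b t) = {a, b, t}"
| "gate_qubits _ = {}"

lemma fold_cact_upd:
  assumes "\<forall>x\<in>set C. q \<notin> gate_qubits x"
  shows "fold cact C (z(q := v)) = (fold cact C z)(q := v)"
  using assms
proof (induction C arbitrary: z)
  case (Cons x C)
  have "cact x (z(q := v)) = (cact x z)(q := v)"
    using Cons.prems by (cases x) (auto simp: fun_upd_twist)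
  then have "fold cact (x # C) (z(q := v)) = fold cact C ((cact x z)(q := v))"
    by (simp only: fold_simps)
  also have "\<dots> = (fold cact C (cact x z))(q := v)"
    using Cons.prems by (intro Cons.IH) simp
  finally show ?case by (simp only: fold_simps)
qed simp

lemma fold_cact_untouched:
  "(\<forall>x\<in>set C. q \<notin> gate_qubits x) \<Longrightarrow> fold cact C z q = z q"
  using fold_cact_upd [of C q z "z q"] by (metis fun_upd_same fun_upd_triv)

text \<open>Compute, copy, uncompute. The \<open>PauliX\<close> complements the copied bit:
  \<open>w\<close> will announce full rank, whereas the flag has to flip on deficiency. As
  \<open>C\<close> avoids the flag, the copy does not disturb the uncomputation.\<close>

lemma run_flag_conj:
  assumes "\<forall>x\<in>set C. classical x" "\<forall>x\<in>set C. Flag \<notin> gate_qubits x" "w \<noteq> Flag"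
  shows "run F g m n (C @ [CNot w Flag, PauliX Flag] @ rev C) \<psi> =
    (\<lambda>z. \<psi> (z(Flag := z Flag + (1 + fold cact C z w))))"
proof -
  have "\<forall>x\<in>set (C @ [CNot w Flag, PauliX Flag] @ rev C). classical x"
    using assms by auto
  then have "run F g m n (C @ [CNot w Flag, PauliX Flag] @ rev C) \<psi> =
    (\<lambda>z. \<psi> (fold cact (rev (C @ [CNot w Flag, PauliX Flag] @ rev C)) z))"
    by (rule run_classical)
  moreover have "fold cact (rev (C @ [CNot w Flag, PauliX Flag] @ rev C)) z
      = z(Flag := z Flag + (1 + fold cact C z w))" for z
    using assms fold_cact_untouched [OF assms(2), of z]
    by (simp add: fold_cact_upd fold_cact_rev add.assoc)
  ultimately show ?thesis by simp
qed

text \<open>No target serves as control or source, so the gates do not influence one another and add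
  a whole register under one control.\<close>

lemma fold_Toffoli:
  assumes "distinct ks" "inj h" "\<And>k. a \<noteq> h k" "\<And>k k'. f k \<noteq> h k'"
  shows "k \<in> set ks \<Longrightarrow> fold cact (map (\<lambda>k. Toffoli a (f k) (h k)) ks) z (h k) = z (h k) + z a * z (f k)"
    and "q \<notin> h ` set ks \<Longrightarrow> fold cact (map (\<lambda>k. Toffoli a (f k) (h k)) ks) z q = z q"
proof -
  have *: "(k \<in> set ks \<longrightarrow> fold cact (map (\<lambda>k. Toffoli a (f k) (h k)) ks) z (h k) = z (h k) + z a * z (f k)) \<and>
      (q \<notin> h ` set ks \<longrightarrow> fold cact (map (\<lambda>k. Toffoli a (f k) (h k)) ks) z q = z q)" for k q
    using assms(1)
  proof (induction ks arbitrary: z k q)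
    case (Cons k0 ks)
    have ne: "h k = h k' \<longleftrightarrow> k = k'" "a \<noteq> h k" "f k \<noteq> h k'" for k k'
      using assms(2,3,4) by (auto simp: inj_def)
    let ?z = "cact (Toffoli a (f k0) (h k0)) z"
    let ?D = "map (\<lambda>k. Toffoli a (f k) (h k)) ks"
    have z: "?z a = z a" "?z (f k) = z (f k)" "?z (h k0) = z (h k0) + z a * z (f k0)"
        "q \<noteq> h k0 \<Longrightarrow> ?z q = z q" for k q
      using ne(2,3) by auto
    have IH: "k \<in> set ks \<Longrightarrow> fold cact ?D ?z (h k) = ?z (h k) + ?z a * ?z (f k)"
        "q \<notin> h ` set ks \<Longrightarrow> fold cact ?D ?z q = ?z q" for k q
      using Cons.IH Cons.prems by (simp_all del: cact.simps)
    have k0: "h k0 \<notin> h ` set ks" using ne(1) Cons.prems by auto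
    have "fold cact (map (\<lambda>k. Toffoli a (f k) (h k)) (k0 # ks)) z = fold cact ?D ?z"
      by simp
    moreover have "fold cact ?D ?z (h k) = z (h k) + z a * z (f k)" if "k \<in> set (k0 # ks)"
    proof (cases "k = k0")
      case True
      then show ?thesis using IH(2) [OF k0] z(3) by simp
    next
      case False
      then show ?thesis using that IH(1) [of k] z(1,2) z(4) [of "h k"] ne(1) by simp
    qed
    moreover have "fold cact ?D ?z q = z q" if "q \<notin> h ` set (k0 # ks)"
      using that IH(2) [of q] z(4) [of q] by simp
    ultimately show ?case by simp
  qed simp
  show "k \<in> set ks \<Longrightarrow> fold cact (map (\<lambda>k. Toffoli a (f k) (h k)) ks) z (h k) = z (h k) + z a * z (f k)"
    "q \<notin> h ` set ks \<Longrightarrow> fold cact (map (\<lambda>k. Toffoli a (f k) (h k)) ks) z q = z q"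
    using * by auto
qed

text \<open>The pairing function provides ancillas with three coordinates. The first one is the
  purpose: 0 for rows of the echelon form, 2 for the decision to move a vector, 3 for conjunctions,
  4 for saved leading bits.\<close>

definition anc :: "nat \<Rightarrow> nat \<Rightarrow> nat \<Rightarrow> qubit" where
  "anc a b k = Work (prod_encode (a, prod_encode (b, k)))"

lemma anc_eq [simp]: "anc a b k = anc a' b' k' \<longleftrightarrow> a = a' \<and> b = b' \<and> k = k'"
  by (auto simp: anc_def prod_encode_eq)

lemma anc_ne [simp]:
  "anc a b k \<noteq> Inp j i" "Inp j i \<noteq> anc a b k" "anc a b k \<noteq> Index i" "Index i \<noteq> anc a b k"
  "anc a b k \<noteq> Flag" "Flag \<noteq> anc a b k"
  by (simp_all add: anc_def)

text \<open>\<open>anc 3 k 0\<close> holds the conjunction of the first \<open>k\<close> bits; the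
  initial \<open>PauliX\<close> sets the empty conjunction to 1.\<close>

definition conj_chain :: "(nat \<Rightarrow> qubit) \<Rightarrow> nat \<Rightarrow> gate list" where
  "conj_chain q n = PauliX (anc 3 0 0) # map (\<lambda>k. Toffoli (anc 3 k 0) (q k) (anc 3 (Suc k) 0)) [0..<n]"

lemma fold_conj_chain:
  assumes "\<And>k. z (anc 3 k 0) = 0" "\<And>k k'. q k \<noteq> anc 3 k' 0"
  shows "fold cact (conj_chain q n) z (anc 3 n 0) = (if \<forall>k<n. z (q k) = 1 then 1 else 0)"
proof -
  have "fold cact (conj_chain q n) z (anc 3 k 0) = (if k \<le> n \<and> (\<forall>i<k. z (q i) = 1) then 1 else 0) \<and>
      fold cact (conj_chain q n) z (q i) = z (q i)" for k i
  proof (induction n arbitrary: k i)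
    case 0
    then show ?case using assms by (auto simp: conj_chain_def)
  next
    case (Suc n)
    have "conj_chain q (Suc n) = conj_chain q n @ [Toffoli (anc 3 n 0) (q n) (anc 3 (Suc n) 0)]"
      by (simp add: conj_chain_def)
    then show ?case
      using Suc assms(2) by (auto simp: le_Suc_eq less_Suc_eq)
  qed
  then show ?thesis by simp
qed

lemma classical_conj_chain:
  "(\<And>k k'. q k \<noteq> anc 3 k' 0) \<Longrightarrow> x \<in> set (conj_chain q n) \<Longrightarrow> classical x"
  by (auto simp: conj_chain_def) metis

text \<open>Complementing the index first turns the comparison with the zero string into a
  conjunction.\<close>

definition reflect_prep :: "nat \<Rightarrow> gate list" where
  "reflect_prep m = map (\<lambda>k. PauliX (Index k)) [0..<m] @ conj_chain Index m"

definition reflect_circuit :: "nat \<Rightarrow> gate list" where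
  "reflect_circuit m = reflect_prep m @ phase (anc 3 m 0) @ rev (reflect_prep m)"

lemma fold_map_X_Index:
  "fold cact (map (\<lambda>k. PauliX (Index k)) [0..<m]) z =
     (\<lambda>q. case q of Index k \<Rightarrow> z q + (if k < m then 1 else 0) | _ \<Rightarrow> z q)"
proof (induction m)
  case (Suc m)
  then show ?case by (auto simp: fun_eq_iff split: qubit.split)
qed (auto simp: fun_eq_iff split: qubit.split)

lemma run_reflect_circuit:
  assumes "clean \<psi>"
  shows "run F g m n (reflect_circuit m) \<psi> = (\<lambda>z. if index_reg m z = 0 then - \<psi> z else \<psi> z)"
proof
  fix z
  have "\<forall>x\<in>set (reflect_prep m). classical x"
    by (auto simp: reflect_prep_def intro: classical_conj_chain [rotated])
  then have run: "run F g m n (reflect_circuit m) \<psi> z = chi (fold cact (reflect_prep m) z (anc 3 m 0)) * \<psi> z"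
    unfolding reflect_circuit_def by (simp add: run_phase_conj)
  show "run F g m n (reflect_circuit m) \<psi> z = (if index_reg m z = 0 then - \<psi> z else \<psi> z)"
  proof (cases "\<psi> z = 0")
    case False
    then have "z (Work k) = 0" for k using assms by (auto simp: clean_def)
    then have "fold cact (reflect_prep m) z (anc 3 m 0) = (if \<forall>k<m. z (Index k) + 1 = 1 then 1 else 0)"
      unfolding reflect_prep_def fold_append o_apply
      by (subst fold_conj_chain) (auto simp: fold_map_X_Index anc_def)
    moreover have "(\<forall>k<m. z (Index k) + 1 = 1) \<longleftrightarrow> index_reg m z = 0"
      by (auto simp: index_reg_def fun_eq_iff)
    ultimately show ?thesis by (simp add: run)
  qed (simp add: run)
qed

text \<open>X and Z anticommute, so the product X Z X Z is -1 on any state of the flag.\<close>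

definition negate_circuit :: "gate list" where
  "negate_circuit = [PauliX Flag] @ phase Flag @ [PauliX Flag] @ phase Flag"

lemma run_negate_circuit: "run F g m n negate_circuit \<psi> = (\<lambda>z. - \<psi> z)"
proof -
  have X: "run F g m n [PauliX Flag] \<phi> = (\<lambda>z. \<phi> (z(Flag := z Flag + 1)))" for \<phi>
    by (simp add: run_def apply_PauliX)
  have "chi b * (chi (b + 1) * a) = - a" for b a by (cases b) auto
  then show ?thesis
    unfolding negate_circuit_def run_append X run_phase by (simp add: add.assoc)
qed

text \<open>In-place Gaussian elimination. Row \<open>p\<close> of the echelon form, held in the ancillas
  \<open>anc 0 p k\<close>, is either zero or has its leading one in column \<open>p\<close>, so that its diagonal entry
  tells whether the pivot is present. If the bit \<open>t\<close> of the current vector in column \<open>p\<close> is 1,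
  then the vector is moved to row \<open>p\<close> when the pivot is absent, and row \<open>p\<close> is added to it otherwise:
  in both cases row \<open>p\<close>, after its update, is added to the vector. The ancilla \<open>anc 4 j p\<close> keeps
  \<open>t\<close>, and \<open>anc 2 j p\<close> tells whether the vector is moved.\<close>

definition pivot_step :: "nat \<Rightarrow> nat \<Rightarrow> nat \<Rightarrow> gate list" where
  "pivot_step n j p =
     [CNot (Inp j p) (anc 4 j p), CNot (anc 4 j p) (anc 2 j p), Toffoli (anc 4 j p) (anc 0 p p) (anc 2 j p)] @
     map (\<lambda>k. Toffoli (anc 2 j p) (Inp j k) (anc 0 p k)) [0..<n] @
     map (\<lambda>k. Toffoli (anc 4 j p) (anc 0 p k) (Inp j k)) [0..<n]"

definition insert_circuit :: "nat \<Rightarrow> nat \<Rightarrow> nat \<Rightarrow> gate list" where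
  "insert_circuit n j p = concat (map (pivot_step n j) [0..<p])"

definition elim_circuit :: "nat \<Rightarrow> nat \<Rightarrow> gate list" where
  "elim_circuit n N = concat (map (\<lambda>j. insert_circuit n j n) [0..<N])"

definition rank_prep :: "nat \<Rightarrow> nat \<Rightarrow> gate list" where
  "rank_prep n N = elim_circuit n N @ conj_chain (\<lambda>k. anc 0 k k) n"

definition rank_circuit :: "nat \<Rightarrow> nat \<Rightarrow> gate list" where
  "rank_circuit n N = rank_prep n N @ [CNot (anc 3 n 0) Flag, PauliX Flag] @ rev (rank_prep n N)"

section \<open>Correctness of the Gaussian elimination\<close>

definition ech_row :: "nat \<Rightarrow> config \<Rightarrow> nat \<Rightarrow> nat \<Rightarrow> bit" where
  "ech_row n z p = (\<lambda>k. if k < n then z (anc 0 p k) else 0)"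

definition echelon :: "nat \<Rightarrow> (nat \<Rightarrow> nat \<Rightarrow> bit) \<Rightarrow> bool" where
  "echelon n R \<longleftrightarrow> (\<forall>p<n. R p \<in> bits n \<and> (\<forall>k<p. R p k = 0) \<and> (R p p = 0 \<longrightarrow> R p = 0))"

lemma fold_pivot_step:
  assumes "z (anc 4 j p) = 0" "z (anc 2 j p) = 0" "p < n"
  defines "z' \<equiv> fold cact (pivot_step n j p) z"
  shows "ech_row n z' p = ech_row n z p + (if z (Inp j p) = 1 \<and> ech_row n z p p = 0 then inp_reg n j z else 0)"
    "p' \<noteq> p \<Longrightarrow> ech_row n z' p' = ech_row n z p'"
    "inp_reg n j z' = inp_reg n j z + (if z (Inp j p) = 1 then ech_row n z' p else 0)"
    "j' \<noteq> j \<Longrightarrow> inp_reg n j' z' = inp_reg n j' z"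
    "(j', p') \<noteq> (j, p) \<Longrightarrow> z' (anc 4 j' p') = z (anc 4 j' p')"
    "(j', p') \<noteq> (j, p) \<Longrightarrow> z' (anc 2 j' p') = z (anc 2 j' p')"
    "z' (anc 3 i k) = z (anc 3 i k)"
proof -
  define z1 where "z1 = fold cact
    [CNot (Inp j p) (anc 4 j p), CNot (anc 4 j p) (anc 2 j p), Toffoli (anc 4 j p) (anc 0 p p) (anc 2 j p)] z"
  define z2 where "z2 = fold cact (map (\<lambda>k. Toffoli (anc 2 j p) (Inp j k) (anc 0 p k)) [0..<n]) z1"
  have z': "z' = fold cact (map (\<lambda>k. Toffoli (anc 4 j p) (anc 0 p k) (Inp j k)) [0..<n]) z2"
    by (simp add: z'_def pivot_step_def z1_def z2_def)
  \<comment> \<open>With \<open>t\<close> the leading bit, the CNOT and the Toffoli add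
    \<open>t\<close> and \<open>t\<close> times the diagonal entry to \<open>anc 2 j p\<close>,
    which is therefore 1 just when \<open>t\<close> is set and the pivot is absent.\<close>
  have z1: "z1 (anc 4 j p) = z (Inp j p)" "z1 (anc 2 j p) = z (Inp j p) * (1 + z (anc 0 p p))"
    "q \<noteq> anc 4 j p \<Longrightarrow> q \<noteq> anc 2 j p \<Longrightarrow> z1 q = z q" for q
    using assms(1,2) by (auto simp: z1_def distrib_left)
  have z2: "k < n \<Longrightarrow> z2 (anc 0 p k) = z (anc 0 p k) + z (Inp j p) * (1 + z (anc 0 p p)) * z (Inp j k)"
    "q \<notin> anc 0 p ` {0..<n} \<Longrightarrow> z2 q = z1 q" for k q
    unfolding z2_def
    using fold_Toffoli(1) [of "[0..<n]" "anc 0 p" "anc 2 j p" "Inp j" k z1]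
      fold_Toffoli(2) [of "[0..<n]" "anc 0 p" "anc 2 j p" "Inp j" q z1]
    by (auto simp: inj_def z1)
  \<comment> \<open>The control is the saved copy \<open>anc 4 j p\<close>, because this sweep
    overwrites \<open>Inp j p\<close> itself.\<close>
  have z3: "k < n \<Longrightarrow> z' (Inp j k) = z2 (Inp j k) + z2 (anc 4 j p) * z2 (anc 0 p k)"
    "q \<notin> Inp j ` {0..<n} \<Longrightarrow> z' q = z2 q" for k q
    unfolding z'
    using fold_Toffoli(1) [of "[0..<n]" "Inp j" "anc 4 j p" "anc 0 p" k z2]
      fold_Toffoli(2) [of "[0..<n]" "Inp j" "anc 4 j p" "anc 0 p" q z2]
    by (auto simp: inj_def)
  have other: "z' q = z q" if "q \<notin> Inp j ` {0..<n}" "q \<notin> anc 0 p ` {0..<n}" "q \<noteq> anc 4 j p" "q \<noteq> anc 2 j p" for q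
    using that z1(3) z2(2) z3(2) by simp
  have row': "ech_row n z' p k = ech_row n z p k + z (Inp j p) * (1 + z (anc 0 p p)) * inp_reg n j z k" for k
    by (auto simp: ech_row_def inp_reg_def z3(2) z2(1) image_iff)
  then show "ech_row n z' p = ech_row n z p + (if z (Inp j p) = 1 \<and> ech_row n z p p = 0 then inp_reg n j z else 0)"
    using assms(3) bit_cases [of "z (Inp j p)"] bit_cases [of "z (anc 0 p p)"]
    by (auto simp: fun_eq_iff ech_row_def)
  have "inp_reg n j z' k = inp_reg n j z k + z (Inp j p) * ech_row n z' p k" for k
    by (auto simp: ech_row_def inp_reg_def z3 z2(2) z1 image_iff)
  then show "inp_reg n j z' = inp_reg n j z + (if z (Inp j p) = 1 then ech_row n z' p else 0)"
    using bit_cases [of "z (Inp j p)"] by (auto simp: fun_eq_iff)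
  show "p' \<noteq> p \<Longrightarrow> ech_row n z' p' = ech_row n z p'"
    by (auto simp: ech_row_def fun_eq_iff image_iff intro!: other)
  show "j' \<noteq> j \<Longrightarrow> inp_reg n j' z' = inp_reg n j' z"
    by (auto simp: inp_reg_def fun_eq_iff image_iff intro!: other)
  show "(j', p') \<noteq> (j, p) \<Longrightarrow> z' (anc 4 j' p') = z (anc 4 j' p')"
    "(j', p') \<noteq> (j, p) \<Longrightarrow> z' (anc 2 j' p') = z (anc 2 j' p')" "z' (anc 3 i k) = z (anc 3 i k)"
    by (auto simp: image_iff intro!: other)
qed

lemma span_insert_add:
  assumes "w \<in> f2.span A"
  shows "f2.span (insert (v + w) A) = f2.span (insert v A)"
proof -
  have "f2.span (insert (v + w) A) \<subseteq> f2.span (insert v A)" if "w \<in> f2.span A" for v w :: "nat \<Rightarrow> bit"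
  proof (rule f2.span_minimal)
    have "w \<in> f2.span (insert v A)" using that f2.span_mono [of A "insert v A"] by blast
    then show "insert (v + w) A \<subseteq> f2.span (insert v A)"
      by (auto intro: f2.span_add f2.span_base)
  qed simp
  \<comment> \<open>The second use gives the converse inclusion, as
    \<open>v + w + w = v\<close>.\<close>
  from this [OF assms, of v] this [OF assms, of "v + w"] show ?thesis by auto
qed

text \<open>If the leading bit is 0, nothing changes; if the pivot is present, its row cancels the
  bit; if it is absent, the vector becomes the row and cancels itself. The invariant is the span of
  the rows together with the current vector.\<close>

lemma echelon_step:
  assumes R: "echelon n R" and v: "v \<in> bits n" "\<forall>k<p. v k = 0" and p: "p < n"
    and r: "r = R p + (if v p = 1 \<and> R p p = 0 then v else 0)"
    and w: "w = v + (if v p = 1 then r else 0)"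
    and R': "R' p = r" "\<And>p'. p' \<noteq> p \<Longrightarrow> R' p' = R p'"
  shows "echelon n R'" "\<forall>k<Suc p. w k = 0"
    "f2.span (insert w (R' ` {..<n})) = f2.span (insert v (R ` {..<n}))"
proof -
  have Rp: "R p \<in> bits n" "\<forall>k<p. R p k = 0" "R p p = 0 \<Longrightarrow> R p = 0"
    using R p by (auto simp: echelon_def)
  have R'_eq: "R' = R(p := r)" using R' by (auto simp: fun_eq_iff)
  consider "v p = 0" | "v p = 1" "R p p = 1" | "v p = 1" "R p p = 0" "R p = 0"
    using bit_cases Rp(3) by blast
  then have "echelon n R' \<and> (\<forall>k<Suc p. w k = 0) \<and>
      f2.span (insert w (R' ` {..<n})) = f2.span (insert v (R ` {..<n}))"
  proof cases
    case 1
    then have "r = R p" "w = v" by (simp_all add: r w)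
    then show ?thesis using R v 1 by (auto simp: R'_eq less_Suc_eq)
  next
    case 2
    then have rw: "r = R p" "w = v + R p" by (simp_all add: r w)
    have "R p \<in> f2.span (R ` {..<n})" using p by (intro f2.span_base) auto
    then have "f2.span (insert w (R ` {..<n})) = f2.span (insert v (R ` {..<n}))"
      unfolding rw by (rule span_insert_add)
    then show ?thesis using R v 2 Rp by (auto simp: R'_eq rw less_Suc_eq)
  next
    case 3
    then have rw: "r = v" "w = 0" by (simp_all add: r w)
    \<comment> \<open>Row \<open>p\<close> was zero: \<open>v\<close> takes its place among the
      rows, and the zero vector takes the place of \<open>v\<close>, so even the sets of generators
      agree.\<close>
    have "R ` {..<n} = insert 0 (R ` ({..<n} - {p}))" "R' ` {..<n} = insert v (R ` ({..<n} - {p}))"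
      using p 3(3) by (auto simp: R'_eq rw image_iff)
    then have "insert w (R' ` {..<n}) = insert v (R ` {..<n})"
      unfolding rw by auto
    moreover have "echelon n R'"
      using R v 3 by (auto simp: echelon_def R'_eq rw)
    ultimately show ?thesis by (simp add: rw)
  qed
  then show "echelon n R'" "\<forall>k<Suc p. w k = 0"
    "f2.span (insert w (R' ` {..<n})) = f2.span (insert v (R ` {..<n}))" by auto
qed

text \<open>The clauses about ancillas serve the induction: those of later columns and of other
  vectors are untouched, hence still 0 when their pivot step starts.\<close>

lemma fold_insert_circuit:
  assumes "echelon n (ech_row n z)" "\<And>p. z (anc 4 j p) = 0 \<and> z (anc 2 j p) = 0" "p \<le> n"
  defines "z' \<equiv> fold cact (insert_circuit n j p) z"
  shows "echelon n (ech_row n z') \<and> (\<forall>k<p. inp_reg n j z' k = 0) \<and>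
      f2.span (insert (inp_reg n j z') (ech_row n z' ` {..<n})) = f2.span (insert (inp_reg n j z) (ech_row n z ` {..<n})) \<and>
      (\<forall>j'. j' \<noteq> j \<longrightarrow> inp_reg n j' z' = inp_reg n j' z) \<and>
      (\<forall>j' p'. j' \<noteq> j \<or> p \<le> p' \<longrightarrow> z' (anc 4 j' p') = z (anc 4 j' p') \<and> z' (anc 2 j' p') = z (anc 2 j' p')) \<and>
      (\<forall>i k. z' (anc 3 i k) = z (anc 3 i k))"
  using assms(3) unfolding z'_def
proof (induction p)
  case 0
  then show ?case using assms(1) by (simp add: insert_circuit_def)
next
  case (Suc p)
  define y where "y = fold cact (insert_circuit n j p) z"
  have IH: "echelon n (ech_row n y)" "\<forall>k<p. inp_reg n j y k = 0"
      "f2.span (insert (inp_reg n j y) (ech_row n y ` {..<n})) = f2.span (insert (inp_reg n j z) (ech_row n z ` {..<n}))"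
      "\<And>j'. j' \<noteq> j \<Longrightarrow> inp_reg n j' y = inp_reg n j' z"
      "\<And>j' p'. j' \<noteq> j \<or> p \<le> p' \<Longrightarrow> y (anc 4 j' p') = z (anc 4 j' p') \<and> y (anc 2 j' p') = z (anc 2 j' p')"
      "\<And>i k. y (anc 3 i k) = z (anc 3 i k)"
    using Suc unfolding y_def by auto
  let ?y' = "fold cact (pivot_step n j p) y"
  have y': "fold cact (insert_circuit n j (Suc p)) z = ?y'"
    by (simp add: insert_circuit_def y_def)
  have p: "p < n" using Suc.prems by simp
  have "y (anc 4 j p) = 0" "y (anc 2 j p) = 0" using IH(5) [of j p] assms(2) by auto
  note step = fold_pivot_step [OF this p]
  have vp: "inp_reg n j y p = y (Inp j p)" using p by (simp add: inp_reg_def)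
  note ech = echelon_step [OF IH(1) inp_reg_in_bits IH(2) p, unfolded vp, OF step(1) step(3) refl step(2)]
  show ?case
    unfolding y' using ech IH step(4-7) by (auto simp: less_Suc_eq_le Suc_le_eq)
qed

lemma fold_elim_circuit:
  fixes n N :: nat
  assumes "\<And>k. z (Work k) = 0"
  defines "z' \<equiv> fold cact (elim_circuit n N) z"
  shows "echelon n (ech_row n z')" "f2.span (ech_row n z' ` {..<n}) = f2.span ((\<lambda>j. inp_reg n j z) ` {..<N})"
    "z' (anc 3 i k) = 0"
proof -
  have anc0: "z (anc a b k) = 0" for a b k using assms(1) by (simp add: anc_def)
  have "echelon n (ech_row n z') \<and> f2.span (ech_row n z' ` {..<n}) = f2.span ((\<lambda>j. inp_reg n j z) ` {..<N}) \<and>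
      (\<forall>j\<ge>N. inp_reg n j z' = inp_reg n j z \<and> (\<forall>p. z' (anc 4 j p) = 0 \<and> z' (anc 2 j p) = 0)) \<and>
      (\<forall>i k. z' (anc 3 i k) = 0)"
    unfolding z'_def
  proof (induction N)
    case 0
    have row: "ech_row n z p = 0" for p using anc0 by (auto simp: ech_row_def fun_eq_iff)
    then have "ech_row n z ` {..<n} \<subseteq> {0}" by auto
    then have "f2.span (ech_row n z ` {..<n}) = f2.span {}"
      by (metis f2.span_insert_0 subset_singleton_iff)
    moreover have "echelon n (ech_row n z)" unfolding echelon_def row by simp
    ultimately show ?case using anc0 by (simp add: elim_circuit_def)
  next
    case (Suc N)
    let ?y = "fold cact (elim_circuit n N) z"
    let ?y' = "fold cact (insert_circuit n N n) ?y"
    have y': "fold cact (elim_circuit n (Suc N)) z = ?y'" by (simp add: elim_circuit_def)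
    have ins: "echelon n (ech_row n ?y')" "\<forall>k<n. inp_reg n N ?y' k = 0"
      "f2.span (insert (inp_reg n N ?y') (ech_row n ?y' ` {..<n})) = f2.span (insert (inp_reg n N ?y) (ech_row n ?y ` {..<n}))"
      "\<And>j'. j' \<noteq> N \<Longrightarrow> inp_reg n j' ?y' = inp_reg n j' ?y"
      "\<And>j' p'. j' \<noteq> N \<Longrightarrow> ?y' (anc 4 j' p') = ?y (anc 4 j' p') \<and> ?y' (anc 2 j' p') = ?y (anc 2 j' p')"
      "\<And>i k. ?y' (anc 3 i k) = ?y (anc 3 i k)"
      using fold_insert_circuit [of n ?y N n] Suc by auto
    \<comment> \<open>After all \<open>n\<close> columns nothing is left of the vector, so it drops
      out of the span.\<close>
    have "inp_reg n N ?y' = 0"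
      using ins(2) by (auto simp: inp_reg_def fun_eq_iff)
    then have "f2.span (ech_row n ?y' ` {..<n}) = f2.span (insert (inp_reg n N ?y) (ech_row n ?y ` {..<n}))"
      using ins(3) by simp
    also have "\<dots> = f2.span (insert (inp_reg n N z) ((\<lambda>j. inp_reg n j z) ` {..<N}))"
      using Suc by (simp add: f2.span_insert)
    also have "insert (inp_reg n N z) ((\<lambda>j. inp_reg n j z) ` {..<N}) = (\<lambda>j. inp_reg n j z) ` {..<Suc N}"
      by (auto simp: lessThan_Suc)
    finally show ?case
      unfolding y' using ins(1,4-6) Suc by auto
  qed
  then show "echelon n (ech_row n z')" "f2.span (ech_row n z' ` {..<n}) = f2.span ((\<lambda>j. inp_reg n j z) ` {..<N})"
    "z' (anc 3 i k) = 0" by auto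
qed

text \<open>A missing pivot means a zero row, so fewer than \<open>n\<close> generators. Conversely,
  let \<open>t\<close> be orthogonal to all rows and \<open>p\<close> its last nonzero position: row
  \<open>p\<close> vanishes before \<open>p\<close> and \<open>t\<close> after it, so their inner
  product is the diagonal entry, which must be 0.\<close>

lemma dim_echelon:
  assumes "echelon n R"
  shows "f2.dim (f2.span (R ` {..<n})) < n \<longleftrightarrow> \<not> (\<forall>p<n. R p p = 1)"
proof
  assume "\<not> (\<forall>p<n. R p p = 1)"
  then obtain p where p: "p < n" "R p = 0" using assms by (auto simp: echelon_def)
  then have "R ` {..<n} = insert 0 (R ` ({..<n} - {p}))" by (auto simp: image_iff)
  then have "f2.span (R ` {..<n}) = f2.span (R ` ({..<n} - {p}))" by simp
  then have "f2.dim (f2.span (R ` {..<n})) \<le> card (R ` ({..<n} - {p}))"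
    by (intro f2.dim_le_card) auto
  also have "\<dots> \<le> card ({..<n} - {p})" by (rule card_image_le) simp
  finally show "f2.dim (f2.span (R ` {..<n})) < n" using p by simp
next
  have sub: "R ` {..<n} \<subseteq> bits n" using assms by (auto simp: echelon_def)
  assume "f2.dim (f2.span (R ` {..<n})) < n"
  then obtain t where t: "t \<in> bits n" "t \<noteq> 0" "\<And>p. p < n \<Longrightarrow> dot n t (R p) = 0"
    unfolding rank_deficient_iff [OF sub] by auto
  define p where "p = Max {k. k < n \<and> t k = 1}"
  from t(2) obtain k where "t k = 1" by (force simp: fun_eq_iff)
  moreover from this have "k < n" using t(1) by (metis bits_eq_0 leI zero_neq_one)
  ultimately have "p \<in> {k. k < n \<and> t k = 1}" unfolding p_def by (intro Max_in) auto
  then have p: "p < n" "t p = 1" by auto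
  have above: "t k = 0" if "k > p" "k < n" for k
    using Max_ge [of "{k. k < n \<and> t k = 1}" k] that bit_cases [of "t k"] unfolding p_def by fastforce
  have below: "R p k = 0" if "k < p" for k using assms p that by (auto simp: echelon_def)
  have "t k * R p k = (if k = p then R p p else 0)" if "k < n" for k
    using above below p that by (cases k p rule: linorder_cases) auto
  then have "dot n t (R p) = R p p" using p by (simp add: dot_def)
  then show "\<not> (\<forall>p<n. R p p = 1)" using t(3) p(1) by auto
qed

lemma run_rank_circuit:
  assumes "clean \<psi>"
  shows "run F g m n (rank_circuit n (c * n)) \<psi> = (\<lambda>z. \<psi> (rank_flip c n z))"
proof
  fix z
  let ?P = "rank_prep n (c * n)"
  have cl: "\<forall>x\<in>set ?P. classical x" "\<forall>x\<in>set ?P. Flag \<notin> gate_qubits x"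
    by (auto simp: rank_prep_def elim_circuit_def insert_circuit_def pivot_step_def conj_chain_def)
  have run: "run F g m n (rank_circuit n (c * n)) \<psi> z = \<psi> (z(Flag := z Flag + (1 + fold cact ?P z (anc 3 n 0))))"
    unfolding rank_circuit_def by (subst run_flag_conj [OF cl]) auto
  show "run F g m n (rank_circuit n (c * n)) \<psi> z = \<psi> (rank_flip c n z)"
  proof (cases "\<forall>k. z (Work k) = 0")
    case True
    let ?y = "fold cact (elim_circuit n (c * n)) z"
    note elim = fold_elim_circuit [of z n "c * n", OF spec [OF True]]
    have "fold cact ?P z (anc 3 n 0) = (if \<forall>p<n. ?y (anc 0 p p) = 1 then 1 else 0)"
      unfolding rank_prep_def fold_append o_apply by (rule fold_conj_chain) (auto simp: elim)
    moreover have "(\<forall>p<n. ?y (anc 0 p p) = 1) \<longleftrightarrow> (\<forall>p<n. ech_row n ?y p p = 1)"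
      by (simp add: ech_row_def)
    ultimately show ?thesis
      using dim_echelon [OF elim(1)] by (auto simp: run rank_flip_def elim(2))
  next
    case False
    \<comment> \<open>With an occupied ancilla both sides are amplitudes of unclean configurations,
      since only the flag has been changed, and so both are 0.\<close>
    then have "\<exists>k. (z(Flag := v)) (Work k) \<noteq> 0" for v by simp
    then have "\<psi> (z(Flag := v)) = 0" for v using assms unfolding clean_def by blast
    then show ?thesis by (simp add: run rank_flip_def)
  qed
qed

section \<open>Query counts and running time\<close>

definition step_circuit :: "nat \<Rightarrow> nat \<Rightarrow> nat \<Rightarrow> step \<Rightarrow> gate list" where
  "step_circuit c n m s = (case s of Gate x \<Rightarrow> [x] | Rank_Flip \<Rightarrow> rank_circuit n (c * n)
     | Reflect_Zero \<Rightarrow> reflect_circuit m | Negate \<Rightarrow> negate_circuit)"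

lemma step_circuit_simps [simp]:
  "step_circuit c n m (Gate x) = [x]" "step_circuit c n m Rank_Flip = rank_circuit n (c * n)"
  "step_circuit c n m Reflect_Zero = reflect_circuit m" "step_circuit c n m Negate = negate_circuit"
  by (simp_all add: step_circuit_def)

lemma elementary_step_circuit:
  assumes "s \<in> {Rank_Flip, Reflect_Zero, Negate}" "x \<in> set (step_circuit c n m s)"
  shows "elementary x"
  using assms
  by (auto simp: rank_circuit_def rank_prep_def elim_circuit_def insert_circuit_def pivot_step_def
      conj_chain_def reflect_circuit_def reflect_prep_def negate_circuit_def phase_def)

lemma implementation_step_circuit: "implementation c n m (step_circuit c n m)"
  unfolding implementation_def
  using elementary_step_circuit
  by (auto simp: run_rank_circuit run_reflect_circuit run_negate_circuit apply_Rank_Flip)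

lemma clean_supp_on: "supp_on (qubits m n l N) \<psi> \<Longrightarrow> clean \<psi>"
  unfolding clean_def supp_on_def in_vecs_qubits by blast

text \<open>The isometry hypothesis keeps the state supported away from the ancillas after every
  step, so the next circuit again starts from a clean state.\<close>

lemma run_compile:
  assumes circ: "implementation c n m circ"
    and isom: "\<And>s. s \<in> set P \<Longrightarrow> isom (qubits m n l N) (apply_step F g c m n s)"
    and "supp_on (qubits m n l N) \<psi>"
  shows "run F g m n (compile circ P) \<psi> = fold (apply_step F g c m n) P \<psi>"
  using isom assms(3)
proof (induction P arbitrary: \<psi>)
  case Nil
  then show ?case by (simp add: compile_def run_def)
next
  case (Cons s P)
  have "run F g m n (circ s) \<psi> = apply_step F g c m n s \<psi>"
    using circ clean_supp_on [OF Cons.prems(2)]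
    by (cases s) (auto simp: implementation_def run_def)
  moreover have "supp_on (qubits m n l N) (apply_step F g c m n s \<psi>)"
    by (rule isomD(1) [OF Cons.prems]) simp
  moreover have "compile circ (s # P) = circ s @ compile circ P"
    by (simp add: compile_def)
  ultimately show ?case
    using Cons by (simp add: run_append)
qed

lemma compile_append: "compile circ (P @ P') = compile circ P @ compile circ P'"
  by (simp add: compile_def)

lemma compile_Gates: "compile (step_circuit c n m) (map Gate C) = C"
  by (induction C) (simp_all add: compile_def)

lemma compile_rev_Gates: "compile (step_circuit c n m) (rev (map Gate C)) = rev C"
  by (simp only: rev_map compile_Gates)

lemma compile_concat_replicate:
  "compile circ (concat (replicate k P)) = concat (replicate k (compile circ P))"
  by (induction k) (simp_all add: compile_append, simp add: compile_def)

lemma count_simps: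
  "queries_F (C @ D) = queries_F C + queries_F D" "queries_g (C @ D) = queries_g C + queries_g D"
  "queries_F (concat (replicate k C)) = k * queries_F C" "queries_g (concat (replicate k C)) = k * queries_g C"
  "queries_F (rev C) = queries_F C" "queries_g (rev C) = queries_g C"
  "queries_F (map Query_F js) = length js" "queries_F (map Query_g js) = 0" "queries_F (map Hadamard qs) = 0"
  "queries_g (map Query_F js) = 0" "queries_g (map Query_g js) = length js" "queries_g (map Hadamard qs) = 0"
proof -
  show "queries_F (concat (replicate k C)) = k * queries_F C" "queries_g (concat (replicate k C)) = k * queries_g C"
    by (induction k) (simp_all add: queries_F_def queries_g_def)
qed (simp_all add: queries_F_def queries_g_def comp_def flip: rev_filter)

lemma queries_elementary: "\<forall>x\<in>set C. elementary x \<Longrightarrow> queries_F C = 0 \<and> queries_g C = 0"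
proof -
  assume "\<forall>x\<in>set C. elementary x"
  then have "\<forall>x\<in>set C. \<not> is_Query_F x \<and> \<not> is_Query_g x"
    by (metis elementary.simps(5,6) is_Query_F_def is_Query_g_def)
  then show ?thesis by (simp add: queries_F_def queries_g_def filter_empty_conv)
qed

lemma circuit_time_le: "circuit_time T C \<le> queries_F C * T + length C"
  by (induction C) (auto simp: circuit_time_def queries_F_def)

lemma length_inp_list: "length (inp_list n N) = N * n"
  by (simp add: inp_list_def length_concat comp_def sum_list_triv)

text \<open>\<open>N * n\<close> pivot steps of \<open>2 * n + 3\<close> gates and a conjunction,
  all done twice because of the uncomputation. With \<open>N = c * n\<close> this is the cubic term
  of the running time.\<close>

lemma length_rank_circuit: "length (rank_circuit n N) = 2 * (N * (n * (2 * n + 3)) + n + 1) + 2"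
  by (simp add: rank_circuit_def rank_prep_def elim_circuit_def insert_circuit_def pivot_step_def
      conj_chain_def length_concat comp_def sum_list_triv algebra_simps)

lemma length_reflect_circuit: "length (reflect_circuit m) = 4 * m + 5"
  by (simp add: reflect_circuit_def reflect_prep_def conj_chain_def phase_def)

lemma length_negate_circuit: "length negate_circuit = 8"
  by (simp add: negate_circuit_def phase_def)

abbreviation offline_circuit :: "nat \<Rightarrow> nat \<Rightarrow> nat \<Rightarrow> gate list" where
  "offline_circuit c n m \<equiv> compile (step_circuit c n m) (offline_phase c n m)"

lemma offline_circuit_eq:
  "offline_circuit c n m =
    map Hadamard (map Index [0..<m]) @ [PauliX Flag, Hadamard Flag] @
    concat (replicate (grover_count m)
      (map Query_F [0..<c * n] @ map Hadamard (inp_list n (c * n)) @ rank_circuit n (c * n) @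
       rev (map Query_F [0..<c * n] @ map Hadamard (inp_list n (c * n))) @
       map Hadamard (map Index [0..<m]) @ reflect_circuit m @ map Hadamard (map Index [0..<m]) @ negate_circuit))"
proof -
  have gates: "map (\<lambda>k. Gate (Hadamard (Index k))) [0..<m] = map Gate (map Hadamard (map Index [0..<m]))"
    by simp
  have single: "compile (step_circuit c n m) [s] = step_circuit c n m s" for s
    by (simp add: compile_def)
  have two: "[Gate (PauliX Flag), Gate (Hadamard Flag)] = map Gate [PauliX Flag, Hadamard Flag]" by simp
  show ?thesis
    unfolding offline_phase_def grover_iteration_eq test_eq test_prep_def gates two
    by (simp only: compile_append compile_concat_replicate compile_Gates compile_rev_Gates single
        step_circuit_simps append_assoc)
qed

lemma queries_circuits:
  "queries_F (rank_circuit n N) = 0" "queries_g (rank_circuit n N) = 0"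
  "queries_F (reflect_circuit m) = 0" "queries_g (reflect_circuit m) = 0"
  "queries_F negate_circuit = 0" "queries_g negate_circuit = 0"
proof -
  have "\<forall>x\<in>set (rank_circuit n N). elementary x"
    by (auto simp: rank_circuit_def rank_prep_def elim_circuit_def insert_circuit_def pivot_step_def conj_chain_def)
  then show "queries_F (rank_circuit n N) = 0" "queries_g (rank_circuit n N) = 0"
    using queries_elementary by auto
  have "\<forall>x\<in>set (reflect_circuit m). elementary x" "\<forall>x\<in>set negate_circuit. elementary x"
    using elementary_step_circuit [of Reflect_Zero _ 0 0 m] elementary_step_circuit [of Negate _ 0 0 0] by auto
  then show "queries_F (reflect_circuit m) = 0" "queries_g (reflect_circuit m) = 0"
    "queries_F negate_circuit = 0" "queries_g negate_circuit = 0"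
    using queries_elementary by auto
qed

lemma queries_offline:
  "queries_F (offline_circuit c n m) = grover_count m * (2 * (c * n))"
  "queries_g (offline_circuit c n m) = 0"
proof -
  have [simp]: "queries_F [PauliX Flag, Hadamard Flag] = 0" "queries_g [PauliX Flag, Hadamard Flag] = 0"
    by (simp_all add: queries_F_def queries_g_def)
  show "queries_F (offline_circuit c n m) = grover_count m * (2 * (c * n))"
    "queries_g (offline_circuit c n m) = 0"
    unfolding offline_circuit_eq count_simps queries_circuits by simp_all
qed

lemma length_offline:
  "length (offline_circuit c n m) = m + 2 + grover_count m *
     (2 * (c * n + c * n * n) + (2 * (c * n * (n * (2 * n + 3)) + n + 1) + 2) + 2 * m + (4 * m + 5) + 8)"
  unfolding offline_circuit_eq
  by (simp add: length_concat sum_list_replicate length_inp_list length_rank_circuit length_reflect_circuit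
      length_negate_circuit algebra_simps)

lemma queries_online: "queries_F (online_phase c n) = 0" "queries_g (online_phase c n) = c * n"
proof -
  have "online_phase c n = map Hadamard (inp_list n (c * n)) @ map Query_g [0..<c * n]"
    by (simp add: online_phase_def inp_list_def map_concat comp_def)
  then show "queries_F (online_phase c n) = 0" "queries_g (online_phase c n) = c * n"
    by (simp_all add: count_simps)
qed

text \<open>Uses \<open>sin x \<le> x\<close> to bound the angle from below, and
  \<open>pi < 4\<close> to remove the constant.\<close>

lemma grover_count_le: "real (grover_count m) \<le> 2 powr (real m / 2)"
proof -
  let ?\<theta> = "grover_angle m"
  have \<theta>: "?\<theta> > 0" by (rule grover_angle_bounds)
  have "2 powr (- real m / 2) = sin ?\<theta>"
    by (simp only: sin_grover_angle powr_half_minus)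
  also have "\<dots> \<le> ?\<theta>" using \<theta> by (intro sin_x_le_x) simp
  finally have le: "2 powr (- real m / 2) \<le> ?\<theta>" .
  have "real (grover_count m) \<le> pi / (4 * ?\<theta>)"
    unfolding grover_count_def grover_angle_def [symmetric] using \<theta> by (intro of_nat_floor) simp
  also have "\<dots> \<le> 1 / ?\<theta>"
    using \<theta> pi_less_4 by (simp add: divide_simps)
  also have "\<dots> \<le> 1 / 2 powr (- real m / 2)"
    using le by (intro divide_left_mono) (auto intro: mult_pos_pos \<theta>)
  also have "\<dots> = 2 powr (real m / 2)"
    by (simp add: powr_minus_divide)
  finally show ?thesis .
qed

text \<open>The extra \<open>m\<close> allows for measuring the index qubits. One iteration costs
  \<open>L\<close> gates, at most \<open>14 * c + 6 * \<kappa> + 19\<close> times the cube of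
  \<open>n\<close>; preparation and measurement contribute \<open>2 * m + 2\<close>, which accounts
  for the remaining \<open>2 * \<kappa> + 2\<close>.\<close>

lemma time_bound:
  fixes \<kappa> :: real
  assumes n: "n \<ge> 1" and m: "real m \<le> \<kappa> * real n"
  shows "real (circuit_time T (offline_circuit c n m) + m)
    \<le> (14 * real c + 8 * \<kappa> + 21) * (real n ^ 3 + real n * real T) * 2 powr (real m / 2)"
proof -
  let ?D = "2 powr (real m / 2)" and ?K = "real (grover_count m)"
  have D: "?D \<ge> 1" by (simp add: ge_one_powr_ge_zero)
  have K: "?K \<le> ?D" by (rule grover_count_le)
  have n1: "real n \<ge> 1" using n by simp
  have n3: "1 \<le> real n ^ 3" "real n \<le> real n ^ 3" "real n * real n \<le> real n ^ 3"
    using n1 power_increasing [of 0 3 "real n"] power_increasing [of 1 3 "real n"] power_increasing [of 2 3 "real n"]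
    by (simp_all add: power2_eq_square)
  have \<kappa>: "\<kappa> \<ge> 0"
  proof (rule ccontr)
    assume "\<not> \<kappa> \<ge> 0"
    then have "\<kappa> * real n < 0" using n1 by (intro mult_neg_pos) auto
    then show False using m by linarith
  qed
  have m3: "real m \<le> \<kappa> * real n ^ 3"
    using m mult_left_mono [OF n3(2) \<kappa>] by linarith
  define L where "L = 2 * (c * n + c * n * n) + (2 * (c * n * (n * (2 * n + 3)) + n + 1) + 2) + 2 * m + (4 * m + 5) + 8"
  have "real L = 4 * real c * real n ^ 3 + 8 * (real c * (real n * real n)) + 2 * (real c * real n) + 2 * real n + 17 + 6 * real m"
    by (simp add: L_def algebra_simps power3_eq_cube)
  also have "\<dots> \<le> 4 * real c * real n ^ 3 + 8 * (real c * real n ^ 3) + 2 * (real c * real n ^ 3) + 2 * real n ^ 3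
      + 17 * real n ^ 3 + 6 * (\<kappa> * real n ^ 3)"
    using n3 m3 mult_left_mono [OF n3(2), of "real c"] mult_left_mono [OF n3(3), of "real c"] by linarith
  also have "\<dots> = (14 * real c + 6 * \<kappa> + 19) * real n ^ 3"
    by (simp add: algebra_simps)
  finally have L: "real L \<le> (14 * real c + 6 * \<kappa> + 19) * real n ^ 3" .
  have "real (circuit_time T (offline_circuit c n m) + m)
      \<le> real (queries_F (offline_circuit c n m) * T + length (offline_circuit c n m) + m)"
    using circuit_time_le by (intro of_nat_mono add_right_mono)
  also have "\<dots> = ?K * (2 * real c * (real n * real T)) + ?K * real L + (2 * real m + 2)"
    unfolding queries_offline length_offline L_def [symmetric] by (simp add: algebra_simps)
  also have "\<dots> \<le> ?D * (2 * real c * (real n * real T)) + ?D * ((14 * real c + 6 * \<kappa> + 19) * real n ^ 3)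
      + ?D * ((2 * \<kappa> + 2) * real n ^ 3)"
  proof (intro add_mono mult_mono K L)
    have "2 * real m + 2 \<le> (2 * \<kappa> + 2) * real n ^ 3"
      using m3 n3(1) by (simp add: algebra_simps)
    also have "\<dots> \<le> ?D * ((2 * \<kappa> + 2) * real n ^ 3)"
      using mult_right_mono [OF D, of "(2 * \<kappa> + 2) * real n ^ 3"] \<kappa> by simp
    finally show "2 * real m + 2 \<le> ?D * ((2 * \<kappa> + 2) * real n ^ 3)" .
  qed auto
  also have "\<dots> = ?D * (2 * real c * (real n * real T)) + ?D * ((14 * real c + 8 * \<kappa> + 21) * real n ^ 3)"
    by (simp add: algebra_simps)
  also have "\<dots> \<le> ?D * ((14 * real c + 8 * \<kappa> + 21) * (real n * real T)) + ?D * ((14 * real c + 8 * \<kappa> + 21) * real n ^ 3)"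
    using \<kappa> by (intro add_right_mono mult_left_mono mult_right_mono) auto
  also have "\<dots> = (14 * real c + 8 * \<kappa> + 21) * (real n ^ 3 + real n * real T) * ?D"
    by (simp add: algebra_simps)
  finally show ?thesis .
qed

text \<open>After squaring, everything is 4 times an n-th power whose base depends on
  \<open>c\<close> and \<open>\<kappa>\<close> alone. Since \<open>n \<ge> 1\<close>, a base of at
  most 1/64 suffices, as \<open>4 / 64\<close> is the square of 1/4.\<close>

lemma error_bound:
  fixes \<kappa> :: real
  assumes n: "n \<ge> 1" and m: "real m \<le> \<kappa> * real n" and c: "2 powr \<kappa> * 2 * (3/4) ^ c \<le> 1 / 64"
  shows "real (grover_count m) * (2 * sqrt (2 ^ n * (3/4) ^ (c * n))) \<le> 1 / 4"
proof (rule power2_le_imp_le)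
  have "(2 powr (real m / 2))\<^sup>2 = 2 powr real m"
    by (simp add: powr_power)
  also have "\<dots> \<le> 2 powr (\<kappa> * real n)" using m by simp
  also have "\<dots> = (2 powr \<kappa>) ^ n" by (simp add: powr_power mult.commute)
  finally have "(real (grover_count m))\<^sup>2 \<le> (2 powr \<kappa>) ^ n"
    using power_mono [OF grover_count_le [of m] of_nat_0_le_iff, of 2] by linarith
  then have "(real (grover_count m) * (2 * sqrt (2 ^ n * (3/4) ^ (c * n))))\<^sup>2
      \<le> (2 powr \<kappa>) ^ n * (4 * (2 ^ n * (3/4) ^ (c * n)))"
    by (simp add: power_mult_distrib)
  also have "\<dots> = 4 * (2 powr \<kappa> * 2 * (3/4) ^ c) ^ n"
    by (simp add: power_mult_distrib power_mult)
  also have "\<dots> \<le> 4 * (1 / 64) ^ n"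
    using c by (intro mult_left_mono power_mono) auto
  also have "\<dots> \<le> 4 * (1 / 64) ^ 1"
    using n by (intro mult_left_mono power_decreasing) auto
  finally show "(real (grover_count m) * (2 * sqrt (2 ^ n * (3/4) ^ (c * n))))\<^sup>2 \<le> (1 / 4)\<^sup>2"
    by (simp add: power2_eq_square)
qed simp

lemma (in unique_period) supp_on_psi: "supp_on Qb (psi c n g)"
  unfolding supp_on_def
proof (intro allI impI)
  fix z assume z: "z \<notin> vecs Qb"
  show "psi c n g z = 0"
  proof (rule ccontr)
    assume "psi c n g z \<noteq> 0"
    then have p: "\<And>k. z (Index k) = 0" "\<And>j k. j < N \<and> k < n \<or> z (Inp j k) = 0" "\<And>j k. j < N \<or> z (Outp j k) = 0"
      "\<And>k. z (Work k) = 0" "\<And>j. j < N \<Longrightarrow> outp j z = g (inp_reg n j z)"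
      unfolding psi_eq by (auto split: if_splits)
    have "k < l \<or> outp j z k = 0" if "j < N" for j k
      using g_in [OF inp_reg_in_bits, unfolded in_bits] p(5) [OF that] by simp
    then have "j < N \<and> k < l \<or> z (Outp j k) = 0" for j k
      using p(3) [of j k] unfolding outp_def by blast
    then show False using z p(1,2,4) unfolding in_vecs_qubits by blast
  qed
qed

lemma queries_online_offline:
  "queries_F (online_phase c n @ offline_circuit c n m) = 2 * c * n * grover_count m"
  "queries_g (online_phase c n @ offline_circuit c n m) = c * n"
  by (simp_all add: count_simps queries_offline queries_online)

lemma queries_F_bound:
  assumes "C \<ge> 2 * real c"
  shows "real (queries_F (online_phase c n @ offline_circuit c n m)) \<le> C * real n * 2 powr (real m / 2)"
proof -
  have "real (queries_F (online_phase c n @ offline_circuit c n m)) = (2 * real c * real n) * real (grover_count m)"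
    by (simp add: queries_online_offline)
  also have "\<dots> \<le> (C * real n) * 2 powr (real m / 2)"
    using assms by (intro mult_mono grover_count_le mult_right_mono) auto
  finally show ?thesis .
qed

lemma run_online_offline:
  assumes n: "n \<ge> 1" and m: "real m \<le> \<kappa> * real n" and c: "2 powr \<kappa> * 2 * (3/4) ^ c \<le> 1 / 64"
    and *: "(\<forall>i\<in>bits m. \<forall>x\<in>bits n. F i x \<in> bits l) \<and>
       (\<forall>x\<in>bits n. g x \<in> bits l) \<and>
       {i \<in> bits m. has_period n (\<lambda>x. F i x + g x)} = {i0} \<and>
       (\<forall>i\<in>bits m - {i0}. \<forall>t\<in>bits n - {0}.
          measure_pmf.prob (pmf_of_set (bits n))
            {x. F i (x + t) + g (x + t) = F i x + g x} \<le> 1 / 2)"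
  shows "1 / 16 \<le> outcome_prob m (run F g m n (online_phase c n @ offline_circuit c n m) zero_state) i0"
    "outcome_prob m (run F g m n (online_phase c n @ offline_circuit c n m) zero_state) i0 \<le> 1"
proof -
  interpret unique_period F g c m n l i0
  proof
    have "i0 \<in> {i \<in> bits m. has_period n (\<lambda>x. F i x + g x)}" using * by blast
    then show "i0 \<in> bits m" "has_period n (\<lambda>x. F i0 x + g x)" by auto
    show "real (card {x \<in> bits n. F i (x + t) + g (x + t) = F i x + g x}) \<le> 2 ^ n / 2"
      if "i \<in> bits m" "i \<noteq> i0" "t \<in> bits n" "t \<noteq> 0" for i t
    proof -
      have "bits n \<noteq> {}" using zero_in_bits by blast
      then have "measure_pmf.prob (pmf_of_set (bits n)) {x. F i (x + t) + g (x + t) = F i x + g x}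
        = real (card (bits n \<inter> {x. F i (x + t) + g (x + t) = F i x + g x})) / 2 ^ n"
        by (simp add: measure_pmf_of_set card_bits)
      moreover have "measure_pmf.prob (pmf_of_set (bits n)) {x. F i (x + t) + g (x + t) = F i x + g x} \<le> 1 / 2"
        using * that by blast
      ultimately have "real (card (bits n \<inter> {x. F i (x + t) + g (x + t) = F i x + g x})) / 2 ^ n \<le> 1 / 2"
        by linarith
      then show ?thesis by (simp add: Int_def divide_simps)
    qed
  qed (use * in blast)+
  have run: "run F g m n (online_phase c n @ offline_circuit c n m) zero_state =
      fold (apply_step F g c m n) (offline_phase c n m) (psi c n g)"
    unfolding run_append run_online_phase
    by (rule run_compile [OF implementation_step_circuit isom_offline_steps supp_on_psi])
  show "1 / 16 \<le> outcome_prob m (run F g m n (online_phase c n @ offline_circuit c n m) zero_state) i0"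
    "outcome_prob m (run F g m n (online_phase c n @ offline_circuit c n m) zero_state) i0 \<le> 1"
    unfolding run by (rule outcome_prob_bounds [OF error_bound [OF n m c]])+
qed

text \<open>The circuits are chosen from \<open>c\<close>, \<open>n\<close> and \<open>m\<close>
  before \<open>l\<close>, the oracles and \<open>i0\<close> are given, and \<open>p\<close> and
  \<open>C\<close> even before \<open>n\<close> and \<open>m\<close>; so one family of circuits and
  constants serves all instances.\<close>

theorem proposition2:
  fixes K :: real
  shows "\<exists>c0::nat. c0 > 0 \<and> (\<forall>c\<ge>c0. \<exists>p>0. \<exists>C>0. \<forall>n m :: nat. n \<ge> 1 \<and> real m \<le> K * real n \<longrightarrow>
    (\<exists>circ. implementation c n m circ \<and>
      (let online = online_phase c n;
           offline = compile circ (offline_phase c n m)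
       in real (queries_g (online @ offline)) \<le> C * real n \<and>
          queries_g offline = 0 \<and>
          real (queries_F (online @ offline)) \<le> C * real n * 2 powr (real m / 2) \<and>
          (\<forall>T_F :: nat. real (circuit_time T_F offline + m)
             \<le> C * (real n ^ 3 + real n * real T_F) * 2 powr (real m / 2)) \<and>
          (\<forall>(l :: nat) (F :: (nat \<Rightarrow> bit) \<Rightarrow> (nat \<Rightarrow> bit) \<Rightarrow> (nat \<Rightarrow> bit))
              (g :: (nat \<Rightarrow> bit) \<Rightarrow> (nat \<Rightarrow> bit)) (i0 :: nat \<Rightarrow> bit).
             (\<forall>i\<in>bits m. \<forall>x\<in>bits n. F i x \<in> bits l) \<and>
             (\<forall>x\<in>bits n. g x \<in> bits l) \<and>
             {i \<in> bits m. has_period n (\<lambda>x. F i x + g x)} = {i0} \<and>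
             (\<forall>i\<in>bits m - {i0}. \<forall>t\<in>bits n - {0}.
                measure_pmf.prob (pmf_of_set (bits n))
                  {x. F i (x + t) + g (x + t) = F i x + g x} \<le> 1 / 2)
             \<longrightarrow> run F g m n online zero_state = psi c n g \<and>
                 p \<le> outcome_prob m (run F g m n (online @ offline) zero_state) i0 \<and>
                 outcome_prob m (run F g m n (online @ offline) zero_state) i0 \<le> 1))))"
proof -
  obtain c1 where c1: "(3/4 :: real) ^ c1 < 1 / (64 * (2 powr K * 2))"
    using real_arch_pow_inv [of "1 / (64 * (2 powr K * 2))" "3/4"] by auto
  have small: "2 powr K * 2 * (3/4) ^ c \<le> 1 / 64" if "c \<ge> Suc c1" for c
  proof -
    have "(3/4 :: real) ^ c \<le> (3/4) ^ c1" using that by (intro power_decreasing) auto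
    then have "(3/4 :: real) ^ c \<le> 1 / (64 * (2 powr K * 2))" using c1 by linarith
    then show ?thesis by (simp add: field_simps)
  qed
  \<comment> \<open>The absolute value keeps the constant positive for negative \<open>K\<close>,
    since it has to be chosen before \<open>n\<close> and \<open>m\<close>.\<close>
  let ?C = "\<lambda>c. 14 * real c + 8 * \<bar>K\<bar> + 21"
  have abs: "real m \<le> \<bar>K\<bar> * real n" if "real m \<le> K * real n" for m n
    using that mult_right_mono [OF abs_ge_self [of K] of_nat_0_le_iff [of n]] by linarith
  have qg: "real (queries_g (online_phase c n @ offline_circuit c n m)) \<le> ?C c * real n" for c n m
    by (simp add: queries_online_offline distrib_right)
  have qF: "real (queries_F (online_phase c n @ offline_circuit c n m)) \<le> ?C c * real n * 2 powr (real m / 2)" for c n m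
    by (rule queries_F_bound) simp
  show ?thesis
    \<comment> \<open>The successor makes the threshold for \<open>c\<close> positive.\<close>
    apply (rule exI [of _ "Suc c1"], intro conjI allI impI, simp)
    subgoal for c
      apply (rule exI [of _ "1 / 16"], rule conjI, simp, rule exI [of _ "?C c"], rule conjI, simp)
      apply (intro allI impI, elim conjE)
      subgoal premises prems for n m
        unfolding Let_def
        by (intro exI [of _ "step_circuit c n m"] conjI implementation_step_circuit qg queries_offline(2) qF
            allI impI time_bound [OF prems(2) abs] run_online_phase prems(3))
           (erule run_online_offline [OF prems(2,3) small [OF prems(1)]])+
      done
    done
qed

end
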